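(* Let $C\subset\mathbb{P}^3$ be a non-singular complete intersection defined by $q=a_0x_0^2+a_1x_1^2+a_2x_2^2+a_3x_3^2=0$ and $r=b_0x_0^2+b_1x_1^2+b_2x_2^2+b_3x_3^2=0$ with integral coefficients $a_i,b_i$. Then for every $\varepsilon>0$ and $B\geq 1$, $$N(B)\ll_{\varepsilon} \frac{B^{1/2+\varepsilon}}{H(C)^{1/8}}+\log B+1,$$ where the implied constant depends only on $\varepsilon$.
   Context: For $P=[x_0,x_1,x_2,x_3]\in\mathbb{P}^3(\mathbb{Q})$ with coprime integer coordinates, $H(P)=\max_i|x_i|$, and $N(B)=\#\{P\in C(\mathbb{Q}): H(P)\leq B\}$. With $d_{ij}=a_ib_j-a_jb_i$ for $0\leq i<j\leq 3$, the height of $C$ is $H(C)=\max_{0\leq i<j\leq 3}|d_{ij}|\,/\,\gcd_{0\leq i<j\leq 3}(d_{ij})$ (the height of the Plücker point $(d_{ij})\in\mathbb{P}^5(\mathbb{Q})$ of the span of $q$ and $r$). *)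

theory Defs
  imports "HOL-Analysis.Analysis"
begin

text \<open>The four homogeneous coordinates are indexed by the numeral type \<open>4\<close>, whose elements
  are \<open>0 < 1 < 2 < 3\<close> (with \<open>4 = 0\<close>).\<close>

definition diag_form :: "int ^ 4 \<Rightarrow> 'a::comm_ring_1 ^ 4 \<Rightarrow> 'a" where
  "diag_form a x = (\<Sum>i\<in>UNIV. of_int (a $ i) * (x $ i)\<^sup>2)"

text \<open>The row of formal partial derivatives of \<open>diag_form a\<close>.\<close>

definition diag_grad :: "int ^ 4 \<Rightarrow> 'a::comm_ring_1 ^ 4 \<Rightarrow> 'a ^ 4" where
  "diag_grad a x = (\<chi> i. 2 * of_int (a $ i) * x $ i)"

definition jacobian :: "int ^ 4 \<Rightarrow> int ^ 4 \<Rightarrow> 'a::comm_ring_1 ^ 4 \<Rightarrow> 'a ^ 4 ^ 2" where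
  "jacobian a b x = vector [diag_grad a x, diag_grad b x]"

text \<open>Jacobian criterion at all geometric points of the scheme \<open>q = r = 0\<close> in projective
  3-space. Rank 2 at every point also forces codimension 2, so that the
  intersection is complete.\<close>

definition nonsingular_ci :: "int ^ 4 \<Rightarrow> int ^ 4 \<Rightarrow> bool" where
  "nonsingular_ci a b \<longleftrightarrow>
    (\<forall>x :: complex ^ 4. x \<noteq> 0 \<longrightarrow> diag_form a x = 0 \<longrightarrow> diag_form b x = 0
       \<longrightarrow> rank (jacobian a b x) = 2)"

definition proj_rel :: "((rat ^ 4) \<times> (rat ^ 4)) set" where
  "proj_rel = {(x, y). x \<noteq> 0 \<and> y \<noteq> 0 \<and> (\<exists>c. c \<noteq> 0 \<and> y = c *s x)}"

definition proj3Q :: "(rat ^ 4) set set" where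
  "proj3Q = {x. x \<noteq> 0} // proj_rel"

definition primitive :: "int ^ 4 \<Rightarrow> bool" where
  "primitive x \<longleftrightarrow> Gcd (range (\<lambda>i. x $ i)) = 1"

definition rat_vec :: "int ^ 4 \<Rightarrow> rat ^ 4" where
  "rat_vec x = (\<chi> i. of_int (x $ i))"

definition point_height :: "(rat ^ 4) set \<Rightarrow> int" where
  "point_height P =
    (THE h. \<exists>x. primitive x \<and> rat_vec x \<in> P \<and> h = Max (range (\<lambda>i. \<bar>x $ i\<bar>)))"

definition curve_points :: "int ^ 4 \<Rightarrow> int ^ 4 \<Rightarrow> (rat ^ 4) set set" where
  "curve_points a b = {P \<in> proj3Q. \<forall>x\<in>P. diag_form a x = 0 \<and> diag_form b x = 0}"

definition count_points :: "int ^ 4 \<Rightarrow> int ^ 4 \<Rightarrow> real \<Rightarrow> nat" where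
  "count_points a b B = card {P \<in> curve_points a b. real_of_int (point_height P) \<le> B}"

definition plucker :: "int ^ 4 \<Rightarrow> int ^ 4 \<Rightarrow> 4 \<Rightarrow> 4 \<Rightarrow> int" where
  "plucker a b i j = a $ i * b $ j - a $ j * b $ i"

definition curve_height :: "int ^ 4 \<Rightarrow> int ^ 4 \<Rightarrow> real" where
  "curve_height a b =
    real_of_int (Max {\<bar>plucker a b i j\<bar> | i j. i < j}) /
    real_of_int (Gcd {plucker a b i j | i j. i < j})"

text \<open>The height is well defined, and the sets counted by \<open>count_points\<close> are finite.\<close>

lemma rat_vec_neq_0: "primitive x \<Longrightarrow> rat_vec x \<noteq> 0"
proof
  assume p: "primitive x" and z: "rat_vec x = 0"
  have "x $ i = 0" for i
    using z by (simp add: rat_vec_def vec_eq_iff)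
  then show False
    using p by (simp add: primitive_def)
qed

lemma primitive_proportional:
  assumes x: "primitive x" and y: "primitive y" and eq: "rat_vec y = c *s rat_vec x"
  shows "y = x \<or> y = - x"
proof -
  obtain m n where c: "c = of_int m / of_int n" and n: "n > 0"
    by (metis Rat_cases_nonzero Fract_of_int_quotient Rat_cases)
  have yi: "n * y $ i = m * x $ i" for i
  proof -
    have "(of_int (y $ i) :: rat) = of_int m / of_int n * of_int (x $ i)"
      using eq c by (simp add: rat_vec_def vec_eq_iff)
    then have "(of_int (n * y $ i) :: rat) = of_int (m * x $ i)"
      using n by (simp add: field_simps)
    then show ?thesis
      by (simp only: of_int_eq_iff)
  qed
  have G: "Gcd ((*) k ` range (\<lambda>i. z $ i)) = \<bar>k\<bar>" if "primitive z" for k and z :: "int ^ 4"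
    using that by (simp add: primitive_def Gcd_mult abs_mult)
  have "(*) n ` range (\<lambda>i. y $ i) = (*) m ` range (\<lambda>i. x $ i)"
    using yi by (auto simp: image_image)
  then have "\<bar>n\<bar> = \<bar>m\<bar>"
    using G[OF x, of m] G[OF y, of n] by simp
  then consider "m = n" | "m = - n" by linarith
  then show ?thesis
  proof cases
    case 1
    then show ?thesis
      using yi n by (simp add: vec_eq_iff)
  next
    case 2
    have "n * y $ i = n * (- x $ i)" for i
      using yi[of i] 2 by simp
    then have "y $ i = - x $ i" for i
      using n by (metis mult_left_cancel less_irrefl)
    then show ?thesis
      by (simp add: vec_eq_iff)
  qed
qed

lemma proj_class_proportional:
  assumes "P \<in> proj3Q" "x \<in> P" "y \<in> P"
  shows "\<exists>c. c \<noteq> 0 \<and> y = c *s x"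
proof -
  obtain z c d where "c \<noteq> 0" "x = c *s z" "d \<noteq> 0" "y = d *s z"
    using assms by (auto simp: proj3Q_def quotient_def proj_rel_def)
  then have "d / c \<noteq> 0" "y = (d / c) *s x"
    by (auto simp: vec_eq_iff)
  then show ?thesis by blast
qed

lemma point_height_eq:
  assumes "P \<in> proj3Q" "primitive x" "rat_vec x \<in> P"
  shows "point_height P = Max (range (\<lambda>i. \<bar>x $ i\<bar>))"
  unfolding point_height_def
proof (rule the_equality)
  fix h assume "\<exists>y. primitive y \<and> rat_vec y \<in> P \<and> h = Max (range (\<lambda>i. \<bar>y $ i\<bar>))"
  then obtain y where y: "primitive y" "rat_vec y \<in> P" "h = Max (range (\<lambda>i. \<bar>y $ i\<bar>))"
    by blast
  then have "y = x \<or> y = - x"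
    using assms primitive_proportional proj_class_proportional by metis
  then show "h = Max (range (\<lambda>i. \<bar>x $ i\<bar>))"
    using y(3) by auto
qed (use assms in blast)

lemma ex_primitive:
  assumes "P \<in> proj3Q"
  shows "\<exists>x. primitive x \<and> rat_vec x \<in> P"
proof -
  obtain z where z: "z \<noteq> 0" and P: "P = proj_rel `` {z}"
    using assms by (auto simp: proj3Q_def quotient_def)
  define N where "N = (\<Prod>i\<in>UNIV. snd (quotient_of (z $ i)))"
  have den: "snd (quotient_of q) > 0" for q
    by (simp add: quotient_of_denom_pos')
  have N: "N > 0"
    unfolding N_def by (simp add: prod_pos den)
  have "\<exists>w. of_int w = of_int N * z $ i" for i
  proof -
    have "snd (quotient_of (z $ i)) dvd N"
      unfolding N_def by (rule dvd_prodI) auto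
    then obtain k where k: "N = snd (quotient_of (z $ i)) * k" ..
    have "z $ i = of_int (fst (quotient_of (z $ i))) / of_int (snd (quotient_of (z $ i)))"
      by (metis prod.collapse quotient_of_div)
    then have "of_int N * z $ i = of_int (k * fst (quotient_of (z $ i)))"
      using den[of "z $ i"] k by (simp add: field_simps)
    then show ?thesis by metis
  qed
  then obtain f where f: "\<And>i. of_int (f i) = of_int N * z $ i"
    by metis
  define g where "g = Gcd (range f)"
  have g0: "g \<noteq> 0"
  proof
    assume "g = 0"
    then have "f i = 0" for i
      by (auto simp: g_def)
    then have "z $ i = 0" for i
      using f[of i] N by simp
    then show False
      using z by (simp add: vec_eq_iff)
  qed
  have "g dvd f i" for i
    by (simp add: g_def)
  then obtain h where h: "\<And>i. f i = g * h i"
    unfolding dvd_def by metis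
  define x :: "int ^ 4" where "x = (\<chi> i. h i)"
  have "range f = (*) g ` range h"
    using h by (auto simp: image_image)
  then have "g = \<bar>g\<bar> * Gcd (range h)"
    by (metis g_def Gcd_mult normalize_int_def abs_mult abs_Gcd_eq)
  moreover have "\<bar>g\<bar> = g"
    by (simp add: g_def)
  ultimately have "Gcd (range h) = 1"
    using g0 by simp
  then have x: "primitive x"
    by (simp add: primitive_def x_def)
  have "rat_vec x = (of_int N / of_int g) *s z"
  proof -
    have "(of_int (h i) :: rat) = of_int N / of_int g * z $ i" for i
      using f[of i] h[of i] g0 by (simp add: field_simps)
    then show ?thesis
      by (simp add: rat_vec_def x_def vec_eq_iff)
  qed
  moreover have "(of_int N / of_int g :: rat) \<noteq> 0"
    using N g0 by simp
  ultimately have "rat_vec x \<in> P"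
    using z rat_vec_neq_0[OF x] unfolding P proj_rel_def by blast
  then show ?thesis
    using x by blast
qed

lemma finite_count_points: "finite {P \<in> curve_points a b. real_of_int (point_height P) \<le> B}"
proof -
  define V where "V = {x :: int ^ 4. \<forall>i. x $ i \<in> {- \<lfloor>B\<rfloor>..\<lfloor>B\<rfloor>}}"
  have "finite (vec_lambda ` (UNIV \<rightarrow>\<^sub>E {- \<lfloor>B\<rfloor>..\<lfloor>B\<rfloor>} :: (4 \<Rightarrow> int) set))"
    by (intro finite_imageI finite_PiE) auto
  moreover have "V \<subseteq> vec_lambda ` (UNIV \<rightarrow>\<^sub>E {- \<lfloor>B\<rfloor>..\<lfloor>B\<rfloor>} :: (4 \<Rightarrow> int) set)"
  proof
    fix x assume "x \<in> V"
    then show "x \<in> vec_lambda ` (UNIV \<rightarrow>\<^sub>E {- \<lfloor>B\<rfloor>..\<lfloor>B\<rfloor>} :: (4 \<Rightarrow> int) set)"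
      by (intro image_eqI[of _ _ "vec_nth x"]) (auto simp: V_def)
  qed
  ultimately have V: "finite V"
    by (rule finite_subset[rotated])
  have "{P \<in> curve_points a b. real_of_int (point_height P) \<le> B}
      \<subseteq> (\<lambda>x. proj_rel `` {rat_vec x}) ` V"
  proof
    fix P assume "P \<in> {P \<in> curve_points a b. real_of_int (point_height P) \<le> B}"
    then have P: "P \<in> proj3Q" and le: "real_of_int (point_height P) \<le> B"
      by (auto simp: curve_points_def)
    obtain x where x: "primitive x" "rat_vec x \<in> P"
      using ex_primitive[OF P] by blast
    have "\<bar>x $ i\<bar> \<le> \<lfloor>B\<rfloor>" for i
    proof -
      have "\<bar>x $ i\<bar> \<le> point_height P"
        unfolding point_height_eq[OF P x] by (rule Max_ge) auto
      then show ?thesis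
        using le by linarith
    qed
    then have "x \<in> V"
      unfolding V_def by (auto simp: abs_le_iff minus_le_iff)
    moreover have "P = proj_rel `` {rat_vec x}"
    proof -
      obtain z d where z: "z \<noteq> 0" and Pz: "P = proj_rel `` {z}"
        and d: "d \<noteq> 0" "rat_vec x = d *s z"
        using P x(2) by (auto simp: proj3Q_def quotient_def proj_rel_def)
      show ?thesis
      proof (rule set_eqI)
        fix y
        have "(\<exists>c. c \<noteq> 0 \<and> y = c *s z) \<longleftrightarrow> (\<exists>c. c \<noteq> 0 \<and> y = c *s (d *s z))"
        proof
          assume "\<exists>c. c \<noteq> 0 \<and> y = c *s z"
          then obtain c where "c \<noteq> 0" "y = c *s z" by blast
          then show "\<exists>c. c \<noteq> 0 \<and> y = c *s (d *s z)"
            using d(1) by (intro exI[of _ "c / d"]) auto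
        next
          assume "\<exists>c. c \<noteq> 0 \<and> y = c *s (d *s z)"
          then obtain c where "c \<noteq> 0" "y = c *s (d *s z)" by blast
          then show "\<exists>c. c \<noteq> 0 \<and> y = c *s z"
            using d(1) by (intro exI[of _ "c * d"]) auto
        qed
        then show "y \<in> P \<longleftrightarrow> y \<in> proj_rel `` {rat_vec x}"
          using z rat_vec_neq_0[OF x(1)] d(2) by (simp add: Pz proj_rel_def)
      qed
    qed
    ultimately show "P \<in> (\<lambda>x. proj_rel `` {rat_vec x}) ` V"
      by blast
  qed
  then show ?thesis
    using V finite_subset by blast
qed

end

theory Submission
  imports Defs "HOL-Number_Theory.Cong" "HOL-Real_Asymp.Real_Asymp"
begin

text \<open>
  If \<open>x\<close> is a primitive integer vector on the curve, then \<open>(x_i\<^sup>2)\<close> lies in the rank two lattice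
  orthogonal to \<open>a\<close> and \<open>b\<close>. In a reduced basis \<open>v1, v2\<close> of this lattice, \<open>x_i\<^sup>2 = v1_i u + v2_i w\<close>
  with \<open>|u| \<le> U\<close> and \<open>|w| \<le> W\<close>, where \<open>U W\<close> is at most \<open>8 B^4 / H(C)\<close>; if all these vectors are
  parallel, there are at most 16 of them.

  The points are then counted by a determinant method in the coordinates \<open>u, w\<close>. Take a prime \<open>p\<close> of
  size at most \<open>B^\<delta>\<close> and of good reduction, and a power \<open>q = p^e\<close> slightly larger than
  \<open>(U W)^(1/8)\<close>. On a residue class modulo \<open>q\<close> the curve has a \<open>p\<close>-adic local parameter, so the pigeonhole
  principle gives a small combination of the \<open>8 M\<close> monomials
  \<open>u^a w^b (x_0 x_1)^i (x_0 x_2)^j (x_0 x_3)^l\<close> (with \<open>a < M\<close> and \<open>i, j, l < 2\<close>) whose values on the class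
  are divisible by \<open>q^(8 M)\<close> and smaller than \<open>q^(8 M)\<close>, hence zero. These monomials are
  independent on the curve because \<open>1\<close> and the products of the square roots of four pairwise
  non-proportional linear forms are independent over the rational functions. The norm of the
  combination is therefore a nonzero polynomial in \<open>u / w\<close> of degree \<open>O(M)\<close>, so that each of the
  \<open>O(p^4 q)\<close> classes contains \<open>O(M)\<close> points.
\<close>

subsection \<open>Small primes outside a given set\<close>

text \<open>The exponent 1/8 is the reciprocal of the degree of the map \<open>u / w\<close> from
  the curve to the line: sign changes of the four coordinates modulo a common sign act on its
  fibres, which is why eight products accompany each power of \<open>u\<close>. With
  \<open>n = 8 M\<close> monomials, the pigeonhole principle needs the product of their sizes, about
  \<open>(U W)^(4 M^2)\<close>, to be at most \<open>q^(n (n - 1) / 2)\<close>, about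
  \<open>q^(32 M^2)\<close>; hence \<open>q\<close> slightly above \<open>(U W)^(1/8)\<close>
  suffices once \<open>M\<close> is large in terms of epsilon. The height enters because two
  independent lattice vectors have lengths with product at least \<open>H(C)\<close>. Only
  \<open>U W\<close> matters in the count, however skew the reduced basis is. Two obstacles shape
  the rest. The constants have to be uniform in \<open>a\<close> and \<open>b\<close>, so good
  reduction is asked for the minors of \<open>v1, v2\<close>, which are polynomially bounded in
  \<open>B\<close>, and not for those of \<open>a, b\<close>. And one coordinate of a point may
  vanish modulo \<open>p\<close>, so the local parameter depends on the residue class.\<close>

text \<open>The numbers \<open>1 / ((n + 1) (n choose k))\<close> form Leibniz's harmonic triangle, so they are integral
  combinations of the unit fractions \<open>1 / (n + 1), \<dots>, 1 / (n + 1 - k)\<close>.\<close>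

lemma binomial_dvd_common_multiple:
  fixes D :: nat
  assumes "\<And>m. 1 \<le> m \<Longrightarrow> m \<le> Suc n \<Longrightarrow> m dvd D" "k \<le> n"
  shows "Suc n * (n choose k) dvd D"
proof -
  have "\<exists>z :: int. rat_of_nat D = of_int z * of_nat (Suc n * (n choose k))"
    using assms
  proof (induction k arbitrary: n)
    case 0
    then have "Suc n dvd D" by auto
    then obtain z where "D = Suc n * z" ..
    then show ?case
      by (intro exI[of _ "int z"]) (simp add: algebra_simps)
  next
    case (Suc k)
    then obtain n' where n: "n = Suc n'" by (cases n) auto
    obtain z1 z2 :: int
      where z1: "rat_of_nat D = of_int z1 * of_nat (Suc n * (n choose k))"
        and z2: "rat_of_nat D = of_int z2 * of_nat (Suc n' * (n' choose k))"
      using Suc.IH[of n] Suc.IH[of n'] Suc.prems n by fastforce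
    define A where "A = rat_of_nat (n choose k)"
    define A' where "A' = rat_of_nat (n' choose k)"
    define C where "C = rat_of_nat (n choose Suc k)"
    have A0: "A > 0" "A' > 0" "C > 0"
      unfolding A_def A'_def C_def of_nat_0_less_iff using Suc.prems(2) n
      by (auto intro!: zero_less_binomial simp del: binomial_Suc_Suc)
    have "Suc k * (n choose Suc k) = n * (n' choose k)"
      using binomial_absorption[of k n] n by (simp only: diff_Suc_1)
    from arg_cong[OF this, of rat_of_nat] have e1: "of_nat (Suc k) * C = of_nat n * A'"
      unfolding C_def A'_def by (simp only: of_nat_mult)
    have "(n - k) * (n choose k) = n * (n' choose k)"
      using binomial_absorb_comp[of n k] n by (simp only: diff_Suc_1)
    from arg_cong[OF this, of rat_of_nat] have e2: "(of_nat n - of_nat k) * A = of_nat n * A'"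
      unfolding A_def A'_def using Suc.prems(2) by (simp only: of_nat_mult of_nat_diff Suc_leD)
    \<comment> \<open>Leibniz's recurrence: \<open>1 / ((n + 1) (n choose (k + 1)))\<close> equals
      \<open>1 / (n ((n - 1) choose k))\<close> minus \<open>1 / ((n + 1) (n choose k))\<close>.
      Multiplied by \<open>D\<close>, the two terms on the right are the integers \<open>z2\<close>
      and \<open>z1\<close>.\<close>
    have "rat_of_nat D = of_int (z2 - z1) * of_nat (Suc n * (n choose Suc k))"
    proof -
      define N where "N = rat_of_nat n"
      define k' where "k' = rat_of_nat k"
      have pos: "N > 0" "N - k' > 0" "k' \<ge> 0"
        using Suc.prems n by (auto simp: N_def k'_def)
      have AA: "A' = (k' + 1) * C / N" "A = (k' + 1) * C / (N - k')"
        using e1 e2 pos by (auto simp: N_def k'_def field_simps)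
      have d1: "rat_of_nat D = of_int z1 * ((N + 1) * A)" using z1 by (simp add: N_def A_def algebra_simps)
      have d2: "rat_of_nat D = of_int z2 * (N * A')"
        using z2 by (simp add: N_def A'_def n algebra_simps)
      have nz: "N + 1 \<noteq> 0" "k' + 1 \<noteq> 0" "C \<noteq> 0" "N - k' \<noteq> 0" "N \<noteq> 0"
        using pos A0 by auto
      have z1: "of_int z1 = rat_of_nat D * (N - k') / ((N + 1) * ((k' + 1) * C))"
        unfolding d1 AA(2) using nz by simp
      have z2: "of_int z2 = rat_of_nat D / ((k' + 1) * C)"
        unfolding d2 AA(1) using nz by simp
      have "of_int (z2 - z1) = rat_of_nat D * (k' + 1) / ((N + 1) * ((k' + 1) * C))"
        unfolding of_int_diff z1 z2 using pos A0
        by (simp add: divide_simps) (simp add: algebra_simps)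
      also have "\<dots> = rat_of_nat D / ((N + 1) * C)"
        using pos A0 by (simp add: divide_simps)
      finally have z3: "of_int (z2 - z1) = rat_of_nat D / ((N + 1) * C)" .
      have "rat_of_nat (Suc n * (n choose Suc k)) = (N + 1) * C"
        by (simp add: N_def C_def algebra_simps)
      then show ?thesis unfolding z3 using pos A0 by simp
    qed
    then show ?case by blast
  qed
  then obtain z :: int where "rat_of_nat D = of_int z * of_nat (Suc n * (n choose k))" by blast
  then have "rat_of_int (int D) = of_int (z * int (Suc n * (n choose k)))" by simp
  then have "int D = z * int (Suc n * (n choose k))" by (simp only: of_int_eq_iff)
  then show ?thesis
    by (metis dvd_triv_right int_dvd_int_iff)
qed

text \<open>Since \<open>m < 2 ^ L\<close>, each prime occurs in \<open>m\<close> fewer than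
  \<open>L\<close> times, while every prime of \<open>m\<close> occurs at least \<open>L\<close>
  times in \<open>D ^ L\<close>.\<close>

lemma dvd_power_of_primes_dvd:
  fixes D m L :: nat
  assumes "D > 0" "m > 0" "m < 2 ^ L" "\<And>p. prime p \<Longrightarrow> p dvd m \<Longrightarrow> p dvd D"
  shows "m dvd D ^ L"
proof (rule multiplicity_le_imp_dvd)
  show "m \<noteq> 0" using assms by auto
  fix p :: nat assume p: "prime p"
  show "multiplicity p m \<le> multiplicity p (D ^ L)"
  proof (cases "p dvd m")
    case True
    have "2 ^ multiplicity p m \<le> p ^ multiplicity p m"
      using p prime_ge_2_nat by (intro power_mono) auto
    also have "\<dots> \<le> m"
      using assms(2) by (intro dvd_imp_le multiplicity_dvd)
    also have "\<dots> < 2 ^ L" by fact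
    finally have "multiplicity p m < L"
      by (metis nat_power_less_imp_less zero_less_numeral)
    moreover have "multiplicity p D \<ge> 1"
      using assms(4)[OF p True] p assms(1) multiplicity_gt_zero_iff[of D p]
      by (simp add: Suc_le_eq prime_nat_iff)
    moreover have "multiplicity p (D ^ L) = L * multiplicity p D"
      using p assms(1) by (simp add: prime_elem_multiplicity_power_distrib)
    ultimately show ?thesis
      using mult_le_mono2[of 1 "multiplicity p D" L] by linarith
  qed (simp add: not_dvd_imp_multiplicity_0)
qed

text \<open>An elementary substitute for Chebyshev's estimate. If all primes up to
  \<open>n + 1\<close> divided \<open>D\<close>, then \<open>D ^ L\<close> would be a common
  multiple of \<open>1, ..., n + 1\<close>, hence of all \<open>(n + 1) (n choose k)\<close>;
  summing these over \<open>k\<close> gives \<open>(n + 1) 2 ^ n <= (n + 1) D ^ L\<close>.\<close>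

lemma small_prime_not_dvd:
  fixes D L n :: nat
  assumes "D > 0" "Suc n < 2 ^ L" "D ^ L < 2 ^ n"
  shows "\<exists>p. prime p \<and> p \<le> Suc n \<and> \<not> p dvd D"
proof (rule ccontr)
  assume no: "\<not> ?thesis"
  have "m dvd D ^ L" if "1 \<le> m" "m \<le> Suc n" for m
  proof (rule dvd_power_of_primes_dvd)
    fix p assume p: "prime p" "p dvd m"
    then have "p \<le> m" using that by (intro dvd_imp_le) auto
    then show "p dvd D" using no p that by auto
  qed (use that assms in auto)
  then have dv: "Suc n * (n choose k) dvd D ^ L" if "k \<le> n" for k
    using that by (intro binomial_dvd_common_multiple) auto
  have le: "Suc n * (n choose k) \<le> D ^ L" if "k \<le> n" for k
    using dv[OF that] assms(1) by (intro dvd_imp_le) auto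
  have "Suc n * 2 ^ n = (\<Sum>k\<le>n. Suc n * (n choose k))"
    by (simp add: choose_row_sum sum_distrib_left[symmetric] del: mult_Suc)
  also have "\<dots> \<le> (\<Sum>k\<le>n. D ^ L)"
    by (intro sum_mono le) auto
  also have "\<dots> = Suc n * D ^ L" by simp
  finally have "2 ^ n \<le> D ^ L" by (simp del: mult_Suc)
  then show False using assms(3) by simp
qed

subsection \<open>Independence of square roots\<close>

definition is_subring :: "'a::idom set \<Rightarrow> bool" where
  "is_subring k \<longleftrightarrow> 0 \<in> k \<and> (\<forall>a\<in>k. \<forall>b\<in>k. a + b \<in> k \<and> a - b \<in> k \<and> a * b \<in> k)"

text \<open>\<open>E\<close> is not a square in the fraction field of \<open>k\<close>, with
  denominators cleared so that no fraction field has to be formed.\<close>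

definition nonsquare_over :: "'a::idom set \<Rightarrow> 'a \<Rightarrow> bool" where
  "nonsquare_over k E \<longleftrightarrow> (\<forall>a\<in>k. \<forall>b\<in>k. a\<^sup>2 = E * b\<^sup>2 \<longrightarrow> b = 0)"

definition adjoin :: "'a::idom set \<Rightarrow> 'a \<Rightarrow> 'a set" where
  "adjoin k \<theta> = {a + b * \<theta> | a b. a \<in> k \<and> b \<in> k}"

lemma nonsquare_overD:
  assumes "nonsquare_over k E" "a \<in> k" "b \<in> k" "a\<^sup>2 = E * b\<^sup>2"
  shows "a = 0" "b = 0"
  using assms by (auto simp: nonsquare_over_def)

lemma is_subringD:
  assumes "is_subring k"
  shows "0 \<in> k" "\<And>a b. a \<in> k \<Longrightarrow> b \<in> k \<Longrightarrow> a + b \<in> k"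
    "\<And>a b. a \<in> k \<Longrightarrow> b \<in> k \<Longrightarrow> a - b \<in> k" "\<And>a b. a \<in> k \<Longrightarrow> b \<in> k \<Longrightarrow> a * b \<in> k"
  using assms by (auto simp: is_subring_def)

lemma adjoinI: "a \<in> k \<Longrightarrow> b \<in> k \<Longrightarrow> a + b * \<theta> \<in> adjoin k \<theta>"
  by (auto simp: adjoin_def)

lemma subset_adjoin: "is_subring k \<Longrightarrow> k \<subseteq> adjoin k \<theta>"
  using adjoinI[of _ k 0 \<theta>] is_subringD(1)[of k] by auto

lemma adjoin_eq_0:
  assumes "is_subring k" "\<theta>\<^sup>2 = D" "nonsquare_over k D" "a \<in> k" "b \<in> k" "a + b * \<theta> = 0"
  shows "a = 0" "b = 0"
proof -
  have "a = - (b * \<theta>)" using assms by (simp add: eq_neg_iff_add_eq_0)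
  then have "a\<^sup>2 = D * b\<^sup>2" using assms(2) by (simp add: power_mult_distrib)
  then show "a = 0" "b = 0" using nonsquare_overD assms by blast+
qed

lemma is_subring_adjoin:
  assumes k: "is_subring k" and \<theta>: "\<theta>\<^sup>2 \<in> k"
  shows "is_subring (adjoin k \<theta>)"
  unfolding is_subring_def
proof (intro conjI ballI)
  show "0 \<in> adjoin k \<theta>" using subset_adjoin k is_subringD(1) by blast
  fix x y assume "x \<in> adjoin k \<theta>" "y \<in> adjoin k \<theta>"
  then obtain a b c d where x: "x = a + b * \<theta>" "a \<in> k" "b \<in> k" and y: "y = c + d * \<theta>" "c \<in> k" "d \<in> k"
    by (auto simp: adjoin_def)
  have "x + y = (a + c) + (b + d) * \<theta>" "x - y = (a - c) + (b - d) * \<theta>"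
    "x * y = (a * c + b * d * \<theta>\<^sup>2) + (a * d + b * c) * \<theta>"
    using x y by (simp_all add: algebra_simps power2_eq_square)
  then show "x + y \<in> adjoin k \<theta>" "x - y \<in> adjoin k \<theta>" "x * y \<in> adjoin k \<theta>"
    using x y \<theta> by (simp_all only:) (intro adjoinI is_subringD[OF k]; assumption)+
qed

text \<open>The Kummer step: if \<open>E\<close> becomes a square after a root \<theta> of
  \<open>D\<close> is adjoined, then \<open>E\<close> or \<open>D * E\<close> was a square before,
  because the coefficient \<open>2 * c0 * c1\<close> of \<theta> in the square of
  \<open>c0 + c1 * \<theta>\<close> has to vanish.\<close>

lemma nonsquare_over_adjoin:
  fixes \<theta> :: "'a::idom"
  assumes k: "is_subring k" and \<theta>: "\<theta>\<^sup>2 = D" and mem: "D \<in> k" "E \<in> k" and two: "(2 :: 'a) \<noteq> 0"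
    and D: "nonsquare_over k D" and E: "nonsquare_over k E" and DE: "nonsquare_over k (D * E)"
  shows "nonsquare_over (adjoin k \<theta>) E"
  unfolding nonsquare_over_def
proof (intro ballI impI)
  fix \<alpha> \<beta> assume "\<alpha> \<in> adjoin k \<theta>" "\<beta> \<in> adjoin k \<theta>" and eq: "\<alpha>\<^sup>2 = E * \<beta>\<^sup>2"
  then obtain a0 a1 b0 b1 where a: "\<alpha> = a0 + a1 * \<theta>" "a0 \<in> k" "a1 \<in> k"
    and b: "\<beta> = b0 + b1 * \<theta>" "b0 \<in> k" "b1 \<in> k"
    by (auto simp: adjoin_def)
  \<comment> \<open>\<open>n\<close> is the norm of \<beta>, and \<open>c0 + c1 * \<theta>\<close>
    is \<alpha> times the conjugate of \<beta>. Multiplying by the conjugate replaces division by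
    \<beta>.\<close>
  define n where "n = b0 * b0 - D * (b1 * b1)"
  define c0 where "c0 = a0 * b0 - D * (a1 * b1)"
  define c1 where "c1 = a1 * b0 - a0 * b1"
  have cn: "n \<in> k" "c0 \<in> k" "c1 \<in> k"
    unfolding n_def c0_def c1_def using a b mem is_subringD[OF k] by metis+
  have n: "\<beta> * (b0 - b1 * \<theta>) = n"
    unfolding b n_def \<theta>[symmetric] by (simp add: algebra_simps power2_eq_square)
  have c: "\<alpha> * (b0 - b1 * \<theta>) = c0 + c1 * \<theta>"
    unfolding a c0_def c1_def \<theta>[symmetric] by (simp add: algebra_simps power2_eq_square)
  have "(c0 + c1 * \<theta>)\<^sup>2 = E * n\<^sup>2"
    unfolding c[symmetric] n[symmetric] power_mult_distrib eq by (simp add: algebra_simps)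
  then have "(c0 * c0 + D * (c1 * c1) - E * (n * n)) + (c0 * c1 + c0 * c1) * \<theta> = 0"
    unfolding \<theta>[symmetric] by (simp add: algebra_simps power2_eq_square)
  then have "c0 * c0 + D * (c1 * c1) - E * (n * n) = 0" "c0 * c1 + c0 * c1 = 0"
    by (rule adjoin_eq_0[OF k \<theta> D, rotated 2];
        intro is_subringD[OF k] cn mem)+
  then have 1: "c0\<^sup>2 + D * c1\<^sup>2 = E * n\<^sup>2" and 2: "2 * (c0 * c1) = 0"
    by (simp_all add: power2_eq_square)
  \<comment> \<open>Unless \<open>n\<close> vanishes, \<open>c0 = 0\<close> exhibits
    \<open>D * E\<close> as a square and \<open>c1 = 0\<close> exhibits \<open>E\<close> as
    one.\<close>
  have "n = 0"
  proof (cases "c0 = 0")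
    case True
    then have "(D * c1)\<^sup>2 = D * E * n\<^sup>2" using 1 by (simp add: power2_eq_square algebra_simps)
    then show ?thesis using nonsquare_overD(2)[OF DE] cn mem is_subringD(4)[OF k] by blast
  next
    case False
    then have "c0\<^sup>2 = E * n\<^sup>2" using 1 2 two by simp
    then show ?thesis using nonsquare_overD(2)[OF E] cn by blast
  qed
  then have "b0\<^sup>2 = D * b1\<^sup>2" by (simp add: n_def power2_eq_square)
  then show "\<beta> = 0" using nonsquare_overD[OF D b(2,3)] b(1) by simp
qed

text \<open>The four coefficients with respect to \<open>1, y1, y2, y1 y2\<close> become
  \<open>sq0\<close> to \<open>sq3\<close> in the norm computation. Factors 2 are written as
  repeated summands so that the embedding \<iota> into power series passes through by its rules for
  sums and products.\<close>

lemma biquadratic_square: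
  fixes y1 y2 :: "'a::comm_ring_1"
  assumes "y1\<^sup>2 = d1" "y2\<^sup>2 = d2"
  shows "(a0 + a1 * y1 + (a2 + a3 * y1) * y2)\<^sup>2 =
      (a0 * a0 + a1 * a1 * d1 + a2 * a2 * d2 + a3 * a3 * (d1 * d2))
    + ((a0 * a1 + a2 * a3 * d2) + (a0 * a1 + a2 * a3 * d2)) * y1
    + (((a0 * a2 + a1 * a3 * d1) + (a0 * a2 + a1 * a3 * d1))
        + ((a0 * a3 + a1 * a2) + (a0 * a3 + a1 * a2)) * y1) * y2"
  unfolding assms[symmetric] by (simp add: algebra_simps power2_eq_square)

lemma quadratic_square:
  fixes y1 :: "'a::comm_ring_1"
  assumes "y1\<^sup>2 = d1"
  shows "(a0 + a1 * y1)\<^sup>2 = (a0 * a0 + a1 * a1 * d1) + (a0 * a1 + a0 * a1) * y1"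
  unfolding assms[symmetric] by (simp add: algebra_simps power2_eq_square)

text \<open>\<open>N\<close> is the norm, obtained by multiplying with the conjugates under
  \<open>y3\<close>, \<open>y2\<close>, \<open>y1\<close> in turn; the degree grows from
  \<open>m\<close> to \<open>2 m + 6\<close>, \<open>4 m + 16\<close>, \<open>8 m + 34\<close>.
  Formal roots show that \<open>N\<close> is nonzero, and the same identities for numbers
  \<open>y1, y2, y3\<close> show that it vanishes at every zero.\<close>

lemma multiquadratic_norm:
  fixes D1 D2 D3 :: "complex poly" and f :: "nat \<Rightarrow> nat \<Rightarrow> nat \<Rightarrow> complex poly"
  assumes ns: "\<And>E a b. E \<in> {D1, D2, D3, D1 * D2, D1 * D3, D2 * D3, D1 * (D2 * D3)} \<Longrightarrow> a\<^sup>2 = E * b\<^sup>2 \<Longrightarrow> b = 0"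
    and degf: "\<And>i j l. degree (f i j l) \<le> m"
    and degD: "degree D1 \<le> 2" "degree D2 \<le> 2" "degree D3 \<le> 2"
    and nz: "i < 2" "j < 2" "l < 2" "f i j l \<noteq> 0"
  shows "\<exists>N. N \<noteq> 0 \<and> degree N \<le> 8 * m + 34 \<and>
    (\<forall>t y1 y2 y3. y1\<^sup>2 = poly D1 t \<longrightarrow> y2\<^sup>2 = poly D2 t \<longrightarrow> y3\<^sup>2 = poly D3 t \<longrightarrow>
       (\<Sum>i<2. \<Sum>j<2. \<Sum>l<2. poly (f i j l) t * y1 ^ i * y2 ^ j * y3 ^ l) = 0 \<longrightarrow> poly N t = 0)"
proof -
  have "D1 * D2 * D3 \<noteq> 0" using ns[of D1 0 1] ns[of D2 0 1] ns[of D3 0 1] by auto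
  then obtain t0 where t0: "poly D1 t0 \<noteq> 0" "poly D2 t0 \<noteq> 0" "poly D3 t0 \<noteq> 0"
    using poly_all_0_iff_0[of "D1 * D2 * D3"] by auto
  \<comment> \<open>The square roots of \<open>D1, D2, D3\<close> exist in the ring of power series in \<open>t - t0\<close>.\<close>
  define \<iota> :: "complex poly \<Rightarrow> complex fps" where "\<iota> p = fps_of_poly (pcompose p [:t0, 1:])" for p
  define k where "k = range \<iota>"
  have hom: "\<iota> (p + q) = \<iota> p + \<iota> q" "\<iota> (p - q) = \<iota> p - \<iota> q" "\<iota> (p * q) = \<iota> p * \<iota> q"
    "\<iota> 0 = 0" for p q
    by (simp_all add: \<iota>_def pcompose_add pcompose_diff pcompose_mult fps_of_poly_add fps_of_poly_diff fps_of_poly_mult)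
  have inj0: "\<iota> p = 0 \<longleftrightarrow> p = 0" for p
    by (simp add: \<iota>_def pcompose_eq_0_iff)
  have inj: "\<iota> p = \<iota> q \<longleftrightarrow> p = q" for p q
    using inj0[of "p - q"] by (simp add: hom)
  have \<iota>k: "\<iota> p \<in> k" for p by (simp add: k_def)
  have k: "is_subring k"
    unfolding is_subring_def k_def by (auto simp flip: hom)
  have nsk: "nonsquare_over k (\<iota> E)" if "E \<in> {D1, D2, D3, D1 * D2, D1 * D3, D2 * D3, D1 * (D2 * D3)}" for E
    unfolding nonsquare_over_def k_def
    using ns[OF that] by (auto simp: power2_eq_square inj hom inj0 simp flip: hom(3))
  have two: "(2 :: complex fps) \<noteq> 0" by simp
  have root: "\<exists>s. s\<^sup>2 = \<iota> D" if "poly D t0 \<noteq> 0" for D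
  proof -
    have "fps_nth (\<iota> D) 0 = poly D t0"
      by (simp add: \<iota>_def poly_pcompose flip: poly_0_coeff_0)
    then have "(fps_radical (\<lambda>_. csqrt) (Suc 1) (\<iota> D)) ^ Suc 1 = \<iota> D"
      using that power_radical[of "\<iota> D" "\<lambda>_. csqrt" 1] power2_csqrt[of "poly D t0"]
      by (simp add: power2_eq_square)
    then show ?thesis by (auto simp: numeral_2_eq_2)
  qed
  obtain s1 s2 s3 where s: "s1\<^sup>2 = \<iota> D1" "s2\<^sup>2 = \<iota> D2" "s3\<^sup>2 = \<iota> D3"
    using root t0 by metis
  define R1 where "R1 = adjoin k s1"
  define R2 where "R2 = adjoin R1 s2"
  have R1: "is_subring R1" unfolding R1_def using k s \<iota>k by (intro is_subring_adjoin) auto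
  have \<iota>1: "\<iota> p \<in> R1" for p using subset_adjoin[OF k] \<iota>k by (auto simp: R1_def)
  have R2: "is_subring R2" unfolding R2_def using R1 s \<iota>1 by (intro is_subring_adjoin) auto
  have \<iota>2: "\<iota> p \<in> R2" for p using subset_adjoin[OF R1] \<iota>1 by (auto simp: R2_def)
  \<comment> \<open>Each adjunction turns the condition on \<open>E\<close> into conditions on
    \<open>D\<close>, \<open>E\<close> and \<open>D * E\<close> one level below. Going down twice
    consumes all seven products in \<open>ns\<close>.\<close>
  have ns1: "nonsquare_over R1 (\<iota> D2)" "nonsquare_over R1 (\<iota> D3)" "nonsquare_over R1 (\<iota> D2 * \<iota> D3)"
    unfolding R1_def hom(3)[symmetric]
    by (rule nonsquare_over_adjoin[OF k s(1) \<iota>k \<iota>k two nsk nsk];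
        simp add: nsk flip: hom(3))+
  have ns2: "nonsquare_over R2 (\<iota> D3)"
    unfolding R2_def
    by (rule nonsquare_over_adjoin[OF R1 s(2) \<iota>1 \<iota>1 two]) (use ns1 in auto)
  \<comment> \<open>If \<open>A l\<close> collects the terms with \<open>y3 ^ l\<close>, then
    \<open>g sq0, ..., g sq3\<close> are the coordinates of \<open>A 0 ^ 2 - D3 * A 1 ^ 2\<close>.
    Eliminating \<open>y2\<close> in the same way leaves \<open>h0 + h1 * y1\<close>, and
    eliminating \<open>y1\<close> leaves \<open>N\<close>.\<close>
  define sq0 where "sq0 a0 a1 a2 a3 = a0 * a0 + a1 * a1 * D1 + a2 * a2 * D2 + a3 * a3 * (D1 * D2)"
    for a0 a1 a2 a3
  define sq1 where "sq1 a0 a1 a2 a3 = (a0 * a1 + a2 * a3 * D2) + (a0 * a1 + a2 * a3 * D2)"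
    for a0 a1 a2 a3
  define sq2 where "sq2 a0 a1 a2 a3 = (a0 * a2 + a1 * a3 * D1) + (a0 * a2 + a1 * a3 * D1)"
    for a0 a1 a2 a3
  define sq3 where "sq3 a0 a1 a2 a3 = (a0 * a3 + a1 * a2) + (a0 * a3 + a1 * a2)"
    for a0 a1 a2 a3 :: "complex poly"
  define g where "g sq = sq (f 0 0 0) (f 1 0 0) (f 0 1 0) (f 1 1 0)
      - D3 * sq (f 0 0 1) (f 1 0 1) (f 0 1 1) (f 1 1 1)"
    for sq :: "complex poly \<Rightarrow> complex poly \<Rightarrow> complex poly \<Rightarrow> complex poly \<Rightarrow> complex poly"
  define h0 where "h0 = (g sq0 * g sq0 + g sq1 * g sq1 * D1) - D2 * (g sq2 * g sq2 + g sq3 * g sq3 * D1)"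
  define h1 where "h1 = (g sq0 * g sq1 + g sq0 * g sq1) - D2 * (g sq2 * g sq3 + g sq2 * g sq3)"
  define N where "N = h0 * h0 - D1 * (h1 * h1)"
  have dm: "degree (p * q) \<le> r" if "degree p \<le> m1" "degree q \<le> m2" "m1 + m2 \<le> r"
    for p q :: "complex poly" and m1 m2 r
    using that degree_mult_le[of p q] by linarith
  have sqdeg: "degree (sq a0 a1 a2 a3) \<le> 2 * m + 4"
    if "sq \<in> {sq0, sq1, sq2, sq3}" "degree a0 \<le> m" "degree a1 \<le> m" "degree a2 \<le> m" "degree a3 \<le> m"
    for sq a0 a1 a2 a3
  proof -
    have 1: "degree (p * q) \<le> 2 * m" if "degree p \<le> m" "degree q \<le> m" for p q :: "complex poly"
      using dm[OF that] by simp
    have 2: "degree (p * q * D) \<le> 2 * m + 4" if "degree p \<le> m" "degree q \<le> m" "degree D \<le> 4" for p q D :: "complex poly"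
      using dm[OF 1[OF that(1,2)] that(3)] by simp
    have 3: "degree (p * q) \<le> 2 * m + 4" if "degree p \<le> m" "degree q \<le> m" for p q :: "complex poly"
      using 1[OF that] by simp
    have D: "degree D1 \<le> 4" "degree D2 \<le> 4" "degree (D1 * D2) \<le> 4"
      using degD dm[OF degD(1,2)] by auto
    show ?thesis
      using that(1) unfolding insert_iff empty_iff
      by (elim disjE FalseE; simp only: sq0_def sq1_def sq2_def sq3_def;
          intro degree_add_le 2 3 D that(2-))
  qed
  have gdeg: "degree (g sq) \<le> 2 * m + 6" if "sq \<in> {sq0, sq1, sq2, sq3}" for sq
    unfolding g_def
  proof (rule degree_diff_le)
    have *: "degree (sq (f 0 0 l) (f 1 0 l) (f 0 1 l) (f 1 1 l)) \<le> 2 * m + 4" for l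
      by (rule sqdeg[OF that degf degf degf degf])
    show "degree (sq (f 0 0 0) (f 1 0 0) (f 0 1 0) (f 1 1 0)) \<le> 2 * m + 6" using *[of 0] by simp
    show "degree (D3 * sq (f 0 0 1) (f 1 0 1) (f 0 1 1) (f 1 1 1)) \<le> 2 * m + 6"
      by (rule dm[OF degD(3) *]) simp
  qed
  have gg: "degree (g s * g s') \<le> 4 * m + 12" if "s \<in> {sq0, sq1, sq2, sq3}" "s' \<in> {sq0, sq1, sq2, sq3}" for s s'
    by (rule dm[OF gdeg[OF that(1)] gdeg[OF that(2)]]) simp
  have ggD: "degree (g s * g s' * D1) \<le> 4 * m + 14" if "s \<in> {sq0, sq1, sq2, sq3}" "s' \<in> {sq0, sq1, sq2, sq3}" for s s'
    by (rule dm[OF gg[OF that] degD(1)]) simp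
  have gg': "degree (g s * g s') \<le> n" if "s \<in> {sq0, sq1, sq2, sq3}" "s' \<in> {sq0, sq1, sq2, sq3}" "4 * m + 12 \<le> n" for s s' n
    using gg[OF that(1,2)] that(3) by linarith
  have h0deg: "degree h0 \<le> 4 * m + 16"
    unfolding h0_def
    by (intro degree_diff_le degree_add_le dm[OF degD(2), of _ "4 * m + 14"] gg' ggD order_trans[OF ggD]) auto
  have h1deg: "degree h1 \<le> 4 * m + 16"
    unfolding h1_def
    by (intro degree_diff_le degree_add_le dm[OF degD(2), of _ "4 * m + 14"] gg') auto
  have Ndeg: "degree N \<le> 8 * m + 34"
    unfolding N_def
    by (intro degree_diff_le dm[OF h0deg h0deg] dm[OF degD(1) dm[OF h1deg h1deg]]) auto
  \<comment> \<open>A vanishing norm is unwound backwards: \<open>h0 = h1 = 0\<close> since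
    \<open>D1\<close> is no square, then all \<open>g\<close> vanish since \<open>D2\<close> is none
    over \<open>R1\<close>, then all \<open>f\<close> since \<open>D3\<close> is none over
    \<open>R2\<close>.\<close>
  have N0: "N \<noteq> 0"
  proof
    assume "N = 0"
    then have "h0\<^sup>2 = D1 * h1\<^sup>2" by (simp add: N_def power2_eq_square)
    moreover from this have h1: "h1 = 0" by (rule ns[rotated]) simp
    ultimately have h0: "h0 = 0" by simp
    let ?P = "\<iota> (g sq0) + \<iota> (g sq1) * s1"
    let ?Q = "\<iota> (g sq2) + \<iota> (g sq3) * s1"
    have "?P\<^sup>2 - \<iota> D2 * ?Q\<^sup>2 = \<iota> h0 + \<iota> h1 * s1"
      unfolding h0_def h1_def quadratic_square[OF s(1)] hom by (simp add: algebra_simps)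
    then have "?P\<^sup>2 = \<iota> D2 * ?Q\<^sup>2" by (simp add: h0 h1 hom)
    then have "?P = 0" "?Q = 0"
      using nonsquare_overD[OF ns1(1)] adjoinI[OF \<iota>k \<iota>k] unfolding R1_def by blast+
    then have g0: "g sq0 = 0" "g sq1 = 0" "g sq2 = 0" "g sq3 = 0"
      using adjoin_eq_0[OF k s(1) nsk \<iota>k \<iota>k] by (simp_all add: inj0)
    let ?A = "\<lambda>l. \<iota> (f 0 0 l) + \<iota> (f 1 0 l) * s1 + (\<iota> (f 0 1 l) + \<iota> (f 1 1 l) * s1) * s2"
    have "(?A 0)\<^sup>2 - \<iota> D3 * (?A 1)\<^sup>2 = \<iota> (g sq0) + \<iota> (g sq1) * s1 + (\<iota> (g sq2) + \<iota> (g sq3) * s1) * s2"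
      unfolding g_def sq0_def sq1_def sq2_def sq3_def biquadratic_square[OF s(1,2)] hom
      by (simp add: algebra_simps)
    then have "(?A 0)\<^sup>2 = \<iota> D3 * (?A 1)\<^sup>2" by (simp add: g0 hom)
    moreover have "?A l \<in> R2" for l
      unfolding R2_def R1_def by (intro adjoinI \<iota>k)
    ultimately have "?A 0 = 0" "?A 1 = 0"
      using nonsquare_overD[OF ns2] by blast+
    then have "?A l = 0" if "l < 2" for l using that by (auto simp: less_2_cases_iff)
    then have "\<iota> (f 0 0 l) + \<iota> (f 1 0 l) * s1 = 0 \<and> \<iota> (f 0 1 l) + \<iota> (f 1 1 l) * s1 = 0" if "l < 2" for l
      using that adjoin_eq_0[OF R1 s(2) ns1(1)] adjoinI[OF \<iota>k \<iota>k] unfolding R1_def by blast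
    then have "f 0 0 l = 0 \<and> f 1 0 l = 0 \<and> f 0 1 l = 0 \<and> f 1 1 l = 0" if "l < 2" for l
      using that adjoin_eq_0[OF k s(1) nsk \<iota>k \<iota>k] inj0 by (metis insertI1)
    then show False using nz by (auto simp: less_2_cases_iff)
  qed
  have ev: "poly N t = 0"
    if y: "y1\<^sup>2 = poly D1 t" "y2\<^sup>2 = poly D2 t" "y3\<^sup>2 = poly D3 t"
      and z: "(\<Sum>i<2. \<Sum>j<2. \<Sum>l<2. poly (f i j l) t * y1 ^ i * y2 ^ j * y3 ^ l) = 0"
    for t y1 y2 y3 :: complex
  proof -
    let ?p = "\<lambda>i j l. poly (f i j l) t"
    let ?A = "\<lambda>l. ?p 0 0 l + ?p 1 0 l * y1 + (?p 0 1 l + ?p 1 1 l * y1) * y2"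
    have "?A 0 = - (?A 1 * y3)"
      unfolding eq_neg_iff_add_eq_0 using z by (simp add: numeral_2_eq_2 algebra_simps)
    then have "(?A 0)\<^sup>2 = (?A 1)\<^sup>2 * y3\<^sup>2" by (simp add: power_mult_distrib)
    then have "(?A 0)\<^sup>2 - poly D3 t * (?A 1)\<^sup>2 = 0" by (simp add: y)
    then have 1: "(poly (g sq0) t + poly (g sq1) t * y1) + (poly (g sq2) t + poly (g sq3) t * y1) * y2 = 0" (is "?P + ?Q * _ = 0")
      unfolding biquadratic_square[OF y(1,2)] g_def sq0_def sq1_def sq2_def sq3_def
      by (simp add: algebra_simps)
    have "?P = - (?Q * y2)" using 1 by (simp only: eq_neg_iff_add_eq_0)
    then have "?P\<^sup>2 = ?Q\<^sup>2 * y2\<^sup>2" by (simp add: power_mult_distrib)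
    then have "?P\<^sup>2 - poly D2 t * ?Q\<^sup>2 = 0" by (simp add: y)
    then have "poly h0 t + poly h1 t * y1 = 0"
      unfolding quadratic_square[OF y(1)] h0_def h1_def by (simp add: algebra_simps)
    then have "poly h0 t = - (poly h1 t * y1)" by (simp only: eq_neg_iff_add_eq_0)
    then have "(poly h0 t)\<^sup>2 = (poly h1 t)\<^sup>2 * y1\<^sup>2" by (simp add: power_mult_distrib)
    then have "(poly h0 t)\<^sup>2 = (poly h1 t)\<^sup>2 * poly D1 t" by (simp only: y)
    then show ?thesis by (simp add: N_def power2_eq_square algebra_simps)
  qed
  show ?thesis using N0 Ndeg ev by blast
qed

subsection \<open>Hensel lifting and a Siegel lemma for congruences\<close>

text \<open>Newton iteration in \<open>T\<close>, with \<open>1 / (2 c)\<close> represented by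
  \<open>\<tau> * c'\<close>. The form \<open>c + T * g'\<close> is carried along because
  \<open>c\<close> fixes the branch of the root and is what each correction is divided by.\<close>

lemma polynomial_sqrt_modulo:
  fixes F :: "int poly" and Q c c' \<tau> :: int
  assumes c2: "[c\<^sup>2 = poly F 0] (mod Q)" and c': "[c * c' = 1] (mod Q)" and \<tau>: "[2 * \<tau> = 1] (mod Q)"
  shows "\<exists>g h g'. (\<forall>T. [(poly g T)\<^sup>2 = poly F T + T ^ Suc m * poly h T] (mod Q)) \<and> (\<forall>T. poly g T = c + T * poly g' T)"
proof (induction m)
  case 0
  obtain F0 F' where F: "F = pCons F0 F'" by (cases F)
  have "[(poly [:c:] T)\<^sup>2 = poly F T + T ^ Suc 0 * poly (- F') T] (mod Q)" for T
    using c2 by (simp add: F)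
  moreover have "\<forall>T. poly [:c:] T = c + T * poly 0 T" by simp
  ultimately show ?case by blast
next
  case (Suc m)
  then obtain g h g' where g: "\<And>T. [(poly g T)\<^sup>2 = poly F T + T ^ Suc m * poly h T] (mod Q)"
    and g': "\<And>T. poly g T = c + T * poly g' T" by blast
  \<comment> \<open>The correction is \<open>T ^ Suc m * h / (2 c)\<close>. Its cross term with
    \<open>c\<close> cancels \<open>T ^ Suc m * h\<close>; everything else has order at least
    \<open>m + 2\<close> and is collected in \<open>H\<close>.\<close>
  define k where "k = smult (\<tau> * c') (monom 1 m * h)"
  define G where "G = g - pCons 0 k"
  define H where "H = monom 1 m * (smult ((\<tau> * c')\<^sup>2) (h * h)) - smult (2 * \<tau> * c') (h * g')"
  have 1: "[(poly G T)\<^sup>2 = poly F T + T ^ Suc (Suc m) * poly H T] (mod Q)" for T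
  proof -
    let ?h = "poly h T" and ?g' = "poly g' T" and ?s = "T ^ Suc m"
    have G: "poly G T = poly g T - ?s * (\<tau> * c') * ?h"
      by (simp add: G_def k_def poly_monom algebra_simps)
    have H: "T ^ Suc (Suc m) * poly H T = ?s\<^sup>2 * (\<tau> * c')\<^sup>2 * ?h\<^sup>2 - ?s * T * (2 * \<tau> * c') * ?h * ?g'"
      by (simp add: H_def poly_monom power2_eq_square right_diff_distrib ac_simps)
    have "(poly G T)\<^sup>2 = (poly g T)\<^sup>2 - ((2 * \<tau>) * (c * c')) * (?s * ?h) - ?s * T * (2 * \<tau> * c') * ?h * ?g' + ?s\<^sup>2 * (\<tau> * c')\<^sup>2 * ?h\<^sup>2"
      unfolding G g' by algebra
    also have "[\<dots> = (poly F T + ?s * ?h) - (1 * 1) * (?s * ?h) - ?s * T * (2 * \<tau> * c') * ?h * ?g' + ?s\<^sup>2 * (\<tau> * c')\<^sup>2 * ?h\<^sup>2] (mod Q)"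
      by (intro cong_add cong_diff cong_mult g c' \<tau> cong_refl)
    also have "(poly F T + ?s * ?h) - (1 * 1) * (?s * ?h) - ?s * T * (2 * \<tau> * c') * ?h * ?g' + ?s\<^sup>2 * (\<tau> * c')\<^sup>2 * ?h\<^sup>2
        = poly F T + T ^ Suc (Suc m) * poly H T" unfolding H by simp
    finally show ?thesis .
  qed
  have 2: "poly G T = c + T * poly (g' - k) T" for T
    by (simp add: G_def g' algebra_simps)
  show ?case using 1 2 by blast
qed

text \<open>Pigeonhole for a box with sides inversely proportional to the weights
  \<open>F j\<close>. Coefficient \<open>i\<close> needs only the divisor
  \<open>q ^ (n - i)\<close>, because it will be multiplied by the \<open>i\<close>-th power of a
  multiple of \<open>q\<close>. This leaves \<open>q ^ (n (n + 1) / 2)\<close> residue systems, and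
  \<open>le\<close> makes the box larger.\<close>

lemma siegel_congruences:
  fixes J :: "'j set" and G :: "'j \<Rightarrow> nat \<Rightarrow> int" and F :: "'j \<Rightarrow> real" and q n :: nat
  assumes J: "finite J" "card J = n" "n > 0" and q: "q > 0" and F: "\<And>j. j \<in> J \<Longrightarrow> F j > 0"
    and le: "real (n + 1) ^ n * (\<Prod>j\<in>J. F j) \<le> real q ^ (n * (n - 1) div 2)"
  shows "\<exists>c. (\<exists>j\<in>J. c j \<noteq> 0) \<and> (\<Sum>j\<in>J. \<bar>real_of_int (c j)\<bar> * F j) < real q ^ n
     \<and> (\<forall>i<n. int q ^ (n - i) dvd (\<Sum>j\<in>J. c j * G j i))"
proof -
  \<comment> \<open>The factor \<open>n + 1\<close> instead of \<open>n\<close> makes the final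
    bound strict: the weighted sum is at most \<open>n / (n + 1)\<close> times
    \<open>q ^ n\<close>.\<close>
  define C where "C j = \<lfloor>real q ^ n / (real (n + 1) * F j)\<rfloor>" for j
  have Cnn: "C j \<ge> 0" if "j \<in> J" for j using F[OF that] by (simp add: C_def)
  define V where "V = (\<Pi>\<^sub>E j\<in>J. {0..C j})"
  define W where "W = (\<Pi>\<^sub>E i\<in>{..<n}. {0..<int q ^ (n - i)})"
  define \<phi> where "\<phi> c = (\<lambda>i\<in>{..<n}. (\<Sum>j\<in>J. c j * G j i) mod int q ^ (n - i))" for c
  have cardV: "real (card V) = (\<Prod>j\<in>J. real_of_int (C j + 1))"
    using J Cnn by (simp add: V_def card_PiE)
  have exps: "(\<Sum>i<n. n - i) = n * (n + 1) div 2"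
  proof -
    have "(\<Sum>i<n. n - i) = \<Sum>{1..n}"
      by (rule sum.reindex_bij_witness[of _ "\<lambda>i. n - i" "\<lambda>i. n - i"]) auto
    also have "\<dots> = n * (n + 1) div 2" by (induction n) auto
    finally show ?thesis .
  qed
  have cardW: "real (card W) = real q ^ (n * (n + 1) div 2)"
    by (simp add: W_def card_PiE nat_power_eq exps flip: power_sum)
  have "real q ^ (n * (n + 1) div 2) * (real (n + 1) ^ n * (\<Prod>j\<in>J. F j))
      \<le> real q ^ (n * (n + 1) div 2) * real q ^ (n * (n - 1) div 2)"
    using le by (intro mult_left_mono) auto
  also have "\<dots> = real q ^ (n * n)"
  proof -
    have "n * (n + 1) div 2 + n * (n - 1) div 2 = n * n"
    proof -
      have "n * (n + 1) + n * (n - 1) = 2 * (n * n)" using J(3) by (cases n) auto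
      moreover have "even (n * (n + 1))" "even (n * (n - 1))" by auto
      ultimately show ?thesis by (elim evenE) simp
    qed
    then show ?thesis by (simp flip: power_add)
  qed
  finally have "real q ^ (n * (n + 1) div 2) * (real (n + 1) ^ n * (\<Prod>j\<in>J. F j)) \<le> real q ^ (n * n)" .
  then have "real q ^ (n * (n + 1) div 2) \<le> real q ^ (n * n) / (real (n + 1) ^ n * (\<Prod>j\<in>J. F j))"
    using F by (simp add: pos_le_divide_eq prod_pos)
  also have "\<dots> = (\<Prod>j\<in>J. real q ^ n / (real (n + 1) * F j))"
    using J by (simp add: prod_dividef prod.distrib power_mult)
  also have "\<dots> < (\<Prod>j\<in>J. real_of_int (C j + 1))"
  proof -
    have lt: "real q ^ n / (real (n + 1) * F j) < real_of_int (C j + 1)" for j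
      unfolding C_def by linarith
    have pos: "0 < real q ^ n / (real (n + 1) * F j)" if "j \<in> J" for j
      using F[OF that] q by simp
    obtain j where "j \<in> J" using J by fastforce
    then show ?thesis
      by (rule prod_mono_strict[OF _ lt J(1)])
        (use less_imp_le[OF lt] less_imp_le[OF pos] order.strict_trans[OF pos lt] in blast)+
  qed
  finally have "real (card W) < real (card V)" by (simp only: cardV cardW)
  then have lt: "card W < card V" by simp
  have "\<phi> ` V \<subseteq> W" unfolding \<phi>_def W_def using q
    by (intro image_subsetI restrict_PiE_iff[THEN iffD2]) auto
  moreover have "finite W" by (auto simp: W_def intro: finite_PiE)
  ultimately have "\<not> inj_on \<phi> V" using lt card_inj_on_le[of \<phi> V W] by linarith
  then obtain c d where cd: "c \<in> V" "d \<in> V" "\<phi> c = \<phi> d" "c \<noteq> d" by (auto simp: inj_on_def)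
  define e where "e j = c j - d j" for j
  have "\<exists>j\<in>J. e j \<noteq> 0"
  proof (rule ccontr)
    assume "\<not> ?thesis"
    then have "c j = d j" if "j \<in> J" for j using that by (simp add: e_def)
    then have "c = d" using cd(1,2) unfolding V_def by (intro PiE_ext)
    then show False using cd by simp
  qed
  moreover have "(\<Sum>j\<in>J. \<bar>real_of_int (e j)\<bar> * F j) < real q ^ n"
  proof -
    have "\<bar>real_of_int (e j)\<bar> * F j \<le> real q ^ n / real (n + 1)" if "j \<in> J" for j
    proof -
      have "c j \<in> {0..C j}" "d j \<in> {0..C j}" using cd that by (auto simp: V_def)
      then have "\<bar>e j\<bar> \<le> C j" by (auto simp: e_def)
      then have "\<bar>real_of_int (e j)\<bar> \<le> real_of_int (C j)" by linarith
      also have "\<dots> \<le> real q ^ n / (real (n + 1) * F j)" by (simp add: C_def)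
      finally have "\<bar>real_of_int (e j)\<bar> * F j \<le> real q ^ n / (real (n + 1) * F j) * F j"
        using F[OF that] by (intro mult_right_mono) auto
      also have "\<dots> = real q ^ n / real (n + 1)" using F[OF that] by simp
      finally show ?thesis .
    qed
    then have "(\<Sum>j\<in>J. \<bar>real_of_int (e j)\<bar> * F j) \<le> (\<Sum>j\<in>J. real q ^ n / real (n + 1))"
      by (intro sum_mono)
    also have "\<dots> = real n * (real q ^ n / real (n + 1))" using J by simp
    also have "\<dots> < real q ^ n" using q by (simp add: field_simps)
    finally show ?thesis .
  qed
  moreover have "int q ^ (n - i) dvd (\<Sum>j\<in>J. e j * G j i)" if "i < n" for i
  proof -
    have "(\<Sum>j\<in>J. c j * G j i) mod int q ^ (n - i) = (\<Sum>j\<in>J. d j * G j i) mod int q ^ (n - i)"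
      using fun_cong[OF cd(3), of i] that by (simp add: \<phi>_def)
    then have "int q ^ (n - i) dvd (\<Sum>j\<in>J. c j * G j i) - (\<Sum>j\<in>J. d j * G j i)"
      by (simp add: mod_eq_dvd_iff)
    then show ?thesis by (simp add: e_def algebra_simps sum_subtractf)
  qed
  ultimately show ?thesis by blast
qed

subsection \<open>Auxiliary forms on residue classes\<close>

text \<open>Cramer's rule: where the minor is invertible, two of the four squares determine
  \<open>u\<close> and \<open>w\<close>.\<close>

lemma plucker_solve:
  fixes v1 v2 :: "int ^ 4"
  assumes "\<And>k. y k = v1 $ k * u + v2 $ k * w"
  shows "plucker v1 v2 i j * u = v2 $ j * y i - v2 $ i * y j"
    and "plucker v1 v2 i j * w = v1 $ i * y j - v1 $ j * y i"
  unfolding assms plucker_def by (simp_all add: algebra_simps)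

text \<open>The local parameter is \<open>s = x_i / x_j\<close>, and \<open>T\<close> is its
  increment from a base point \<open>x0\<close>. Cramer's rule makes \<open>u\<close> and
  \<open>w\<close> polynomials in \<open>s\<close>, and the remaining coordinates are square roots
  of polynomials in \<open>T\<close> by Hensel lifting. The branch is the right one because all
  points of \<open>S\<close> agree modulo \<open>p\<close>; the error of order \<open>T ^ n\<close>
  vanishes modulo \<open>p ^ (e * n)\<close>.\<close>

lemma local_expansion:
  fixes v1 v2 :: "int ^ 4" and p :: int and S :: "(int ^ 4) set" and u w :: "int ^ 4 \<Rightarrow> int"
  assumes p: "prime p" "\<not> p dvd 2" "\<not> p dvd plucker v1 v2 i j" and e: "e > 0" "n > 0" and ij: "i \<noteq> j"
    and sq: "\<And>x k. x \<in> S \<Longrightarrow> (x $ k)\<^sup>2 = v1 $ k * u x + v2 $ k * w x"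
    and cl: "\<And>x y k. x \<in> S \<Longrightarrow> y \<in> S \<Longrightarrow> [x $ k = y $ k] (mod p)"
    and unit: "\<And>x k. x \<in> S \<Longrightarrow> k \<noteq> i \<Longrightarrow> \<not> p dvd x $ k"
    and qcl: "\<And>x y. x \<in> S \<Longrightarrow> y \<in> S \<Longrightarrow> p ^ e dvd x $ i * y $ j - y $ i * x $ j"
  shows "\<exists>z T g gu gw. \<forall>x\<in>S. coprime (z x) p \<and> p ^ e dvd T x
     \<and> (\<forall>k. [x $ k * z x = poly (g k) (T x)] (mod p ^ (e * n)))
     \<and> [u x * (z x)\<^sup>2 = poly gu (T x)] (mod p ^ (e * n))
     \<and> [w x * (z x)\<^sup>2 = poly gw (T x)] (mod p ^ (e * n))"
proof (cases "S = {}")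
  case False
  then obtain x0 where x0: "x0 \<in> S" by blast
  define Q where "Q = p ^ (e * n)"
  have qQ: "p ^ e dvd Q" unfolding Q_def using e by (intro le_imp_power_dvd) auto
  have lq: "p dvd p ^ e" using e by simp
  have lQ: "p dvd Q" using lq qQ by (rule dvd_trans)
  have cop: "coprime a p" "coprime a Q" "coprime a (p ^ e)" if "\<not> p dvd a" for a
    using prime_imp_coprime[OF p(1) that] by (auto simp: Q_def coprime_commute)
  have inv: "\<exists>b. [a * b = 1] (mod Q)" if "\<not> p dvd a" for a
    using cong_solve_coprime_int[OF cop(2)[OF that]] .
  obtain \<tau> where \<tau>: "[2 * \<tau> = 1] (mod Q)" using inv p(2) by blast
  obtain \<mu> where \<mu>: "[plucker v1 v2 i j * \<mu> = 1] (mod Q)" using inv p(3) by blast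
  have "\<forall>x\<in>S. \<exists>b. [x $ j * b = 1] (mod Q)" by (intro ballI inv unit) (use ij in auto)
  then obtain z where z: "\<And>x. x \<in> S \<Longrightarrow> [x $ j * z x = 1] (mod Q)" by metis
  have zl: "\<not> p dvd z x" if "x \<in> S" for x
  proof
    assume "p dvd z x"
    then have "[x $ j * z x = 0] (mod p)" by (simp add: cong_0_iff)
    moreover have "[x $ j * z x = 1] (mod p)" using cong_dvd_modulus[OF z[OF that] lQ] .
    ultimately have "[0 = 1] (mod p)" by (meson cong_sym cong_trans)
    then show False using prime_gt_1_int[OF p(1)] by (simp add: cong_iff_dvd_diff)
  qed
  define s where "s x = x $ i * z x" for x
  define T where "T x = s x - s x0" for x
  have qT: "p ^ e dvd T x" if x: "x \<in> S" for x
  proof -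
    have zq: "[y $ j * z y = 1] (mod p ^ e)" if "y \<in> S" for y
      using cong_dvd_modulus[OF z[OF that] qQ] .
    have "T x * (x $ j * x0 $ j) = x $ i * x0 $ j * (x $ j * z x) - x0 $ i * x $ j * (x0 $ j * z x0)"
      by (simp add: T_def s_def algebra_simps)
    also have "[\<dots> = x $ i * x0 $ j * 1 - x0 $ i * x $ j * 1] (mod p ^ e)"
      by (intro cong_diff cong_mult cong_refl zq x x0)
    also have "[x $ i * x0 $ j * 1 - x0 $ i * x $ j * 1 = 0] (mod p ^ e)"
      using qcl[OF x x0] by (simp add: cong_0_iff)
    finally have "p ^ e dvd T x * (x $ j * x0 $ j)" by (simp add: cong_0_iff)
    moreover have "coprime (p ^ e) (x $ j * x0 $ j)"
      using cop(3)[OF unit[OF x]] cop(3)[OF unit[OF x0]] ij by (simp add: coprime_commute)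
    ultimately show ?thesis by (simp add: coprime_dvd_mult_left_iff)
  qed
  \<comment> \<open>After scaling by \<open>z\<close>, coordinate \<open>j\<close> is 1 and
    coordinate \<open>i\<close> is \<open>s x0 + T\<close>; \<mu> is the inverse of the minor in
    Cramer's rule.\<close>
  define gu where "gu = [:\<mu>:] * ([:v2 $ j:] * [:s x0, 1:]\<^sup>2 - [:v2 $ i:])"
  define gw where "gw = [:\<mu>:] * ([:v1 $ i:] - [:v1 $ j:] * [:s x0, 1:]\<^sup>2)"
  have zz: "[(x $ j)\<^sup>2 * (z x)\<^sup>2 = 1] (mod Q)" if "x \<in> S" for x
    using cong_pow[OF z[OF that], of 2] by (simp add: power_mult_distrib)
  have sT: "s x0 + T x = s x" for x by (simp add: T_def)
  have gu: "[u x * (z x)\<^sup>2 = poly gu (T x)] (mod Q)" if x: "x \<in> S" for x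
  proof -
    have "[u x * (z x)\<^sup>2 = (plucker v1 v2 i j * \<mu>) * (u x * (z x)\<^sup>2)] (mod Q)"
      using cong_mult[OF cong_sym[OF \<mu>] cong_refl, of "u x * (z x)\<^sup>2"] by simp
    also have "(plucker v1 v2 i j * \<mu>) * (u x * (z x)\<^sup>2) = \<mu> * (plucker v1 v2 i j * u x) * (z x)\<^sup>2" by simp
    also have "\<dots> = \<mu> * (v2 $ j * (s x)\<^sup>2 - v2 $ i * ((x $ j)\<^sup>2 * (z x)\<^sup>2))"
      unfolding plucker_solve(1)[of "\<lambda>k. (x $ k)\<^sup>2", OF sq[OF x]]
      by (simp add: s_def algebra_simps)
    also have "[\<dots> = \<mu> * (v2 $ j * (s x)\<^sup>2 - v2 $ i * 1)] (mod Q)"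
      by (intro cong_diff cong_mult cong_refl zz x)
    also have "\<mu> * (v2 $ j * (s x)\<^sup>2 - v2 $ i * 1) = poly gu (T x)"
      by (simp add: gu_def sT)
    finally show ?thesis .
  qed
  have gw: "[w x * (z x)\<^sup>2 = poly gw (T x)] (mod Q)" if x: "x \<in> S" for x
  proof -
    have "[w x * (z x)\<^sup>2 = (plucker v1 v2 i j * \<mu>) * (w x * (z x)\<^sup>2)] (mod Q)"
      using cong_mult[OF cong_sym[OF \<mu>] cong_refl, of "w x * (z x)\<^sup>2"] by simp
    also have "(plucker v1 v2 i j * \<mu>) * (w x * (z x)\<^sup>2) = \<mu> * (plucker v1 v2 i j * w x) * (z x)\<^sup>2" by simp
    also have "\<dots> = \<mu> * (v1 $ i * ((x $ j)\<^sup>2 * (z x)\<^sup>2) - v1 $ j * (s x)\<^sup>2)"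
      unfolding plucker_solve(2)[of "\<lambda>k. (x $ k)\<^sup>2", OF sq[OF x]]
      by (simp add: s_def algebra_simps)
    also have "[\<dots> = \<mu> * (v1 $ i * 1 - v1 $ j * (s x)\<^sup>2)] (mod Q)"
      by (intro cong_diff cong_mult cong_refl zz x)
    also have "\<mu> * (v1 $ i * 1 - v1 $ j * (s x)\<^sup>2) = poly gw (T x)"
      by (simp add: gw_def sT)
    finally show ?thesis .
  qed
  have "\<exists>g. \<forall>x\<in>S. [x $ k * z x = poly g (T x)] (mod Q)" for k
  proof (cases "k = i")
    case True
    have "\<forall>x\<in>S. [x $ k * z x = poly [:s x0, 1:] (T x)] (mod Q)"
      by (simp add: sT True) (simp add: s_def)
    then show ?thesis by blast
  next
    case False
    define F where "F = [:v1 $ k:] * gu + [:v2 $ k:] * gw"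
    have F: "[(x $ k * z x)\<^sup>2 = poly F (T x)] (mod Q)" if x: "x \<in> S" for x
    proof -
      have "(x $ k * z x)\<^sup>2 = v1 $ k * (u x * (z x)\<^sup>2) + v2 $ k * (w x * (z x)\<^sup>2)"
        unfolding power_mult_distrib sq[OF x] by (simp add: algebra_simps)
      also have "[\<dots> = v1 $ k * poly gu (T x) + v2 $ k * poly gw (T x)] (mod Q)"
        by (intro cong_add cong_mult cong_refl gu gw x)
      also have "v1 $ k * poly gu (T x) + v2 $ k * poly gw (T x) = poly F (T x)"
        by (simp add: F_def)
      finally show ?thesis .
    qed
    define c where "c = x0 $ k * z x0"
    have cl': "\<not> p dvd c"
      using zl[OF x0] unit[OF x0 False] p(1) by (simp add: c_def prime_dvd_mult_iff)
    then obtain c' where c': "[c * c' = 1] (mod Q)" using inv by blast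
    have "[c\<^sup>2 = poly F 0] (mod Q)" using F[OF x0] by (simp add: c_def T_def)
    from polynomial_sqrt_modulo[OF this c' \<tau>, of "n - 1", unfolded Suc_diff_1[OF e(2)]] obtain g h g' where
      g: "\<And>T. [(poly g T)\<^sup>2 = poly F T + T ^ n * poly h T] (mod Q)"
      and g': "\<And>T. poly g T = c + T * poly g' T" by blast
    have "[x $ k * z x = poly g (T x)] (mod Q)" if x: "x \<in> S" for x
    proof -
      let ?r = "x $ k * z x" and ?g = "poly g (T x)"
      have "(p ^ e) ^ n dvd T x ^ n" using qT[OF x] by (rule dvd_power_same)
      then have "[T x ^ n * poly h (T x) = 0] (mod Q)"
        by (simp add: Q_def power_mult cong_0_iff)
      then have "[poly F (T x) + T x ^ n * poly h (T x) = poly F (T x) + 0] (mod Q)"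
        by (intro cong_add cong_refl)
      then have "[?r\<^sup>2 = ?g\<^sup>2] (mod Q)"
        using F[OF x] g[of "T x"] by (simp add: cong_def)
      then have "Q dvd (?r - ?g) * (?r + ?g)"
        by (simp add: cong_iff_dvd_diff power2_eq_square algebra_simps)
      \<comment> \<open>Both roots reduce to the unit \<open>c\<close> modulo \<open>p\<close>, so
        their sum reduces to \<open>2 c\<close> and the whole modulus has to divide their
        difference.\<close>
      moreover have "coprime Q (?r + ?g)"
      proof -
        have "[x0 $ j * z x = x $ j * z x] (mod p)" by (intro cong_mult cl x x0 cong_refl)
        then have a: "[x0 $ j * z x = 1] (mod p)"
          using cong_dvd_modulus[OF z[OF x] lQ] cong_trans by blast
        have b: "[x0 $ j * z x0 = 1] (mod p)" using cong_dvd_modulus[OF z[OF x0] lQ] .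
        have "[x0 $ j * z x = x0 $ j * z x0] (mod p)"
          using a b by (meson cong_sym cong_trans)
        then have "[z x = z x0] (mod p)"
          using cong_mult_lcancel[OF cop(1)[OF unit[OF x0 ij[symmetric]]]] by simp
        then have rc: "[?r = c] (mod p)" unfolding c_def by (intro cong_mult cl x x0)
        have "p dvd T x" using lq qT[OF x] by (rule dvd_trans)
        then have gc: "[?g = c] (mod p)" unfolding g' by (simp add: cong_iff_dvd_diff)
        have "[?r + ?g = c + c] (mod p)" by (intro cong_add rc gc)
        moreover have "\<not> p dvd c + c" using cl' p(1,2) by (metis mult_2 prime_dvd_multD)
        ultimately have "\<not> p dvd ?r + ?g" using cong_dvd_iff by blast
        then show ?thesis using cop(2) coprime_commute by blast
      qed
      ultimately have "Q dvd ?r - ?g" by (simp add: coprime_dvd_mult_left_iff)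
      then show ?thesis by (simp add: cong_iff_dvd_diff)
    qed
    then show ?thesis by blast
  qed
  then obtain g where g: "\<And>k x. x \<in> S \<Longrightarrow> [x $ k * z x = poly (g k) (T x)] (mod Q)" by metis
  show ?thesis
    unfolding Q_def[symmetric] using zl cop(1) qT g gu gw by blast
qed auto

section \<open>Construction of a vanishing auxiliary form on one residue class\<close>

lemma poly_truncate_dvd:
  fixes p :: "int poly"
  assumes "q dvd T"
  shows "q ^ n dvd poly p T - (\<Sum>i<n. poly.coeff p i * T ^ i)"
proof (induction n arbitrary: p)
  case (Suc n)
  obtain a p' where p: "p = pCons a p'" by (cases p)
  have "(\<Sum>i<Suc n. poly.coeff p i * T ^ i) = a + T * (\<Sum>i<n. poly.coeff p' i * T ^ i)"
    unfolding sum.lessThan_Suc_shift p by (simp add: sum_distrib_left algebra_simps)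
  then have "poly p T - (\<Sum>i<Suc n. poly.coeff p i * T ^ i) = T * (poly p' T - (\<Sum>i<n. poly.coeff p' i * T ^ i))"
    by (simp add: p algebra_simps)
  then show ?case using mult_dvd_mono[OF assms Suc.IH[of p']] by simp
qed simp

text \<open>Division by \<open>w ^ (M + 2)\<close> gives \<open>t^a y_1^e1 y_2^e2 y_3^e3\<close>
  with \<open>t = u / w\<close> and \<open>y_k = x_0 x_k / w\<close>. The degree
  \<open>M + 2\<close> is the least for which the subtraction never truncates when
  \<open>a < M\<close> and \<open>e1, e2, e3 < 2\<close>.\<close>

definition aux_monomial :: "nat \<Rightarrow> int \<Rightarrow> int \<Rightarrow> int ^ 4 \<Rightarrow> nat \<Rightarrow> nat \<Rightarrow> nat \<Rightarrow> nat \<Rightarrow> int" where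
  "aux_monomial M u w x a e1 e2 e3 =
     u ^ a * w ^ (M + 2 - e1 - e2 - e3 - a) * (x $ 0 * x $ 1) ^ e1 * (x $ 0 * x $ 2) ^ e2 * (x $ 0 * x $ 3) ^ e3"

text \<open>The exponents \<open>a\<close> and \<open>M - 1 - a\<close> run through the same values.
  This is why an unbalanced pair \<open>U, W\<close> costs nothing.\<close>

lemma prod_power_exchange:
  fixes U W :: real
  shows "(\<Prod>a<M. U ^ a * W ^ (M - 1 - a)) = (U * W) ^ (M * (M - 1) div 2)"
proof -
  have 1: "(\<Sum>a<M. a) = M * (M - 1) div 2"
  proof -
    have "2 * (\<Sum>a<M. a) = M * (M - 1)"
    proof (induction M)
      case (Suc M)
      then show ?case by (cases M) auto
    qed simp
    from this[symmetric] show ?thesis by simp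
  qed
  have "(\<Prod>a<M. W ^ (M - 1 - a)) = (\<Prod>a<M. W ^ a)"
    using prod.nat_diff_reindex[of "\<lambda>a. W ^ a" M] by simp
  then have "(\<Prod>a<M. U ^ a * W ^ (M - 1 - a)) = U ^ (\<Sum>a<M. a) * W ^ (\<Sum>a<M. a)"
    by (simp add: prod.distrib power_sum)
  then show ?thesis unfolding 1 by (simp add: power_mult_distrib)
qed

text \<open>The hypothesis \<open>size\<close> is the pigeonhole condition of
  \<open>siegel_congruences\<close> for \<open>n = 8 M\<close> and the weights
  \<open>U ^ a * W ^ (M - 1 - a) * Y ^ 3\<close>, applied to the first \<open>n\<close> Taylor
  coefficients of the monomials in the local parameter.\<close>

lemma class_auxiliary_form:
  fixes v1 v2 :: "int ^ 4" and p :: int and S :: "(int ^ 4) set" and u w :: "int ^ 4 \<Rightarrow> int"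
    and U W Y :: real
  assumes p: "prime p" "\<not> p dvd 2" "\<not> p dvd plucker v1 v2 i j" and e: "e > 0" and ij: "i \<noteq> j"
    and sq: "\<And>x k. x \<in> S \<Longrightarrow> (x $ k)\<^sup>2 = v1 $ k * u x + v2 $ k * w x"
    and cl: "\<And>x y k. x \<in> S \<Longrightarrow> y \<in> S \<Longrightarrow> [x $ k = y $ k] (mod p)"
    and unit: "\<And>x k. x \<in> S \<Longrightarrow> k \<noteq> i \<Longrightarrow> \<not> p dvd x $ k"
    and qcl: "\<And>x y. x \<in> S \<Longrightarrow> y \<in> S \<Longrightarrow> p ^ e dvd x $ i * y $ j - y $ i * x $ j"
    and M: "M > 0" and pos: "U > 0" "W > 0" "W \<le> Y"
    and bd: "\<And>x. x \<in> S \<Longrightarrow> \<bar>real_of_int (u x)\<bar> \<le> U" "\<And>x. x \<in> S \<Longrightarrow> \<bar>real_of_int (w x)\<bar> \<le> W"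
      "\<And>x k l. x \<in> S \<Longrightarrow> \<bar>real_of_int (x $ k * x $ l)\<bar> \<le> Y"
    and size: "real (8 * M + 1) ^ (8 * M) * ((U * W) ^ (4 * M * (M - 1)) * Y ^ (24 * M))
       \<le> real_of_int (p ^ e) ^ (4 * M * (8 * M - 1))"
  shows "\<exists>c. (\<exists>a<M. \<exists>e1<2. \<exists>e2<2. \<exists>e3<2. c a e1 e2 e3 \<noteq> 0) \<and>
    (\<forall>x\<in>S. (\<Sum>a<M. \<Sum>e1<2. \<Sum>e2<2. \<Sum>e3<2. c a e1 e2 e3 * aux_monomial M (u x) (w x) x a e1 e2 e3) = 0)"
proof -
  define n where "n = 8 * M"
  have n: "n > 0" using M by (simp add: n_def)
  have "\<exists>z T g gu gw. \<forall>x\<in>S. coprime (z x) p \<and> p ^ e dvd T x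
     \<and> (\<forall>k. [x $ k * z x = poly (g k) (T x)] (mod p ^ (e * n)))
     \<and> [u x * (z x)\<^sup>2 = poly gu (T x)] (mod p ^ (e * n))
     \<and> [w x * (z x)\<^sup>2 = poly gw (T x)] (mod p ^ (e * n))"
    by (rule local_expansion[OF p e n ij]) (rule sq cl unit qcl; assumption)+
  then obtain z T g gu gw where loc0: "\<forall>x\<in>S. coprime (z x) p \<and> p ^ e dvd T x
     \<and> (\<forall>k. [x $ k * z x = poly (g k) (T x)] (mod p ^ (e * n)))
     \<and> [u x * (z x)\<^sup>2 = poly gu (T x)] (mod p ^ (e * n))
     \<and> [w x * (z x)\<^sup>2 = poly gw (T x)] (mod p ^ (e * n))" by blast
  have loc: "\<And>x. x \<in> S \<Longrightarrow> coprime (z x) p" "\<And>x. x \<in> S \<Longrightarrow> p ^ e dvd T x"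
     "\<And>x k. x \<in> S \<Longrightarrow> [x $ k * z x = poly (g k) (T x)] (mod p ^ (e * n))"
     "\<And>x. x \<in> S \<Longrightarrow> [u x * (z x)\<^sup>2 = poly gu (T x)] (mod p ^ (e * n))"
     "\<And>x. x \<in> S \<Longrightarrow> [w x * (z x)\<^sup>2 = poly gw (T x)] (mod p ^ (e * n))"
    using loc0 by auto
  define q where "q = nat (p ^ e)"
  have q: "int q = p ^ e" "q > 0"
    using prime_gt_0_int[OF p(1)] by (auto simp: q_def)
  define J :: "(nat \<times> nat \<times> nat \<times> nat) set" where "J = {..<M} \<times> {..<2} \<times> {..<2} \<times> {..<2}"
  \<comment> \<open>Beside \<open>u ^ a * w ^ (M - 1 - a)\<close> a monomial has exactly three more
    factors, each equal to \<open>w\<close> or to some \<open>x_0 x_k\<close> and hence at most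
    \<open>Y\<close>.\<close>
  define F where "F = (\<lambda>(a, e1 :: nat, e2 :: nat, e3 :: nat). (U ^ a * W ^ (M - 1 - a)) * Y ^ 3)"
  define \<Phi> where "\<Phi> x = (\<lambda>(a, e1, e2, e3). aux_monomial M (u x) (w x) x a e1 e2 e3)" for x
  define G where "G = (\<lambda>(a, e1, e2, e3). gu ^ a * gw ^ (M + 2 - e1 - e2 - e3 - a)
      * (g 0 * g 1) ^ e1 * (g 0 * g 2) ^ e2 * (g 0 * g 3) ^ e3)"
  have J: "finite J" "card J = n" by (auto simp: J_def n_def card_cartesian_product)
  have Y: "Y > 0" using pos by simp
  have Fpos: "F j > 0" for j using pos Y by (auto simp: F_def split: prod.splits)
  have prodF: "(\<Prod>j\<in>J. F j) = (U * W) ^ (4 * M * (M - 1)) * Y ^ (24 * M)"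
  proof -
    have "(\<Prod>j\<in>J. F j) = (\<Prod>a<M. ((U ^ a * W ^ (M - 1 - a)) * Y ^ 3) ^ 8)"
      unfolding J_def F_def prod.cartesian_product'[symmetric]
      by (simp add: prod.cartesian_product[symmetric] card_cartesian_product)
    also have "\<dots> = ((\<Prod>a<M. U ^ a * W ^ (M - 1 - a)) * (Y ^ 3) ^ M) ^ 8"
      by (simp add: prod_power_distrib[symmetric] prod.distrib)
    also have "\<dots> = (U * W) ^ (M * (M - 1) div 2 * 8) * Y ^ (3 * M * 8)"
      unfolding prod_power_exchange by (simp only: power_mult[symmetric] power_mult_distrib[of "(U * W) ^ (M * (M - 1) div 2)"])
    also have "M * (M - 1) div 2 * 8 = 4 * M * (M - 1)"
    proof -
      have "even (M * (M - 1))" by auto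
      then obtain k where "M * (M - 1) = 2 * k" by (elim evenE)
      then show ?thesis by (simp only: mult.assoc) simp
    qed
    finally show ?thesis by (simp add: mult.commute)
  qed
  have "real (n + 1) ^ n * (\<Prod>j\<in>J. F j) \<le> real q ^ (n * (n - 1) div 2)"
  proof -
    have ne: "n * (n - 1) div 2 = 4 * M * (8 * M - 1)" by (simp add: n_def)
    have "real_of_int (int q) = real_of_int (p ^ e)" by (simp only: q(1))
    then have "real q = real_of_int (p ^ e)" by (simp only: of_int_of_nat_eq)
    then show ?thesis using size unfolding prodF ne by (simp only: n_def)
  qed
  from siegel_congruences[OF J n q(2) Fpos this, of "\<lambda>j i. poly.coeff (G j) i"]
  obtain c where c: "\<exists>j\<in>J. c j \<noteq> 0" "(\<Sum>j\<in>J. \<bar>real_of_int (c j)\<bar> * F j) < real q ^ n"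
    "\<And>i. i < n \<Longrightarrow> int q ^ (n - i) dvd (\<Sum>j\<in>J. c j * poly.coeff (G j) i)" by blast
  have zero: "(\<Sum>j\<in>J. c j * \<Phi> x j) = 0" if x: "x \<in> S" for x
  proof -
    define Q where "Q = int q ^ n"
    have Q: "Q = p ^ (e * n)" by (simp add: Q_def q power_mult)
    \<comment> \<open>A monomial has \<open>M + 2\<close> factors among \<open>u\<close>,
      \<open>w\<close> and the \<open>x_0 x_k\<close>; the power of \<open>z x\<close> supplies two
      copies of \<open>z x\<close> to each, as the expansions require.\<close>
    have \<Phi>G: "[\<Phi> x j * (z x)\<^sup>2 ^ (M + 2) = poly (G j) (T x)] (mod Q)" if "j \<in> J" for j
    proof -
      obtain a e1 e2 e3 where j: "j = (a, e1, e2, e3)" by (cases j) auto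
      have lt: "a < M" "e1 < 2" "e2 < 2" "e3 < 2" using that by (auto simp: J_def j)
      then have "M + 2 = a + (M + 2 - e1 - e2 - e3 - a) + e1 + e2 + e3" by linarith
      then have "(z x)\<^sup>2 ^ (M + 2) = (z x)\<^sup>2 ^ (a + (M + 2 - e1 - e2 - e3 - a) + e1 + e2 + e3)" by (rule arg_cong)
      then have eq: "\<Phi> x j * (z x)\<^sup>2 ^ (M + 2) = (u x * (z x)\<^sup>2) ^ a * (w x * (z x)\<^sup>2) ^ (M + 2 - e1 - e2 - e3 - a)
         * ((x $ 0 * z x) * (x $ 1 * z x)) ^ e1 * ((x $ 0 * z x) * (x $ 2 * z x)) ^ e2 * ((x $ 0 * z x) * (x $ 3 * z x)) ^ e3"
        by (simp only: \<Phi>_def j aux_monomial_def power_add power_mult_distrib prod.case power2_eq_square mult_ac)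
      have G: "poly (G j) (T x) = poly gu (T x) ^ a * poly gw (T x) ^ (M + 2 - e1 - e2 - e3 - a)
         * (poly (g 0) (T x) * poly (g 1) (T x)) ^ e1 * (poly (g 0) (T x) * poly (g 2) (T x)) ^ e2
         * (poly (g 0) (T x) * poly (g 3) (T x)) ^ e3"
        by (simp only: G_def j prod.case poly_mult poly_power)
      show ?thesis
        unfolding eq G Q by (intro cong_mult cong_pow loc x)
    qed
    have "Q dvd (\<Sum>j\<in>J. c j * \<Phi> x j) * (z x)\<^sup>2 ^ (M + 2)"
    proof -
      have A: "[(\<Sum>j\<in>J. c j * \<Phi> x j) * (z x)\<^sup>2 ^ (M + 2) = (\<Sum>j\<in>J. c j * (\<Sum>i<n. poly.coeff (G j) i * T x ^ i))] (mod Q)"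
        unfolding sum_distrib_right mult.assoc
      proof (intro cong_sum cong_mult cong_refl)
        fix j assume "j \<in> J"
        moreover have "[poly (G j) (T x) = (\<Sum>i<n. poly.coeff (G j) i * T x ^ i)] (mod Q)"
          unfolding cong_iff_dvd_diff Q_def q by (rule poly_truncate_dvd[OF loc(2)[OF x]])
        ultimately show "[\<Phi> x j * (z x)\<^sup>2 ^ (M + 2) = (\<Sum>i<n. poly.coeff (G j) i * T x ^ i)] (mod Q)"
          using \<Phi>G cong_trans by blast
      qed
      have B: "(\<Sum>j\<in>J. c j * (\<Sum>i<n. poly.coeff (G j) i * T x ^ i)) = (\<Sum>i<n. T x ^ i * (\<Sum>j\<in>J. c j * poly.coeff (G j) i))"
        unfolding sum_distrib_left by (subst sum.swap) (simp add: mult_ac)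
      have "Q dvd (\<Sum>i<n. T x ^ i * (\<Sum>j\<in>J. c j * poly.coeff (G j) i))"
      proof (rule dvd_sum)
        fix i assume "i \<in> {..<n}"
        then have i: "i < n" by simp
        \<comment> \<open>\<open>T x ^ i\<close> supplies \<open>q ^ i\<close>, and the pigeonhole
          choice of \<open>c\<close> supplies the missing \<open>q ^ (n - i)\<close>.\<close>
        have "int q ^ i dvd T x ^ i" unfolding q by (rule dvd_power_same[OF loc(2)[OF x]])
        then have "int q ^ i * int q ^ (n - i) dvd T x ^ i * (\<Sum>j\<in>J. c j * poly.coeff (G j) i)"
          by (rule mult_dvd_mono[OF _ c(3)[OF i]])
        then show "Q dvd T x ^ i * (\<Sum>j\<in>J. c j * poly.coeff (G j) i)"
          using i by (simp add: Q_def flip: power_add)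
      qed
      then show ?thesis by (simp only: cong_dvd_iff[OF A] B)
    qed
    moreover have "coprime Q ((z x)\<^sup>2 ^ (M + 2))"
      using loc(1)[OF x] by (simp add: Q coprime_commute)
    ultimately have dv: "Q dvd (\<Sum>j\<in>J. c j * \<Phi> x j)" by (simp add: coprime_dvd_mult_left_iff)
    have \<Phi>F: "\<bar>real_of_int (\<Phi> x j)\<bar> \<le> F j" if "j \<in> J" for j
    proof -
      obtain a e1 e2 e3 where j: "j = (a, e1, e2, e3)" by (cases j) auto
      have lt: "a < M" "e1 < 2" "e2 < 2" "e3 < 2" using that by (auto simp: J_def j)
      then have ex: "M + 2 - e1 - e2 - e3 - a = (M - 1 - a) + (3 - e1 - e2 - e3)"
        and ex': "3 - e1 - e2 - e3 + e1 + e2 + e3 = 3" by linarith+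
      let ?a = "\<lambda>t :: int. \<bar>real_of_int t\<bar>"
      have "?a (\<Phi> x j) = ?a (u x) ^ a * ?a (w x) ^ (M - 1 - a) * (?a (w x) ^ (3 - e1 - e2 - e3)
          * ?a (x $ 0 * x $ 1) ^ e1 * ?a (x $ 0 * x $ 2) ^ e2 * ?a (x $ 0 * x $ 3) ^ e3)"
        unfolding \<Phi>_def j aux_monomial_def ex prod.case
        by (simp only: of_int_mult of_int_power abs_mult power_abs power_add mult_ac)
      also have "\<dots> \<le> U ^ a * W ^ (M - 1 - a) * (Y ^ (3 - e1 - e2 - e3) * Y ^ e1 * Y ^ e2 * Y ^ e3)"
        using pos Y by (intro mult_mono power_mono bd x order_trans[OF bd(2)[OF x] pos(3)]) (auto intro!: mult_nonneg_nonneg)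
      also have "Y ^ (3 - e1 - e2 - e3) * Y ^ e1 * Y ^ e2 * Y ^ e3 = Y ^ 3"
        unfolding power_add[symmetric] ex' ..
      finally show ?thesis by (simp add: F_def j)
    qed
    have "\<bar>real_of_int (\<Sum>j\<in>J. c j * \<Phi> x j)\<bar> \<le> (\<Sum>j\<in>J. \<bar>real_of_int (c j * \<Phi> x j)\<bar>)"
      unfolding of_int_sum by (rule sum_abs)
    also have "\<dots> \<le> (\<Sum>j\<in>J. \<bar>real_of_int (c j)\<bar> * F j)"
      by (intro sum_mono) (simp add: abs_mult mult_left_mono \<Phi>F)
    also have "\<dots> < real q ^ n" by (rule c(2))
    also have "\<dots> = real_of_int Q" by (simp add: Q_def)
    finally have lt: "\<bar>\<Sum>j\<in>J. c j * \<Phi> x j\<bar> < Q" by linarith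
    show ?thesis
    proof (rule ccontr)
      assume "(\<Sum>j\<in>J. c j * \<Phi> x j) \<noteq> 0"
      from dvd_imp_le_int[OF this dv] lt show False by linarith
    qed
  qed
  define d where "d a e1 e2 e3 = c (a, e1, e2, e3)" for a e1 e2 e3
  have "(\<Sum>a<M. \<Sum>e1<2. \<Sum>e2<2. \<Sum>e3<2. d a e1 e2 e3 * aux_monomial M (u x) (w x) x a e1 e2 e3) = 0" if "x \<in> S" for x
    using zero[OF that] unfolding J_def by (simp add: d_def \<Phi>_def sum.cartesian_product')
  moreover have "\<exists>a<M. \<exists>e1<2. \<exists>e2<2. \<exists>e3<2. d a e1 e2 e3 \<noteq> 0"
    using c(1) by (auto simp: J_def d_def)
  ultimately show ?thesis by blast
qed

subsection \<open>Zeros of auxiliary forms\<close>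

lemma card_same_abs:
  fixes y :: "int ^ 4"
  shows "finite {x :: int ^ 4. \<forall>k. \<bar>x $ k\<bar> = \<bar>y $ k\<bar>}" "card {x :: int ^ 4. \<forall>k. \<bar>x $ k\<bar> = \<bar>y $ k\<bar>} \<le> 16"
proof -
  let ?P = "PiE UNIV (\<lambda>k. {y $ k, - y $ k}) :: (4 \<Rightarrow> int) set"
  have sub: "{x :: int ^ 4. \<forall>k. \<bar>x $ k\<bar> = \<bar>y $ k\<bar>} \<subseteq> vec_lambda ` ?P"
  proof
    fix x :: "int ^ 4" assume "x \<in> {x. \<forall>k. \<bar>x $ k\<bar> = \<bar>y $ k\<bar>}"
    then have "vec_nth x \<in> ?P" by (auto simp: abs_eq_iff)
    then show "x \<in> vec_lambda ` ?P" by (intro image_eqI[of _ _ "vec_nth x"]) simp_all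
  qed
  have fin: "finite ?P" by (intro finite_PiE) auto
  then show "finite {x :: int ^ 4. \<forall>k. \<bar>x $ k\<bar> = \<bar>y $ k\<bar>}" using sub finite_surj by blast
  have "card {x :: int ^ 4. \<forall>k. \<bar>x $ k\<bar> = \<bar>y $ k\<bar>} \<le> card (vec_lambda ` ?P)"
    using sub fin by (intro card_mono) auto
  also have "\<dots> \<le> card ?P" using fin by (rule card_image_le)
  also have "\<dots> = (\<Prod>k\<in>UNIV. card {y $ k, - y $ k})" by (simp add: card_PiE)
  also have "\<dots> \<le> (\<Prod>k\<in>(UNIV :: 4 set). 2)" by (intro prod_mono) (auto simp: card_insert_if)
  also have "\<dots> = 16" by simp
  finally show "card {x :: int ^ 4. \<forall>k. \<bar>x $ k\<bar> = \<bar>y $ k\<bar>} \<le> 16" .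
qed

text \<open>Proportional squares give \<open>|y_l x_k| = |x_l y_k|\<close> for all \<open>k\<close>.
  By primitivity the gcd over \<open>k\<close> is \<open>|y_l|\<close> on the left and
  \<open>|x_l|\<close> on the right.\<close>

lemma primitive_parallel_squares:
  assumes x: "primitive x" and y: "primitive y"
    and eq: "\<And>k l. (x $ k)\<^sup>2 * (y $ l)\<^sup>2 = (x $ l)\<^sup>2 * (y $ k)\<^sup>2"
  shows "\<bar>x $ l\<bar> = \<bar>y $ l\<bar>"
proof -
  have "\<bar>y $ l * x $ k\<bar> = \<bar>x $ l * y $ k\<bar>" for k
  proof -
    have "(y $ l * x $ k)\<^sup>2 = (x $ l * y $ k)\<^sup>2"
      using eq[of k l] by (simp add: power_mult_distrib mult.commute)
    then show ?thesis by (simp only: power2_eq_iff abs_eq_iff)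
  qed
  then have im: "abs ` ((*) (y $ l) ` range (\<lambda>k. x $ k)) = abs ` ((*) (x $ l) ` range (\<lambda>k. y $ k))"
    by (auto simp: image_image)
  have G: "Gcd (abs ` ((*) c ` range (\<lambda>i. z $ i))) = \<bar>c\<bar>" if "primitive z" for c and z :: "int ^ 4"
  proof -
    have "Gcd (abs ` A) = Gcd A" for A :: "int set"
    proof (rule Gcd_eqI)
      fix c assume "\<And>b. b \<in> abs ` A \<Longrightarrow> c dvd b"
      then have "c dvd \<bar>b\<bar>" if "b \<in> A" for b using that by blast
      then show "c dvd Gcd A" by (intro Gcd_greatest) simp
    qed auto
    then show ?thesis using that by (simp add: primitive_def Gcd_mult abs_mult)
  qed
  show ?thesis using G[OF x, of "y $ l"] G[OF y, of "x $ l"] im by simp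
qed

lemma odd_order_nonsquare:
  fixes a b E :: "complex poly"
  assumes "odd (order r E)" "E \<noteq> 0" "a\<^sup>2 = E * b\<^sup>2"
  shows "b = 0"
proof (rule ccontr)
  assume b: "b \<noteq> 0"
  then have nz: "E * b\<^sup>2 \<noteq> 0" using assms by simp
  then have a: "a \<noteq> 0" using assms(3) by auto
  have "order r (a\<^sup>2) = 2 * order r a" using a by (simp add: power2_eq_square order_mult)
  moreover have "order r (E * b\<^sup>2) = order r E + 2 * order r b"
    using nz b by (simp add: order_mult power2_eq_square)
  ultimately have "2 * order r a = order r E + 2 * order r b" using assms(3) by simp
  then have "even (order r E)" by presburger
  then show False using assms(1) by simp
qed

text \<open>Of two non-proportional forms at most one is constant in the variable, so two indices in
  \<open>K\<close> guarantee a factor with a root. No other factor vanishes there, and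
  \<open>F ^ 2\<close> contributes an even order.\<close>

lemma linear_products_nonsquare:
  fixes \<alpha> \<beta> :: "'i \<Rightarrow> complex"
  assumes det: "\<And>i j. i \<noteq> j \<Longrightarrow> \<alpha> i * \<beta> j \<noteq> \<alpha> j * \<beta> i"
    and ij: "finite K" "i \<in> K" "j \<in> K" "i \<noteq> j" and eq: "a\<^sup>2 = ((\<Prod>k\<in>K. [:\<beta> k, \<alpha> k:]) * F\<^sup>2) * b\<^sup>2" and F: "F \<noteq> 0"
  shows "b = 0"
proof -
  obtain k where k: "k \<in> K" "\<alpha> k \<noteq> 0" 
    using det[OF ij(4)] ij(2,3) by (cases "\<alpha> i = 0") auto
  define r where "r = - \<beta> k / \<alpha> k"
  have nz: "[:\<beta> l, \<alpha> l:] \<noteq> 0" if "l \<in> K" for l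
    using det[of l i] det[of l j] ij(4) by (cases "l = i") auto
  have rk: "poly [:\<beta> k, \<alpha> k:] r = 0" using k by (simp add: r_def)
  have other: "poly [:\<beta> l, \<alpha> l:] r \<noteq> 0" if "l \<noteq> k" for l
  proof
    assume "poly [:\<beta> l, \<alpha> l:] r = 0"
    then have "\<alpha> k * \<beta> l = \<alpha> l * \<beta> k" using k by (simp add: r_def field_simps)
    then show False using det[of k l] that by auto
  qed
  have ok: "order r [:\<beta> k, \<alpha> k:] = 1"
  proof -
    have "[:\<beta> k, \<alpha> k:] = smult (\<alpha> k) [:- r, 1:]" using k by (simp add: r_def)
    then have "order r [:\<beta> k, \<alpha> k:] = order r [:- r, 1:]" using order_smult[OF k(2)] by metis
    also have "\<dots> = 1" using order_power_n_n[of r 1] by simp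
    finally show ?thesis .
  qed
  have Pnz: "(\<Prod>l\<in>K. [:\<beta> l, \<alpha> l:]) \<noteq> 0" using nz ij(1) by simp
  have R: "order r (\<Prod>l\<in>K - {k}. [:\<beta> l, \<alpha> l:]) = 0"
    by (rule order_0I) (use other ij(1) in \<open>auto simp: poly_prod\<close>)
  have P: "(\<Prod>l\<in>K. [:\<beta> l, \<alpha> l:]) = [:\<beta> k, \<alpha> k:] * (\<Prod>l\<in>K - {k}. [:\<beta> l, \<alpha> l:])"
    using k ij(1) by (simp add: prod.remove)
  have "order r (\<Prod>l\<in>K. [:\<beta> l, \<alpha> l:]) = 1"
    using order_mult[OF Pnz[unfolded P], of r] unfolding P ok R by (simp only: add_0_right)
  then have "order r ((\<Prod>l\<in>K. [:\<beta> l, \<alpha> l:]) * F\<^sup>2) = 1 + 2 * order r F"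
    using Pnz F by (simp add: order_mult power2_eq_square)
  then have "odd (order r ((\<Prod>l\<in>K. [:\<beta> l, \<alpha> l:]) * F\<^sup>2))" by simp
  then show ?thesis using odd_order_nonsquare[OF _ _ eq] Pnz F by simp
qed

text \<open>The norm has at most \<open>8 M + 34\<close> roots \<open>t = u / w\<close>, and
  \<open>w = 0\<close> adds the point at infinity. Each of these ratios fixes the absolute values of
  the coordinates and so belongs to at most 16 vectors.\<close>

lemma card_zeros_le:
  fixes v1 v2 :: "int ^ 4" and S :: "(int ^ 4) set" and u w :: "int ^ 4 \<Rightarrow> int"
  assumes det: "\<And>i j. i \<noteq> j \<Longrightarrow> plucker v1 v2 i j \<noteq> 0"
    and sq: "\<And>x k. x \<in> S \<Longrightarrow> (x $ k)\<^sup>2 = v1 $ k * u x + v2 $ k * w x"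
    and prim: "\<And>x. x \<in> S \<Longrightarrow> primitive x"
    and nz: "a < M" "i < 2" "j < 2" "l < 2" "c a i j l \<noteq> 0"
    and zero: "\<And>x. x \<in> S \<Longrightarrow> (\<Sum>a<M. \<Sum>i<2. \<Sum>j<2. \<Sum>l<2. c a i j l * aux_monomial M (u x) (w x) x a i j l) = 0"
  shows "finite S \<and> card S \<le> 16 * (8 * M + 35)"
proof -
  define lin where "lin k = [:complex_of_int (v2 $ k), complex_of_int (v1 $ k):]" for k
  define f where "f i j l = (\<Sum>a<M. monom (complex_of_int (c a i j l)) a)" for i j l
  define t where "t x = complex_of_int (u x) / complex_of_int (w x)" for x
  have det': "complex_of_int (v1 $ i) * complex_of_int (v2 $ j) \<noteq> complex_of_int (v1 $ j) * complex_of_int (v2 $ i)" if "i \<noteq> j" for i j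
    using det[OF that] unfolding plucker_def of_int_mult[symmetric] of_int_eq_iff by simp
  have lin0: "lin 0 \<noteq> 0"
    using det'[of 0 1] by (auto simp: lin_def)
  have dist: "(0 :: 4) \<noteq> 1" "(0 :: 4) \<noteq> 2" "(0 :: 4) \<noteq> 3" "(1 :: 4) \<noteq> 2" "(1 :: 4) \<noteq> 3" "(2 :: 4) \<noteq> 3"
    by simp_all
  \<comment> \<open>Once a square of \<open>lin 0\<close> is split off where possible, each product
    still consists of at least two distinct linear forms.\<close>
  have ns: "b = 0" if E: "E \<in> {lin 0 * lin 1, lin 0 * lin 2, lin 0 * lin 3, lin 0 * lin 1 * (lin 0 * lin 2),
      lin 0 * lin 1 * (lin 0 * lin 3), lin 0 * lin 2 * (lin 0 * lin 3), lin 0 * lin 1 * (lin 0 * lin 2 * (lin 0 * lin 3))}"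
    and ab: "a\<^sup>2 = E * b\<^sup>2" for E a b
  proof -
    have *: "b = 0" if "E = (\<Prod>k\<in>K. lin k) * F\<^sup>2" "F \<noteq> 0" "i \<in> K" "j \<in> K" "i \<noteq> j" for K F i j
      by (rule linear_products_nonsquare[OF det' _ that(3-5) _ that(2)])
        (use ab that(1) in \<open>simp_all add: lin_def\<close>)
    have eqs: "lin 0 * lin k = (\<Prod>k\<in>{0, k}. lin k) * 1\<^sup>2" if "0 \<noteq> k" for k using that by simp
    have eqs2: "lin 0 * lin k * (lin 0 * lin m) = (\<Prod>k\<in>{k, m}. lin k) * (lin 0)\<^sup>2" if "k \<noteq> m" for k m
      using that by (simp add: power2_eq_square)
    have eqs3: "lin 0 * lin 1 * (lin 0 * lin 2 * (lin 0 * lin 3)) = (\<Prod>k\<in>{0, 1, 2, 3}. lin k) * (lin 0)\<^sup>2"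
      by (simp add: power2_eq_square)
    from E consider "E = lin 0 * lin 1" | "E = lin 0 * lin 2" | "E = lin 0 * lin 3"
      | "E = lin 0 * lin 1 * (lin 0 * lin 2)" | "E = lin 0 * lin 1 * (lin 0 * lin 3)"
      | "E = lin 0 * lin 2 * (lin 0 * lin 3)" | "E = lin 0 * lin 1 * (lin 0 * lin 2 * (lin 0 * lin 3))"
      by blast
    then show ?thesis
    proof cases
      case 1 show ?thesis by (rule *[OF trans[OF 1 eqs[OF dist(1)]] _ _ _ dist(1)]) simp_all
    next
      case 2 show ?thesis by (rule *[OF trans[OF 2 eqs[OF dist(2)]] _ _ _ dist(2)]) simp_all
    next
      case 3 show ?thesis by (rule *[OF trans[OF 3 eqs[OF dist(3)]] _ _ _ dist(3)]) simp_all
    next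
      case 4 show ?thesis by (rule *[OF trans[OF 4 eqs2[OF dist(4)]] lin0 _ _ dist(4)]) simp_all
    next
      case 5 show ?thesis by (rule *[OF trans[OF 5 eqs2[OF dist(5)]] lin0 _ _ dist(5)]) simp_all
    next
      case 6 show ?thesis by (rule *[OF trans[OF 6 eqs2[OF dist(6)]] lin0 _ _ dist(6)]) simp_all
    next
      case 7 show ?thesis by (rule *[OF trans[OF 7 eqs3] lin0 _ _ dist(1)]) simp_all
    qed
  qed
  have degf: "degree (f i j l) \<le> M" for i j l
    unfolding f_def by (rule degree_sum_le) (auto intro: order_trans[OF degree_monom_le])
  have fnz: "f i j l \<noteq> 0"
  proof
    assume "f i j l = 0"
    then have "poly.coeff (f i j l) a = 0" by simp
    then show False using nz(1,5) by (simp add: f_def coeff_sum)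
  qed
  have deglin: "degree (lin i * lin j) \<le> 2" for i j
    using degree_mult_le[of "lin i" "lin j"] by (auto simp: lin_def split: if_splits)
  have "\<exists>N. N \<noteq> 0 \<and> degree N \<le> 8 * M + 34 \<and>
    (\<forall>t y1 y2 y3. y1\<^sup>2 = poly (lin 0 * lin 1) t \<longrightarrow> y2\<^sup>2 = poly (lin 0 * lin 2) t \<longrightarrow> y3\<^sup>2 = poly (lin 0 * lin 3) t \<longrightarrow>
       (\<Sum>i<2. \<Sum>j<2. \<Sum>l<2. poly (f i j l) t * y1 ^ i * y2 ^ j * y3 ^ l) = 0 \<longrightarrow> poly N t = 0)"
    by (rule multiquadratic_norm, erule ns, assumption, rule degf, rule deglin, rule deglin, rule deglin,
        rule nz(2), rule nz(3), rule nz(4), rule fnz)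
  then obtain N where N: "N \<noteq> 0" "degree N \<le> 8 * M + 34"
    and Nz: "\<And>t y1 y2 y3. y1\<^sup>2 = poly (lin 0 * lin 1) t \<Longrightarrow> y2\<^sup>2 = poly (lin 0 * lin 2) t \<Longrightarrow> y3\<^sup>2 = poly (lin 0 * lin 3) t \<Longrightarrow>
       (\<Sum>i<2. \<Sum>j<2. \<Sum>l<2. poly (f i j l) t * y1 ^ i * y2 ^ j * y3 ^ l) = 0 \<Longrightarrow> poly N t = 0"
    by blast
  have root: "poly N (t x) = 0" if x: "x \<in> S" and w0: "w x \<noteq> 0" for x
  proof -
    define W where "W = complex_of_int (w x)"
    define y where "y k = complex_of_int (x $ 0 * x $ k) / W" for k
    have W: "W \<noteq> 0" using w0 by (simp add: W_def)
    have lint: "poly (lin k) (t x) = complex_of_int ((x $ k)\<^sup>2) / W" for k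
      unfolding sq[OF x] using W by (simp add: lin_def t_def W_def field_simps)
    have y: "(y k)\<^sup>2 = poly (lin 0 * lin k) (t x)" for k
      by (simp add: lint y_def power_divide power_mult_distrib power2_eq_square)
    have monomial: "t x ^ a * y 1 ^ i * y 2 ^ j * y 3 ^ l = complex_of_int (aux_monomial M (u x) (w x) x a i j l) / W ^ (M + 2)"
      if "a < M" "i < 2" "j < 2" "l < 2" for a i j l
    proof -
      have "M + 2 = a + (M + 2 - i - j - l - a) + i + j + l" using that by linarith
      then have "W ^ (M + 2) = W ^ (a + (M + 2 - i - j - l - a) + i + j + l)" by (rule arg_cong)
      then have "W ^ (M + 2) = W ^ a * W ^ (M + 2 - i - j - l - a) * W ^ i * W ^ j * W ^ l" by (simp only: power_add)
      then have "complex_of_int (aux_monomial M (u x) (w x) x a i j l) / W ^ (M + 2) =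
         (complex_of_int (u x) ^ a / W ^ a) * (W ^ (M + 2 - i - j - l - a) / W ^ (M + 2 - i - j - l - a))
         * (complex_of_int (x $ 0 * x $ 1) ^ i / W ^ i) * (complex_of_int (x $ 0 * x $ 2) ^ j / W ^ j)
         * (complex_of_int (x $ 0 * x $ 3) ^ l / W ^ l)"
        by (simp only: aux_monomial_def of_int_mult of_int_power W_def times_divide_times_eq mult.assoc)
      also have "\<dots> = t x ^ a * y 1 ^ i * y 2 ^ j * y 3 ^ l"
        using W by (simp only: t_def y_def W_def[symmetric] power_divide) simp
      finally show ?thesis by simp
    qed
    have "(\<Sum>i<2. \<Sum>j<2. \<Sum>l<2. poly (f i j l) (t x) * y 1 ^ i * y 2 ^ j * y 3 ^ l)
       = (\<Sum>i<2. \<Sum>j<2. \<Sum>l<2. \<Sum>a<M. complex_of_int (c a i j l * aux_monomial M (u x) (w x) x a i j l) / W ^ (M + 2))"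
    proof (intro sum.cong refl)
      fix i j l :: nat assume ijl: "i \<in> {..<2}" "j \<in> {..<2}" "l \<in> {..<2}"
      have "poly (f i j l) (t x) * y 1 ^ i * y 2 ^ j * y 3 ^ l = (\<Sum>a<M. complex_of_int (c a i j l) * (t x ^ a * y 1 ^ i * y 2 ^ j * y 3 ^ l))"
        by (simp add: f_def poly_sum poly_monom sum_distrib_right mult.assoc)
      also have "\<dots> = (\<Sum>a<M. complex_of_int (c a i j l * aux_monomial M (u x) (w x) x a i j l) / W ^ (M + 2))"
      proof (intro sum.cong refl)
        fix a assume "a \<in> {..<M}"
        then show "complex_of_int (c a i j l) * (t x ^ a * y 1 ^ i * y 2 ^ j * y 3 ^ l) = complex_of_int (c a i j l * aux_monomial M (u x) (w x) x a i j l) / W ^ (M + 2)"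
          using ijl by (subst monomial) simp_all
      qed
      finally show "poly (f i j l) (t x) * y 1 ^ i * y 2 ^ j * y 3 ^ l = (\<Sum>a<M. complex_of_int (c a i j l * aux_monomial M (u x) (w x) x a i j l) / W ^ (M + 2))" .
    qed
    also have "\<dots> = complex_of_int (\<Sum>a<M. \<Sum>i<2. \<Sum>j<2. \<Sum>l<2. c a i j l * aux_monomial M (u x) (w x) x a i j l) / W ^ (M + 2)"
      unfolding of_int_sum sum_divide_distrib by (simp only: numeral_2_eq_2 sum.lessThan_Suc sum.distrib lessThan_0 sum.empty
          sum.neutral_const add_0_left add_0_right add_ac)
    also have "\<dots> = 0" by (simp only: zero[OF x]) simp
    finally show ?thesis by (rule Nz[OF y y y])
  qed
  have fib: "finite A \<and> card A \<le> 16" if "A \<subseteq> S" and uw: "\<And>x y. x \<in> A \<Longrightarrow> y \<in> A \<Longrightarrow> u x * w y = u y * w x" for A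
  proof (cases "A = {}")
    case False
    then obtain y where y: "y \<in> A" by blast
    have "\<bar>x $ k\<bar> = \<bar>y $ k\<bar>" if x: "x \<in> A" for x k
    proof (rule primitive_parallel_squares)
      have xS: "x \<in> S" and yS: "y \<in> S" using x y \<open>A \<subseteq> S\<close> by auto
      show "primitive x" "primitive y" using prim xS yS by auto
      fix k l
      have "(x $ k)\<^sup>2 * (y $ l)\<^sup>2 - (x $ l)\<^sup>2 * (y $ k)\<^sup>2 = plucker v1 v2 k l * (u x * w y - u y * w x)"
        unfolding sq[OF xS] sq[OF yS] by (simp add: plucker_def algebra_simps)
      then show "(x $ k)\<^sup>2 * (y $ l)\<^sup>2 = (x $ l)\<^sup>2 * (y $ k)\<^sup>2" using uw[OF x y] by simp
    qed
    then have sub: "A \<subseteq> {x. \<forall>k. \<bar>x $ k\<bar> = \<bar>y $ k\<bar>}" by blast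
    show ?thesis
      using finite_subset[OF sub card_same_abs(1)] card_mono[OF card_same_abs(1) sub] card_same_abs(2)[of y]
      by linarith
  qed simp
  define R where "R = {z. poly N z = 0}"
  have R: "finite R" "card R \<le> 8 * M + 34"
    using poly_roots_finite[OF N(1)] card_poly_roots_bound[OF N(1)] N(2) by (auto simp: R_def)
  have f0: "finite {x \<in> S. w x = 0} \<and> card {x \<in> S. w x = 0} \<le> 16" by (rule fib) auto
  have fr: "finite {x \<in> S. w x \<noteq> 0 \<and> t x = z} \<and> card {x \<in> S. w x \<noteq> 0 \<and> t x = z} \<le> 16" for z
  proof (rule fib)
    fix x y assume "x \<in> {x \<in> S. w x \<noteq> 0 \<and> t x = z}" "y \<in> {x \<in> S. w x \<noteq> 0 \<and> t x = z}"
    then have "w x \<noteq> 0" "w y \<noteq> 0" "t x = t y" by auto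
    then have "complex_of_int (u x * w y) = complex_of_int (u y * w x)" by (simp add: t_def field_simps)
    then show "u x * w y = u y * w x" by (simp only: of_int_eq_iff)
  qed auto
  have S: "S = {x \<in> S. w x = 0} \<union> (\<Union>z\<in>R. {x \<in> S. w x \<noteq> 0 \<and> t x = z})"
    using root by (auto simp: R_def)
  have "finite S" by (subst S) (use f0 fr R in auto)
  moreover have "card S \<le> 16 * (8 * M + 35)"
  proof -
    have "card S \<le> card {x \<in> S. w x = 0} + card (\<Union>z\<in>R. {x \<in> S. w x \<noteq> 0 \<and> t x = z})"
      by (subst S) (rule card_Un_le)
    also have "card (\<Union>z\<in>R. {x \<in> S. w x \<noteq> 0 \<and> t x = z}) \<le> (\<Sum>z\<in>R. card {x \<in> S. w x \<noteq> 0 \<and> t x = z})"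
      by (rule card_UN_le[OF R(1)])
    also have "\<dots> \<le> (\<Sum>z\<in>R. 16)" by (intro sum_mono) (use fr in auto)
    finally show ?thesis using f0 R by simp
  qed
  ultimately show ?thesis by blast
qed

subsection \<open>Counting simultaneous square values of four linear forms\<close>

text \<open>As \<open>ln D\<close> is \<open>O(1 + ln B)\<close>, the prime found by
  \<open>small_prime_not_dvd\<close> is of size \<open>O((1 + ln B)^2)\<close>, below any power of
  \<open>B\<close>. The exponent 24 is that of six minors of size \<open>B ^ 4\<close>.\<close>

lemma small_prime_bound:
  fixes \<delta> C :: real
  assumes \<delta>: "\<delta> > 0" and C: "C \<ge> 1"
  shows "\<exists>K\<ge>1. \<forall>(D :: nat) (B :: real). D > 0 \<longrightarrow> B \<ge> 1 \<longrightarrow> real D \<le> C * B ^ 24 \<longrightarrow>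
    (\<exists>p. prime p \<and> \<not> p dvd D \<and> real p \<le> K * B powr \<delta>)"
proof -
  obtain c :: nat where c: "real c \<ge> ln C + 24" using real_arch_simple by blast
  have "eventually (\<lambda>L :: nat. 2 * real c * real L ^ 2 + 2 < 2 ^ L) at_top" by real_asymp
  then obtain L0 where L0: "\<And>L. L \<ge> L0 \<Longrightarrow> 2 * real c * real L ^ 2 + 2 < 2 ^ L"
    by (auto simp: eventually_at_top_linorder)
  define b where "b = 2 / \<delta> + 2 + real L0"
  define K where "K = 2 * real c * b\<^sup>2 + 2"
  have b: "b \<ge> 0" using \<delta> by (simp add: b_def)
  have "K \<ge> 1" by (simp add: K_def)
  moreover have "\<exists>p. prime p \<and> \<not> p dvd D \<and> real p \<le> K * B powr \<delta>"
    if D: "D > 0" and B: "B \<ge> 1" and DB: "real D \<le> C * B ^ 24" for D :: nat and B :: real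
  proof -
    \<comment> \<open>The summand \<open>L0\<close> secures \<open>n + 1 < 2 ^ L\<close>. The choice
      of \<open>n\<close> makes it exceed \<open>2 * L * ln D\<close>, which secures
      \<open>D ^ L < 2 ^ n\<close> because \<open>ln 2 > 1/2\<close>.\<close>
    define L where "L = nat \<lceil>1 + ln B\<rceil> + L0"
    define n where "n = 2 * c * L\<^sup>2 + 1"
    have lnB: "ln B \<ge> 0" using B by simp
    have L1: "1 + ln B \<le> real L" unfolding L_def using lnB by linarith
    have L2: "real L \<le> ln B + 2 + real L0" unfolding L_def using lnB by linarith
    have "2 * real c * real L ^ 2 + 2 < 2 ^ L" by (rule L0) (simp add: L_def)
    then have "real (Suc n) < real (2 ^ L)" by (simp add: n_def)
    then have 1: "Suc n < 2 ^ L" by (simp only: of_nat_less_iff)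
    have "ln (real D) \<le> ln (C * B ^ 24)" using D DB by (subst ln_le_cancel_iff) auto
    also have "\<dots> = ln C + 24 * ln B" using B C by (simp add: ln_mult ln_realpow)
    also have "\<dots> \<le> (ln C + 24) * (1 + ln B)" using lnB C by (simp add: algebra_simps)
    also have "\<dots> \<le> real c * real L" using c L1 lnB C by (intro mult_mono) auto
    finally have lnD: "ln (real D) \<le> real c * real L" .
    have "ln (real D ^ L) = real L * ln (real D)" using D by (simp add: ln_realpow)
    also have "\<dots> \<le> real L * (real c * real L)" using lnD by (intro mult_left_mono) auto
    also have "\<dots> < real n * (1 / 2)" by (simp add: n_def power2_eq_square algebra_simps)
    also have "\<dots> \<le> real n * ln 2" using ln2_ge_two_thirds by (intro mult_left_mono) auto
    also have "\<dots> = ln (2 ^ n)" by (simp add: ln_realpow)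
    finally have "real D ^ L < 2 ^ n" using D by (subst (asm) ln_less_cancel_iff) auto
    then have "real (D ^ L) < real (2 ^ n)" by simp
    then have 2: "D ^ L < 2 ^ n" by (simp only: of_nat_less_iff)
    obtain p where p: "prime p" "p \<le> Suc n" "\<not> p dvd D"
      using small_prime_not_dvd[OF D 1 2] by blast
    have "real L \<le> b * B powr (\<delta> / 2)"
    proof -
      have pw: "B powr (\<delta> / 2) \<ge> 1" using B \<delta> by (simp add: ge_one_powr_ge_zero)
      have "ln B \<le> B powr (\<delta> / 2) / (\<delta> / 2)" using B \<delta> by (intro ln_powr_bound) auto
      then have "ln B \<le> 2 / \<delta> * B powr (\<delta> / 2)" by (simp add: mult.commute)
      moreover have "(2 + real L0) * 1 \<le> (2 + real L0) * B powr (\<delta> / 2)"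
        using pw by (intro mult_left_mono) auto
      ultimately show ?thesis using L2 by (simp add: b_def algebra_simps)
    qed
    then have "(real L)\<^sup>2 \<le> (b * B powr (\<delta> / 2))\<^sup>2" by (intro power_mono) auto
    also have "\<dots> = b\<^sup>2 * B powr \<delta>"
      using B by (simp add: power_mult_distrib power2_eq_square flip: powr_add)
    finally have L3: "(real L)\<^sup>2 \<le> b\<^sup>2 * B powr \<delta>" .
    have "real p \<le> 2 * real c * (real L)\<^sup>2 + 2 * 1"
    proof -
      have "real p \<le> real (Suc n)" using p(2) by (simp only: of_nat_le_iff)
      then show ?thesis by (simp add: n_def)
    qed
    also have "\<dots> \<le> 2 * real c * (b\<^sup>2 * B powr \<delta>) + 2 * B powr \<delta>"
      using L3 B \<delta> by (intro add_mono mult_left_mono) (auto simp: ge_one_powr_ge_zero)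
    also have "\<dots> = K * B powr \<delta>" by (simp add: K_def algebra_simps)
    finally show ?thesis using p by blast
  qed
  ultimately show ?thesis by blast
qed

text \<open>By Cramer's rule \<open>p\<close> would divide \<open>u\<close> and \<open>w\<close>,
  hence every coordinate of a primitive vector. Thus at most one coordinate vanishes modulo a prime
  of good reduction.\<close>

lemma primitive_unit_coordinates:
  fixes p :: int
  assumes p: "prime p" "\<not> p dvd plucker v1 v2 i k" and prim: "primitive x"
    and sq: "\<And>l. (x $ l)\<^sup>2 = v1 $ l * u + v2 $ l * w" and dv: "p dvd x $ i" "p dvd x $ k"
  shows False
proof -
  have sqd: "p dvd (x $ i)\<^sup>2" "p dvd (x $ k)\<^sup>2" using dv by (simp_all add: power2_eq_square)
  have "p dvd plucker v1 v2 i k * u" "p dvd plucker v1 v2 i k * w"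
    unfolding plucker_solve[of "\<lambda>l. (x $ l)\<^sup>2", OF sq] using sqd by (auto intro!: dvd_diff)
  then have "p dvd u" "p dvd w" using p by (auto simp: prime_dvd_mult_iff)
  then have "p dvd (x $ l)\<^sup>2" for l unfolding sq by simp
  then have "p dvd x $ l" for l using p(1) by (meson prime_dvd_power)
  then have "p dvd Gcd (range (\<lambda>l. x $ l))" by (intro Gcd_greatest) auto
  then have "p dvd 1" using prim by (simp add: primitive_def)
  then show False using p(1) not_prime_unit by blast
qed

text \<open>A class consists of a residue vector modulo \<open>p\<close>, which selects the indices
  of the local parameter, and a value of that parameter modulo \<open>p ^ e\<close>; hence the
  factor \<open>p ^ 4 * p ^ e\<close>.\<close>

lemma card_le_by_classes:
  fixes v1 v2 :: "int ^ 4" and p :: int and S :: "(int ^ 4) set" and u w :: "int ^ 4 \<Rightarrow> int"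
    and U W Y :: real
  assumes p: "prime p" "\<not> p dvd 2" "\<And>i j. i \<noteq> j \<Longrightarrow> \<not> p dvd plucker v1 v2 i j" and e: "e > 0"
    and sq: "\<And>x k. x \<in> S \<Longrightarrow> (x $ k)\<^sup>2 = v1 $ k * u x + v2 $ k * w x"
    and prim: "\<And>x. x \<in> S \<Longrightarrow> primitive x"
    and M: "M > 0" and pos: "U > 0" "W > 0" "W \<le> Y"
    and bd: "\<And>x. x \<in> S \<Longrightarrow> \<bar>real_of_int (u x)\<bar> \<le> U" "\<And>x. x \<in> S \<Longrightarrow> \<bar>real_of_int (w x)\<bar> \<le> W"
      "\<And>x k l. x \<in> S \<Longrightarrow> \<bar>real_of_int (x $ k * x $ l)\<bar> \<le> Y"
    and size: "real (8 * M + 1) ^ (8 * M) * ((U * W) ^ (4 * M * (M - 1)) * Y ^ (24 * M))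
       \<le> real_of_int (p ^ e) ^ (4 * M * (8 * M - 1))"
  shows "real (card S) \<le> real_of_int (p ^ 4 * p ^ e) * (16 * (8 * real M + 35))"
proof -
  define q where "q = p ^ e"
  have p1: "p > 1" using p(1) by (rule prime_gt_1_int)
  have q1: "q \<ge> 1" using p1 by (simp add: q_def)
  define \<rho> where "\<rho> x = (\<chi> k. x $ k mod p)" for x :: "int ^ 4"
  \<comment> \<open>At most one coordinate of \<open>x\<close> vanishes modulo \<open>p\<close>. If \<open>i\<close> is its index, then \<open>x_i / x_j\<close> is a
    local parameter at \<open>x\<close> for every \<open>j \<noteq> i\<close>.\<close>
  define ii where "ii r = (if \<exists>k. p dvd r $ k then SOME k. p dvd r $ k else 0)" for r :: "int ^ 4"
  define jj where "jj r = (if ii r = 0 then 1 else (0 :: 4))" for r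
  define iv where "iv a = (SOME b. [a * b = 1] (mod q))" for a
  define key where "key x = (\<rho> x, (x $ ii (\<rho> x) * iv (x $ jj (\<rho> x))) mod q)" for x
  define P where "P = (vec_lambda ` (PiE UNIV (\<lambda>_. {0..<p})) :: (int ^ 4) set) \<times> {0..<q}"
  have ij: "ii r \<noteq> jj r" for r by (simp add: jj_def)
  have \<rho>: "p dvd \<rho> x $ k \<longleftrightarrow> p dvd x $ k" for x k by (simp add: \<rho>_def dvd_mod_iff)
  have unit: "\<not> p dvd x $ k" if x: "x \<in> S" and k: "k \<noteq> ii (\<rho> x)" for x k
  proof
    assume pk: "p dvd x $ k"
    then have ex: "\<exists>k. p dvd \<rho> x $ k" using \<rho> by blast
    then have "ii (\<rho> x) = (SOME k. p dvd \<rho> x $ k)" by (simp only: ii_def if_True)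
    then have "p dvd \<rho> x $ ii (\<rho> x)" using someI_ex[OF ex] by (simp only:)
    then have "p dvd x $ ii (\<rho> x)" using \<rho> by blast
    then show False
      using primitive_unit_coordinates[OF p(1) p(3)[OF k[symmetric]] prim[OF x] sq[OF x] _ pk] by blast
  qed
  have finP: "finite P" unfolding P_def by (intro finite_cartesian_product finite_imageI finite_PiE) auto
  have cardP: "real (card P) \<le> real_of_int (p ^ 4 * p ^ e)"
  proof -
    have "card (vec_lambda ` (PiE UNIV (\<lambda>_. {0..<p})) :: (int ^ 4) set) \<le> card (PiE UNIV (\<lambda>_. {0..<p}) :: (4 \<Rightarrow> int) set)"
      by (intro card_image_le finite_PiE) auto
    also have "\<dots> = nat p ^ 4" by (simp add: card_PiE)
    finally have "card P \<le> nat p ^ 4 * nat q"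
      unfolding P_def card_cartesian_product by (simp add: mult_right_mono)
    then have "real (card P) \<le> real (nat p ^ 4 * nat q)" by (simp only: of_nat_le_iff)
    also have "\<dots> = real_of_int (p ^ 4 * p ^ e)" using p1 q1 by (simp add: q_def)
    finally show ?thesis .
  qed
  have keyP: "key x \<in> P" for x
  proof -
    have "\<rho> x = vec_lambda (\<lambda>k. x $ k mod p)" by (simp add: \<rho>_def)
    then have "\<rho> x \<in> vec_lambda ` (PiE UNIV (\<lambda>_. {0..<p}))" using p1 by auto
    then show ?thesis using q1 by (simp add: key_def P_def)
  qed
  have cls: "finite {x \<in> S. key x = \<kappa>} \<and> card {x \<in> S. key x = \<kappa>} \<le> 16 * (8 * M + 35)" for \<kappa>
  proof -
    define A where "A = {x \<in> S. key x = \<kappa>}"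
    define i where "i = ii (fst \<kappa>)"
    define j where "j = jj (fst \<kappa>)"
    have AS: "x \<in> S" if "x \<in> A" for x using that by (simp add: A_def)
    have r: "\<rho> x = fst \<kappa>" if "x \<in> A" for x using that by (auto simp: A_def key_def)
    have s: "(x $ i * iv (x $ j)) mod q = snd \<kappa>" if "x \<in> A" for x
      using that unfolding A_def key_def i_def j_def by auto
    have iv: "[x $ j * iv (x $ j) = 1] (mod q)" if "x \<in> A" for x
    proof -
      have "\<not> p dvd x $ j" by (rule unit[OF AS[OF that]]) (use ij r[OF that] in \<open>simp add: j_def eq_commute\<close>)
      from prime_imp_coprime[OF p(1) this] have "coprime (x $ j) q"
        unfolding q_def by (simp add: coprime_commute)
      from someI_ex[OF cong_solve_coprime_int[OF this]] show ?thesis by (simp only: iv_def)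
    qed
    have ex: "\<exists>c. (\<exists>a<M. \<exists>e1<2. \<exists>e2<2. \<exists>e3<2. c a e1 e2 e3 \<noteq> 0) \<and>
      (\<forall>x\<in>A. (\<Sum>a<M. \<Sum>e1<2. \<Sum>e2<2. \<Sum>e3<2. c a e1 e2 e3 * aux_monomial M (u x) (w x) x a e1 e2 e3) = 0)"
    proof (rule class_auxiliary_form[OF p(1,2)])
      show "i \<noteq> j" by (simp add: i_def j_def ij)
      then show "\<not> p dvd plucker v1 v2 i j" by (rule p(3))
      show "e > 0" "M > 0" "U > 0" "W > 0" "W \<le> Y" by fact+
      show "real (8 * M + 1) ^ (8 * M) * ((U * W) ^ (4 * M * (M - 1)) * Y ^ (24 * M))
         \<le> real_of_int (p ^ e) ^ (4 * M * (8 * M - 1))" by fact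
    next
      fix x k assume x: "x \<in> A"
      show "(x $ k)\<^sup>2 = v1 $ k * u x + v2 $ k * w x" by (rule sq[OF AS[OF x]])
      show "\<bar>real_of_int (u x)\<bar> \<le> U" "\<bar>real_of_int (w x)\<bar> \<le> W" using bd AS[OF x] by auto
      fix l show "\<bar>real_of_int (x $ k * x $ l)\<bar> \<le> Y" by (rule bd(3)[OF AS[OF x]])
    next
      fix x k assume x: "x \<in> A" and "k \<noteq> i"
      then show "\<not> p dvd x $ k" using unit[OF AS[OF x]] r[OF x] by (simp add: i_def)
    next
      fix x y assume xy: "x \<in> A" "y \<in> A"
      fix k
      have "\<rho> x $ k = \<rho> y $ k" using r xy by simp
      then show "[x $ k = y $ k] (mod p)" by (simp add: \<rho>_def cong_def)
    next
      fix x y assume xy: "x \<in> A" "y \<in> A"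
      \<comment> \<open>Equality of \<open>x_i / x_j\<close> and \<open>y_i / y_j\<close> modulo
        \<open>q\<close> is freed of the chosen inverses by cross-multiplication.\<close>
      let ?c = "iv (x $ j)" and ?d = "iv (y $ j)"
      have 1: "[x $ i * y $ j * 1 = x $ i * y $ j * (x $ j * ?c)] (mod q)"
        by (intro cong_mult cong_refl cong_sym[OF iv[OF xy(1)]])
      have 2: "[(x $ i * ?c) * (y $ j * x $ j) = (y $ i * ?d) * (y $ j * x $ j)] (mod q)"
        by (rule cong_mult[OF _ cong_refl]) (simp add: cong_def s xy)
      have 3: "[y $ i * x $ j * (y $ j * ?d) = y $ i * x $ j * 1] (mod q)"
        by (intro cong_mult cong_refl iv[OF xy(2)])
      have "[x $ i * y $ j = (x $ i * ?c) * (y $ j * x $ j)] (mod q)" using 1 by (simp add: mult_ac)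
      also note 2
      also have "[(y $ i * ?d) * (y $ j * x $ j) = y $ i * x $ j] (mod q)" using 3 by (simp add: mult_ac)
      finally show "p ^ e dvd x $ i * y $ j - y $ i * x $ j" by (simp add: cong_iff_dvd_diff q_def)
    qed
    then obtain c a e1 e2 e3 where c: "a < M" "e1 < 2" "e2 < 2" "e3 < 2" "c a e1 e2 e3 \<noteq> 0"
      and z: "\<And>x. x \<in> A \<Longrightarrow> (\<Sum>a<M. \<Sum>e1<2. \<Sum>e2<2. \<Sum>e3<2. c a e1 e2 e3 * aux_monomial M (u x) (w x) x a e1 e2 e3) = 0"
      by blast
    show ?thesis
      unfolding A_def[symmetric]
    proof (rule card_zeros_le[OF _ _ _ c z])
      fix i j :: 4 assume "i \<noteq> j"
      then show "plucker v1 v2 i j \<noteq> 0" using p(3) by fastforce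
    qed (use sq prim AS in auto)
  qed
  have S: "S = (\<Union>\<kappa>\<in>P. {x \<in> S. key x = \<kappa>})" using keyP by auto
  have "card S \<le> (\<Sum>\<kappa>\<in>P. card {x \<in> S. key x = \<kappa>})"
    by (subst S) (rule card_UN_le[OF finP])
  also have "\<dots> \<le> (\<Sum>\<kappa>\<in>P. 16 * (8 * M + 35))" by (intro sum_mono) (use cls in auto)
  also have "\<dots> = card P * (16 * (8 * M + 35))" by simp
  finally have "real (card S) \<le> real (card P * (16 * (8 * M + 35)))" by (simp only: of_nat_le_iff)
  also have "\<dots> = real (card P) * (16 * (8 * real M + 35))" by simp
  also have "\<dots> \<le> real_of_int (p ^ 4 * p ^ e) * (16 * (8 * real M + 35))"
    by (rule mult_right_mono[OF cardP]) simp
  finally show ?thesis .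
qed

lemma index_cases: "(i :: 4) = 0 \<or> i = 1 \<or> i = 2 \<or> i = 3"
  using exhaust_4[of i] by auto

lemma power_interval_exists:
  fixes p X :: real
  assumes "p > 1" "X \<ge> 1"
  shows "\<exists>e>0. X \<le> p ^ e \<and> p ^ e \<le> p * X"
proof -
  obtain n where n: "X < p ^ n" using real_arch_pow[OF assms(1)] by blast
  define e where "e = (LEAST n. X \<le> p ^ n)"
  have e: "X \<le> p ^ e" unfolding e_def by (rule LeastI[of _ n]) (use n in auto)
  show ?thesis
  proof (cases e)
    case 0
    then have "X = 1" using e assms by simp
    \<comment> \<open>The exponent has to be positive, so 1 takes the place of 0 when
      \<open>X = 1\<close>.\<close>
    then show ?thesis using assms by (intro exI[of _ 1]) auto
  next
    case (Suc d)
    have "\<not> X \<le> p ^ d" using not_less_Least[of d "\<lambda>n. X \<le> p ^ n"] Suc by (simp add: e_def)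
    then have "p * p ^ d \<le> p * X" using assms by (intro mult_left_mono) auto
    then show ?thesis using e Suc by (intro exI[of _ e]) auto
  qed
qed

text \<open>Three exponents are compared with \<open>N = 4 M (8 M - 1)\<close>:
  \<open>4 M (M - 1) <= N / 8\<close> produces the power 1/8, \<open>48 M <= \<delta> N\<close>
  absorbs the powers of \<open>B\<close>, and \<open>4 M <= N\<close> leaves the constant
  \<open>(8 M + 1)^2 3^6\<close>.\<close>

lemma size_condition:
  fixes U W B \<delta> X :: real
  assumes M: "M > 0" "\<delta> * (8 * real M - 1) \<ge> 12" and B: "B \<ge> 1" and UW: "U * W \<ge> 1"
    and X: "X \<ge> (8 * real M + 1)\<^sup>2 * 3 ^ 6 * (U * W) powr (1/8) * B powr \<delta>"
  shows "real (8 * M + 1) ^ (8 * M) * ((U * W) ^ (4 * M * (M - 1)) * (3 * B\<^sup>2) ^ (24 * M))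
     \<le> X ^ (4 * M * (8 * M - 1))"
proof -
  define N where "N = 4 * M * (8 * M - 1)"
  define k where "k = (8 * real M + 1)\<^sup>2 * 3 ^ 6"
  have N: "real N = 4 * real M * (8 * real M - 1)" using M by (simp add: N_def of_nat_diff)
  have k1: "k \<ge> 1" unfolding k_def using mult_mono[of 1 "(8 * real M + 1)\<^sup>2" 1 "3 ^ 6"] by simp
  have UW0: "U * W > 0" and B0: "B > 0" using UW B by auto
  have 1: "real (8 * M + 1) ^ (8 * M) * 3 ^ (24 * M) \<le> k ^ N"
  proof -
    have "real (8 * M + 1) ^ (8 * M) * 3 ^ (24 * M) = ((8 * real M + 1)\<^sup>2) ^ (4 * M) * (3 ^ 6) ^ (4 * M)"
      unfolding power_mult[symmetric] by (simp add: add.commute)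
    also have "\<dots> = k ^ (4 * M)" by (simp only: k_def power_mult_distrib)
    also have "\<dots> \<le> k ^ N" using k1 M unfolding N_def by (intro power_increasing) auto
    finally show ?thesis .
  qed
  have 2: "(U * W) ^ (4 * M * (M - 1)) \<le> ((U * W) powr (1/8)) ^ N"
  proof -
    have "(U * W) ^ (4 * M * (M - 1)) = (U * W) powr real (4 * M * (M - 1))"
      using UW0 by (rule powr_realpow[symmetric])
    also have "\<dots> \<le> (U * W) powr (1/8 * real N)"
    proof (rule powr_mono[OF _ UW])
      have "real (4 * M * (M - 1)) = 4 * real M * (real M - 1)" using M by (simp add: of_nat_diff)
      also have "\<dots> \<le> 1/8 * real N" unfolding N using M by (simp add: algebra_simps)
      finally show "real (4 * M * (M - 1)) \<le> 1/8 * real N" .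
    qed
    also have "\<dots> = ((U * W) powr (1/8)) ^ N"
      unfolding powr_powr[symmetric] using UW0 by (intro powr_realpow) auto
    finally show ?thesis .
  qed
  have 3: "B ^ (48 * M) \<le> (B powr \<delta>) ^ N"
  proof -
    have "B ^ (48 * M) = B powr real (48 * M)" using B0 by (rule powr_realpow[symmetric])
    also have "\<dots> \<le> B powr (\<delta> * real N)"
    proof (rule powr_mono[OF _ B])
      have "4 * real M * 12 \<le> 4 * real M * (\<delta> * (8 * real M - 1))" using M by (intro mult_left_mono) auto
      also have "\<dots> = \<delta> * real N" by (simp add: N)
      finally show "real (48 * M) \<le> \<delta> * real N" by simp
    qed
    also have "\<dots> = (B powr \<delta>) ^ N" 
      unfolding powr_powr[symmetric] using B0 by (intro powr_realpow) simp
    finally show ?thesis .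
  qed
  have "real (8 * M + 1) ^ (8 * M) * ((U * W) ^ (4 * M * (M - 1)) * (3 * B\<^sup>2) ^ (24 * M))
      = real (8 * M + 1) ^ (8 * M) * 3 ^ (24 * M) * (U * W) ^ (4 * M * (M - 1)) * B ^ (48 * M)"
    by (simp add: power_mult_distrib flip: power_mult)
  also have "\<dots> \<le> k ^ N * ((U * W) powr (1/8)) ^ N * (B powr \<delta>) ^ N"
    using 1 2 3 k1 UW0 B0 by (intro mult_mono) (auto intro!: mult_nonneg_nonneg)
  also have "\<dots> = (k * (U * W) powr (1/8) * B powr \<delta>) ^ N" by (simp add: power_mult_distrib)
  also have "\<dots> \<le> X ^ N" using X k1 by (intro power_mono) (auto simp: k_def)
  finally show ?thesis unfolding N_def .
qed

lemma four_linear_squares_count: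
  fixes \<epsilon> :: real
  assumes "\<epsilon> > 0"
  shows "\<exists>K>0. \<forall>(v1 :: int ^ 4) (v2 :: int ^ 4) (S :: (int ^ 4) set) (u :: int ^ 4 \<Rightarrow> int) (w :: int ^ 4 \<Rightarrow> int) (B :: real) (U :: real) (W :: real).
     B \<ge> 1 \<longrightarrow> U > 0 \<longrightarrow> W > 0 \<longrightarrow> W \<le> 3 * B\<^sup>2 \<longrightarrow> U * W \<ge> 1 \<longrightarrow>
     (\<forall>i j. i \<noteq> j \<longrightarrow> plucker v1 v2 i j \<noteq> 0 \<and> \<bar>real_of_int (plucker v1 v2 i j)\<bar> \<le> 4 * B ^ 4) \<longrightarrow>
     (\<forall>x\<in>S. primitive x \<and> (\<forall>k. (x $ k)\<^sup>2 = v1 $ k * u x + v2 $ k * w x) \<and> (\<forall>k. \<bar>real_of_int (x $ k)\<bar> \<le> B)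
        \<and> \<bar>real_of_int (u x)\<bar> \<le> U \<and> \<bar>real_of_int (w x)\<bar> \<le> W) \<longrightarrow>
     real (card S) \<le> K * (B powr \<epsilon> * (U * W) powr (1/8))"
proof -
  \<comment> \<open>Six factors \<open>B powr \<delta>\<close> accumulate: four from the residue
    vectors modulo \<open>p\<close>, one from rounding \<open>X\<close> up to a power of
    \<open>p\<close>, one from \<open>X\<close> itself.\<close>
  define \<delta> where "\<delta> = \<epsilon> / 6"
  have \<delta>: "\<delta> > 0" using assms by (simp add: \<delta>_def)
  obtain M0 :: nat where M0: "real M0 \<ge> 12 / \<delta> + 1" using real_arch_simple by blast
  define M where "M = M0 + 1"
  have M: "M > 0" "\<delta> * (8 * real M - 1) \<ge> 12"
  proof -
    have "12 / \<delta> \<le> 8 * real M - 1" using M0 by (simp add: M_def)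
    then show "\<delta> * (8 * real M - 1) \<ge> 12" using \<delta> by (simp add: field_simps)
  qed (simp add: M_def)
  obtain K1 where K1: "K1 \<ge> 1" and prime: "\<And>(D :: nat) (B :: real). D > 0 \<Longrightarrow> B \<ge> 1 \<Longrightarrow> real D \<le> 2 * 4 ^ 6 * B ^ 24 \<Longrightarrow>
    \<exists>p. prime p \<and> \<not> p dvd D \<and> real p \<le> K1 * B powr \<delta>"
    using small_prime_bound[OF \<delta>, of "2 * 4 ^ 6"] by auto
  define k where "k = (8 * real M + 1)\<^sup>2 * 3 ^ 6"
  have k1: "k \<ge> 1" unfolding k_def using mult_mono[of 1 "(8 * real M + 1)\<^sup>2" 1 "3 ^ 6"] by simp
  define K where "K = K1 ^ 5 * k * (16 * (8 * real M + 35))"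
  have K0: "K > 0" using K1 k1 by (simp add: K_def)
  have main: "real (card S) \<le> K * (B powr \<epsilon> * (U * W) powr (1/8))"
    if B: "B \<ge> 1" and UW: "U > 0" "W > 0" "W \<le> 3 * B\<^sup>2" "U * W \<ge> 1"
      and pl: "\<And>i j. i \<noteq> j \<Longrightarrow> plucker v1 v2 i j \<noteq> 0" "\<And>i j. i \<noteq> j \<Longrightarrow> \<bar>real_of_int (plucker v1 v2 i j)\<bar> \<le> 4 * B ^ 4"
      and S: "\<And>x. x \<in> S \<Longrightarrow> primitive x" "\<And>x k. x \<in> S \<Longrightarrow> (x $ k)\<^sup>2 = v1 $ k * u x + v2 $ k * w x"
        "\<And>x k. x \<in> S \<Longrightarrow> \<bar>real_of_int (x $ k)\<bar> \<le> B" "\<And>x. x \<in> S \<Longrightarrow> \<bar>real_of_int (u x)\<bar> \<le> U"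
        "\<And>x. x \<in> S \<Longrightarrow> \<bar>real_of_int (w x)\<bar> \<le> W"
    for v1 v2 :: "int ^ 4" and S :: "(int ^ 4) set" and u w :: "int ^ 4 \<Rightarrow> int" and B U W :: real
  proof -
    define m where "m i j = nat \<bar>plucker v1 v2 i j\<bar>" for i j
    \<comment> \<open>All six minors have to be units modulo \<open>p\<close>; the factor 2 excludes
      \<open>p = 2\<close>, where square roots do not lift.\<close>
    define D where "D = 2 * (m 0 1 * m 0 2 * m 0 3 * m 1 2 * m 1 3 * m 2 3)"
    have m0: "m i j > 0" if "i \<noteq> j" for i j using pl(1)[OF that] by (simp add: m_def)
    have mB: "real (m i j) \<le> 4 * B ^ 4" if "i \<noteq> j" for i j using pl(2)[OF that] by (simp add: m_def)
    have D0: "D > 0" by (simp add: D_def m0)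
    have "real D \<le> 2 * ((4 * B ^ 4) * (4 * B ^ 4) * (4 * B ^ 4) * (4 * B ^ 4) * (4 * B ^ 4) * (4 * B ^ 4))"
      unfolding D_def of_nat_mult using B
      by (intro mult_left_mono mult_mono mB) (auto intro!: mult_nonneg_nonneg)
    also have "\<dots> = 2 * 4 ^ 6 * B ^ 24" by (simp add: power_numeral_reduce)
    finally have "real D \<le> 2 * 4 ^ 6 * B ^ 24" .
    from prime[OF D0 B this] obtain p where p: "prime p" "\<not> p dvd D" "real p \<le> K1 * B powr \<delta>" by blast
    have pm: "\<not> int p dvd plucker v1 v2 i j" if "i \<noteq> j" for i j
    proof
      assume "int p dvd plucker v1 v2 i j"
      then have "int p dvd int (m i j)" by (simp add: m_def)
      then have 1: "p dvd m i j" by simp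
      have sym: "m i j = m j i" by (simp add: m_def plucker_def abs_minus_commute mult.commute)
      have "m i j dvd D"
        using that sym index_cases[of i] index_cases[of j]
        by (elim disjE) (simp_all add: D_def)
      then show False using 1 p(2) dvd_trans by blast
    qed
    have p2: "\<not> int p dvd 2"
    proof
      assume "int p dvd 2"
      then have "p dvd 2" by presburger
      then show False using p(2) by (simp add: D_def)
    qed
    define X where "X = k * (U * W) powr (1/8) * B powr \<delta>"
    have X1: "X \<ge> 1"
    proof -
      have "1 * 1 * 1 \<le> k * (U * W) powr (1/8) * B powr \<delta>"
        using k1 UW B \<delta> by (intro mult_mono ge_one_powr_ge_zero) auto
      then show ?thesis by (simp add: X_def)
    qed
    have p1: "real p > 1" using p(1) prime_gt_1_nat by simp
    obtain e where e: "e > 0" "X \<le> real p ^ e" "real p ^ e \<le> real p * X"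
      using power_interval_exists[OF p1 X1] by blast
    have xx: "\<bar>real_of_int (x $ k * x $ l)\<bar> \<le> 3 * B\<^sup>2" if x: "x \<in> S" for x k l
    proof -
      have "\<bar>real_of_int (x $ k)\<bar> * \<bar>real_of_int (x $ l)\<bar> \<le> B * B"
        using S(3)[OF x] B by (intro mult_mono) auto
      then show ?thesis
        using zero_le_square[of B] unfolding of_int_mult abs_mult power2_eq_square by linarith
    qed
    have "real (card S) \<le> real_of_int (int p ^ 4 * int p ^ e) * (16 * (8 * real M + 35))"
    proof (rule card_le_by_classes[OF _ p2 pm e(1) S(2) S(1) M(1) UW(1-3) S(4) S(5) xx])
      show "prime (int p)" using p(1) by simp
      have "X ^ (4 * M * (8 * M - 1)) \<le> (real p ^ e) ^ (4 * M * (8 * M - 1))"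
        using e(2) X1 by (intro power_mono) auto
      with size_condition[OF M B UW(4), of X]
      show "real (8 * M + 1) ^ (8 * M) * ((U * W) ^ (4 * M * (M - 1)) * (3 * B\<^sup>2) ^ (24 * M))
        \<le> real_of_int (int p ^ e) ^ (4 * M * (8 * M - 1))"
        by (simp add: X_def k_def)
    qed
    also have "real_of_int (int p ^ 4 * int p ^ e) = real p ^ 4 * real p ^ e" by simp
    also have "real p ^ 4 * real p ^ e \<le> real p ^ 4 * (real p * X)" by (intro mult_left_mono e(3)) auto
    also have "real p ^ 4 * (real p * X) = real p ^ 5 * X" by (simp add: power_numeral_reduce)
    also have "real p ^ 5 * X \<le> (K1 * B powr \<delta>) ^ 5 * X"
      using p(3) X1 by (intro mult_right_mono power_mono) auto
    also have "(K1 * B powr \<delta>) ^ 5 * X = K1 ^ 5 * k * ((B powr \<delta>) ^ 6 * (U * W) powr (1/8))"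
      by (simp add: X_def power_mult_distrib power_numeral_reduce)
    also have "(B powr \<delta>) ^ 6 = B powr \<epsilon>"
      using B by (simp add: powr_power \<delta>_def)
    finally show ?thesis by (simp add: K_def mult_ac)
  qed
  show ?thesis
  proof (intro exI[of _ K] conjI allI impI K0)
    fix v1 v2 :: "int ^ 4" and S :: "(int ^ 4) set" and u w :: "int ^ 4 \<Rightarrow> int" and B U W :: real
    assume as: "B \<ge> 1" "U > 0" "W > 0" "W \<le> 3 * B\<^sup>2" "U * W \<ge> 1"
      and pl: "\<forall>i j. i \<noteq> j \<longrightarrow> plucker v1 v2 i j \<noteq> 0 \<and> \<bar>real_of_int (plucker v1 v2 i j)\<bar> \<le> 4 * B ^ 4"
      and S: "\<forall>x\<in>S. primitive x \<and> (\<forall>k. (x $ k)\<^sup>2 = v1 $ k * u x + v2 $ k * w x) \<and> (\<forall>k. \<bar>real_of_int (x $ k)\<bar> \<le> B)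
        \<and> \<bar>real_of_int (u x)\<bar> \<le> U \<and> \<bar>real_of_int (w x)\<bar> \<le> W"
    show "real (card S) \<le> K * (B powr \<epsilon> * (U * W) powr (1/8))"
      by (rule main[OF as, of v1 v2 S u w]) (use pl S in simp_all)
  qed
qed

subsection \<open>Reduced bases of rank two lattices\<close>

lemma sum_4_from_0: "(\<Sum>k\<in>(UNIV :: 4 set). f k) = f 0 + f 1 + f 2 + f 3"
proof -
  have "(4 :: 4) = 0" by simp
  then show ?thesis unfolding sum_4 by (simp only: ac_simps)
qed

definition dot :: "int ^ 4 \<Rightarrow> int ^ 4 \<Rightarrow> int" where
  "dot x y = (\<Sum>k\<in>UNIV. x $ k * y $ k)"

lemma dot_self_pos: "x \<noteq> 0 \<Longrightarrow> dot x x > 0"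
proof -
  assume "x \<noteq> 0"
  then obtain k where "x $ k \<noteq> 0" by (auto simp: vec_eq_iff)
  then have "0 < x $ k * x $ k" by (auto simp: zero_less_mult_iff neq_iff)
  then show ?thesis unfolding dot_def by (intro sum_pos2[of _ k]) auto
qed

lemma dot_self_nonneg: "dot x x \<ge> 0"
  unfolding dot_def by (intro sum_nonneg) auto

lemma dot_combination:
  assumes "\<And>k. m * z $ k = s * x $ k + t * y $ k"
  shows "m\<^sup>2 * dot z z = s\<^sup>2 * dot x x + 2 * s * t * dot x y + t\<^sup>2 * dot y y"
proof -
  have "m\<^sup>2 * dot z z = (\<Sum>k\<in>UNIV. (m * z $ k) * (m * z $ k))"
    by (simp add: dot_def sum_distrib_left power2_eq_square algebra_simps)
  also have "\<dots> = (\<Sum>k\<in>UNIV. (s * x $ k + t * y $ k) * (s * x $ k + t * y $ k))"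
    by (simp only: assms)
  also have "\<dots> = s\<^sup>2 * dot x x + 2 * s * t * dot x y + t\<^sup>2 * dot y y"
    by (simp add: dot_def sum_4_from_0 power2_eq_square algebra_simps)
  finally show ?thesis .
qed

text \<open>Lagrange's identity in the coordinates \<open>i\<close> and \<open>j\<close>; the other
  coordinates only enlarge the right-hand side.\<close>

lemma plucker_square_le:
  assumes "i \<noteq> j"
  shows "(plucker x y i j)\<^sup>2 \<le> dot x x * dot y y"
proof -
  have le: "z $ i * z $ i + z $ j * z $ j \<le> dot z z" for z
  proof -
    have "(\<Sum>k\<in>{i, j}. z $ k * z $ k) \<le> dot z z"
      unfolding dot_def by (intro sum_mono2) auto
    then show ?thesis using assms by simp
  qed
  have "(plucker x y i j)\<^sup>2 + (x $ i * y $ i + x $ j * y $ j)\<^sup>2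
      = (x $ i * x $ i + x $ j * x $ j) * (y $ i * y $ i + y $ j * y $ j)"
    by (simp add: plucker_def power2_eq_square algebra_simps)
  then have "(plucker x y i j)\<^sup>2 \<le> (x $ i * x $ i + x $ j * x $ j) * (y $ i * y $ i + y $ j * y $ j)"
    using zero_le_power2[of "x $ i * y $ i + x $ j * y $ j"] by linarith
  also have "\<dots> \<le> dot x x * dot y y" by (intro mult_mono le dot_self_nonneg) auto
  finally show ?thesis .
qed

lemma nearest_multiple:
  fixes \<alpha> m :: int
  assumes "m \<noteq> 0"
  shows "\<exists>t. 2 * \<bar>\<alpha> - t * m\<bar> \<le> \<bar>m\<bar>"
proof -
  define t where "t = round (real_of_int \<alpha> / real_of_int m)"
  have "\<bar>real_of_int t - real_of_int \<alpha> / real_of_int m\<bar> \<le> 1 / 2"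
    unfolding t_def by (rule of_int_round_abs_le)
  then have "\<bar>real_of_int t - real_of_int \<alpha> / real_of_int m\<bar> * \<bar>real_of_int m\<bar> \<le> 1 / 2 * \<bar>real_of_int m\<bar>"
    by (intro mult_right_mono) auto
  then have "\<bar>(real_of_int t - real_of_int \<alpha> / real_of_int m) * real_of_int m\<bar> \<le> 1 / 2 * \<bar>real_of_int m\<bar>"
    by (simp only: abs_mult)
  then have "\<bar>real_of_int t * real_of_int m - real_of_int \<alpha>\<bar> \<le> 1 / 2 * \<bar>real_of_int m\<bar>"
    using assms by (simp add: left_diff_distrib)
  then have "2 * \<bar>real_of_int (\<alpha> - t * m)\<bar> \<le> real_of_int \<bar>m\<bar>" by (simp add: abs_minus_commute)
  then have "2 * \<bar>\<alpha> - t * m\<bar> \<le> \<bar>m\<bar>" by linarith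
  then show ?thesis by blast
qed

text \<open>Lagrange-Gauss reduction by minimality: \<open>v1\<close> is a shortest nonzero vector
  and \<open>v2\<close> a shortest one independent of it. The hypothesis \<open>rank\<close> is
  Cramer's rule, so the single minor \<open>i j\<close> tests independence. One of
  \<open>y1, y2\<close> is independent of \<open>v1\<close>, which gives the bound
  \<open>T\<close>.\<close>

lemma reduced_basis:
  fixes \<Lambda> :: "(int ^ 4) set"
  assumes diff: "\<And>x y. x \<in> \<Lambda> \<Longrightarrow> y \<in> \<Lambda> \<Longrightarrow> x - y \<in> \<Lambda>"
    and scale: "\<And>c x. x \<in> \<Lambda> \<Longrightarrow> (\<chi> k. c * x $ k) \<in> \<Lambda>"
    and rank: "\<And>x y z k. x \<in> \<Lambda> \<Longrightarrow> y \<in> \<Lambda> \<Longrightarrow> z \<in> \<Lambda> \<Longrightarrow>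
        plucker x y i j * z $ k = plucker z y i j * x $ k + plucker x z i j * y $ k"
    and y: "y1 \<in> \<Lambda>" "y2 \<in> \<Lambda>" "plucker y1 y2 i j \<noteq> 0" and T: "dot y1 y1 \<le> T" "dot y2 y2 \<le> T"
  shows "\<exists>v1\<in>\<Lambda>. \<exists>v2\<in>\<Lambda>. plucker v1 v2 i j \<noteq> 0 \<and> 0 < dot v1 v1 \<and> dot v1 v1 \<le> dot v2 v2 \<and> dot v2 v2 \<le> T
    \<and> 2 * \<bar>dot v1 v2\<bar> \<le> dot v1 v1 \<and> (\<forall>z\<in>\<Lambda>. \<exists>u w. \<forall>k. z $ k = v1 $ k * u + v2 $ k * w)"
proof -
  have y10: "y1 \<noteq> 0" using y(3) by (auto simp: plucker_def)
  obtain v1 where v1: "v1 \<in> \<Lambda>" "v1 \<noteq> 0" and min1: "\<And>z. z \<in> \<Lambda> \<Longrightarrow> z \<noteq> 0 \<Longrightarrow> nat (dot v1 v1) \<le> nat (dot z z)"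
    using ex_has_least_nat[of "\<lambda>z. z \<in> \<Lambda> \<and> z \<noteq> 0" y1 "\<lambda>z. nat (dot z z)"] y(1) y10 by blast
  have Q1: "dot v1 v1 > 0" using dot_self_pos v1(2) by blast
  have min1': "dot v1 v1 \<le> dot z z" if "z \<in> \<Lambda>" "z \<noteq> 0" for z
    using min1[OF that] dot_self_nonneg[of z] by linarith
  have "\<exists>z. z \<in> \<Lambda> \<and> plucker v1 z i j \<noteq> 0 \<and> dot z z \<le> T"
  proof (rule ccontr)
    assume "\<not> ?thesis"
    then have p: "plucker v1 y1 i j = 0" "plucker v1 y2 i j = 0" using y T by blast+
    have "plucker y1 v1 i j = - plucker v1 y1 i j" by (simp add: plucker_def)
    then have "plucker y1 y2 i j * v1 $ k = 0" for k
      using rank[OF y(1,2) v1(1), of k] p by simp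
    then have "v1 $ k = 0" for k using y(3) by simp
    then show False using v1(2) by (simp add: vec_eq_iff)
  qed
  then obtain z0 where z0: "z0 \<in> \<Lambda>" "plucker v1 z0 i j \<noteq> 0" "dot z0 z0 \<le> T" by blast
  obtain v2 where v2: "v2 \<in> \<Lambda>" "plucker v1 v2 i j \<noteq> 0"
    and min2: "\<And>z. z \<in> \<Lambda> \<Longrightarrow> plucker v1 z i j \<noteq> 0 \<Longrightarrow> nat (dot v2 v2) \<le> nat (dot z z)"
    using ex_has_least_nat[of "\<lambda>z. z \<in> \<Lambda> \<and> plucker v1 z i j \<noteq> 0" z0 "\<lambda>z. nat (dot z z)"] z0 by blast
  have min2': "dot v2 v2 \<le> dot z z" if "z \<in> \<Lambda>" "plucker v1 z i j \<noteq> 0" for z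
    using min2[OF that] dot_self_nonneg[of z] by linarith
  have v20: "v2 \<noteq> 0" using v2(2) by (auto simp: plucker_def)
  have Q12: "dot v1 v1 \<le> dot v2 v2" by (rule min1'[OF v2(1) v20])
  have "dot v2 v2 \<le> dot z0 z0" by (rule min2'[OF z0(1,2)])
  then have Q2T: "dot v2 v2 \<le> T" using z0(3) by linarith
  \<comment> \<open>Both \<open>v2 - v1\<close> and \<open>v2 + v1\<close> compete with
    \<open>v2\<close> for minimality.\<close>
  have c: "2 * \<bar>dot v1 v2\<bar> \<le> dot v1 v1"
  proof -
    have neg: "(\<chi> k. - 1 * v1 $ k) \<in> \<Lambda>" using scale[OF v1(1)] .
    have m: "v2 - v1 \<in> \<Lambda>" "v2 - (\<chi> k. - 1 * v1 $ k) \<in> \<Lambda>" using diff v2(1) v1(1) neg by blast+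
    have "plucker v1 (v2 - v1) i j = plucker v1 v2 i j" "plucker v1 (v2 - (\<chi> k. - 1 * v1 $ k)) i j = plucker v1 v2 i j"
      by (simp_all add: plucker_def algebra_simps)
    then have "dot v2 v2 \<le> dot (v2 - v1) (v2 - v1)"
      "dot v2 v2 \<le> dot (v2 - (\<chi> k. - 1 * v1 $ k)) (v2 - (\<chi> k. - 1 * v1 $ k))"
      using min2'[OF m(1)] min2'[OF m(2)] v2(2) by auto
    moreover have "dot (v2 - v1) (v2 - v1) = dot v2 v2 - 2 * dot v1 v2 + dot v1 v1"
      "dot (v2 - (\<chi> k. - 1 * v1 $ k)) (v2 - (\<chi> k. - 1 * v1 $ k)) = dot v2 v2 + 2 * dot v1 v2 + dot v1 v1"
      by (simp_all add: dot_def sum_4_from_0 algebra_simps)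
    ultimately show ?thesis by linarith
  qed
  have "\<exists>u w. \<forall>k. z $ k = v1 $ k * u + v2 $ k * w" if z: "z \<in> \<Lambda>" for z
  proof -
    define m where "m = plucker v1 v2 i j"
    obtain s where s: "2 * \<bar>plucker z v2 i j - s * m\<bar> \<le> \<bar>m\<bar>" using nearest_multiple v2(2) m_def by metis
    obtain t where t: "2 * \<bar>plucker v1 z i j - t * m\<bar> \<le> \<bar>m\<bar>" using nearest_multiple v2(2) m_def by metis
    define \<alpha> where "\<alpha> = plucker z v2 i j - s * m"
    define \<beta> where "\<beta> = plucker v1 z i j - t * m"
    \<comment> \<open>The remainder \<open>r\<close> is shorter than \<open>v2\<close>, hence parallel to \<open>v1\<close>; then it is shorter than \<open>v1\<close>,
      hence zero.\<close>
    define r where "r = z - (\<chi> k. s * v1 $ k) - (\<chi> k. t * v2 $ k)"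
    have r: "r \<in> \<Lambda>" unfolding r_def by (intro diff scale z v1 v2)
    \<comment> \<open>The rational coordinates \<open>\<alpha> / m\<close> and
      \<open>\<beta> / m\<close> of \<open>r\<close> are at most 1/2 in absolute value; the factor
      \<open>m\<close> keeps the computation integral.\<close>
    have comb: "m * r $ k = \<alpha> * v1 $ k + \<beta> * v2 $ k" for k
      using rank[OF v1(1) v2(1) z, of k] by (simp add: r_def \<alpha>_def \<beta>_def m_def algebra_simps)
    have \<beta>: "\<beta> = plucker v1 r i j" by (simp add: \<beta>_def r_def m_def plucker_def algebra_simps)
    have eq: "m\<^sup>2 * dot r r = \<alpha>\<^sup>2 * dot v1 v1 + 2 * \<alpha> * \<beta> * dot v1 v2 + \<beta>\<^sup>2 * dot v2 v2"
      by (rule dot_combination[OF comb])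
    have m2: "m\<^sup>2 > 0" using v2(2) by (simp add: m_def)
    have a2: "4 * \<alpha>\<^sup>2 \<le> m\<^sup>2" and b2: "4 * \<beta>\<^sup>2 \<le> m\<^sup>2"
      using power_mono[OF s, of 2] power_mono[OF t, of 2] by (auto simp: \<alpha>_def \<beta>_def power_mult_distrib)
    have ab: "8 * \<alpha> * \<beta> * dot v1 v2 \<le> m\<^sup>2 * dot v1 v1"
    proof -
      have "8 * \<alpha> * \<beta> * dot v1 v2 \<le> \<bar>8 * \<alpha> * \<beta> * dot v1 v2\<bar>" by simp
      also have "\<dots> = (2 * \<bar>\<alpha>\<bar>) * (2 * \<bar>\<beta>\<bar>) * (2 * \<bar>dot v1 v2\<bar>)" by (simp add: abs_mult)
      also have "\<dots> \<le> \<bar>m\<bar> * \<bar>m\<bar> * dot v1 v1"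
        using s t c unfolding \<alpha>_def \<beta>_def by (intro mult_mono) auto
      finally show ?thesis by (simp add: power2_eq_square)
    qed
    \<comment> \<open>The three terms of the quadratic form contribute at most a quarter of
      \<open>dot v2 v2\<close> each, so \<open>dot r r\<close> stays below
      \<open>dot v2 v2\<close>.\<close>
    have \<beta>0: "\<beta> = 0"
    proof (rule ccontr)
      assume "\<beta> \<noteq> 0"
      then have "dot v2 v2 \<le> dot r r" using min2'[OF r] \<beta> by simp
      then have "4 * m\<^sup>2 * dot v2 v2 \<le> 4 * (m\<^sup>2 * dot r r)" using m2 by simp
      also have "\<dots> = 4 * \<alpha>\<^sup>2 * dot v1 v1 + 8 * \<alpha> * \<beta> * dot v1 v2 + 4 * \<beta>\<^sup>2 * dot v2 v2"
        unfolding eq by simp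
      also have "\<dots> \<le> m\<^sup>2 * dot v1 v1 + m\<^sup>2 * dot v1 v1 + m\<^sup>2 * dot v2 v2"
        using a2 b2 ab Q1 Q12 by (intro add_mono mult_right_mono) auto
      also have "\<dots> \<le> m\<^sup>2 * dot v2 v2 + m\<^sup>2 * dot v2 v2 + m\<^sup>2 * dot v2 v2"
        using Q12 by (intro add_mono mult_left_mono) auto
      finally have "m\<^sup>2 * dot v2 v2 \<le> 0" by (simp add: mult.commute)
      moreover have "m\<^sup>2 * dot v2 v2 > 0" using m2 Q1 Q12 by simp
      ultimately show False by simp
    qed
    have "r = 0"
    proof (rule ccontr)
      assume "r \<noteq> 0"
      then have "4 * m\<^sup>2 * dot v1 v1 \<le> 4 * (m\<^sup>2 * dot r r)" using min1'[OF r] m2 by simp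
      also have "\<dots> = 4 * \<alpha>\<^sup>2 * dot v1 v1" unfolding eq by (simp add: \<beta>0)
      also have "\<dots> \<le> m\<^sup>2 * dot v1 v1" using a2 Q1 by (intro mult_right_mono) auto
      finally have "m\<^sup>2 * dot v1 v1 \<le> 0" by (simp add: mult.commute)
      moreover have "m\<^sup>2 * dot v1 v1 > 0" using m2 Q1 by simp
      ultimately show False by simp
    qed
    then have "z $ k = v1 $ k * s + v2 $ k * t" for k
      by (simp add: r_def vec_eq_iff algebra_simps)
    then show ?thesis by blast
  qed
  then show ?thesis using v1(1) v2 Q1 Q12 Q2T c by blast
qed

text \<open>Reducedness makes the cross term at most half of the diagonal part, so the quadratic
  form is at least half of its diagonal part.\<close>

lemma reduced_basis_coordinates:
  assumes Q: "dot v1 v1 \<le> dot v2 v2" and c: "2 * \<bar>dot v1 v2\<bar> \<le> dot v1 v1"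
    and z: "\<And>k. z $ k = v1 $ k * u + v2 $ k * w"
  shows "u\<^sup>2 * dot v1 v1 + w\<^sup>2 * dot v2 v2 \<le> 2 * dot z z"
proof -
  have eq: "dot z z = u\<^sup>2 * dot v1 v1 + 2 * u * w * dot v1 v2 + w\<^sup>2 * dot v2 v2"
    using dot_combination[of 1 z u v1 w v2] z by (simp add: mult.commute)
  have "- (4 * u * w * dot v1 v2) \<le> \<bar>4 * u * w * dot v1 v2\<bar>" by simp
  also have "\<dots> = (2 * \<bar>u\<bar> * \<bar>w\<bar>) * (2 * \<bar>dot v1 v2\<bar>)" by (simp add: abs_mult)
  also have "\<dots> \<le> (u\<^sup>2 + w\<^sup>2) * dot v1 v1"
  proof (rule mult_mono)
    show "2 * \<bar>u\<bar> * \<bar>w\<bar> \<le> u\<^sup>2 + w\<^sup>2"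
      using zero_le_power2[of "\<bar>u\<bar> - \<bar>w\<bar>"] by (simp add: power2_diff)
  qed (use c in auto)
  also have "\<dots> \<le> u\<^sup>2 * dot v1 v1 + w\<^sup>2 * dot v2 v2"
    using Q by (simp add: distrib_right mult_left_mono)
  finally show ?thesis unfolding eq by (simp add: algebra_simps)
qed

subsection \<open>The curve and its lattice of squares\<close>

lemma sum_two_indices:
  fixes f :: "4 \<Rightarrow> 'a::comm_monoid_add"
  assumes "i \<noteq> j" "\<And>k. k \<noteq> i \<Longrightarrow> k \<noteq> j \<Longrightarrow> f k = 0"
  shows "(\<Sum>k\<in>UNIV. f k) = f i + f j"
proof -
  have "(\<Sum>k\<in>UNIV. f k) = (\<Sum>k\<in>{i, j}. f k)"
    by (rule sum.mono_neutral_right) (use assms in auto)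
  then show ?thesis using assms(1) by simp
qed

text \<open>If the minor vanished, some point supported on the coordinates \<open>i\<close> and
  \<open>j\<close> would lie on both quadrics. There the Jacobian is zero outside the columns
  \<open>i\<close> and \<open>j\<close>, and on these its rows are dependent.\<close>

lemma nonsingular_plucker_nonzero:
  assumes ns: "nonsingular_ci a b" and ij: "i \<noteq> j"
  shows "plucker a b i j \<noteq> 0"
proof
  assume "plucker a b i j = 0"
  then have ab: "a $ i * b $ j = a $ j * b $ i" by (simp add: plucker_def)
  define A where "A k = complex_of_int (a $ k)" for k
  define B where "B k = complex_of_int (b $ k)" for k
  have AB: "A i * B j = A j * B i"
    unfolding A_def B_def of_int_mult[symmetric] of_int_eq_iff by (rule ab)
  \<comment> \<open>\<open>(s ^ 2, t ^ 2)\<close> has to lie in the kernel of the singular 2 by 2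
    block; a nonzero row such as \<open>(A i, A j)\<close> suggests
    \<open>(A j, - A i)\<close>.\<close>
  have "\<exists>s t. (s \<noteq> 0 \<or> t \<noteq> 0) \<and> A i * s\<^sup>2 + A j * t\<^sup>2 = 0 \<and> B i * s\<^sup>2 + B j * t\<^sup>2 = 0"
  proof (cases "A i = 0 \<and> A j = 0")
    case False
    then have "csqrt (A j) \<noteq> 0 \<or> csqrt (- A i) \<noteq> 0" by auto
    moreover have "A i * (csqrt (A j))\<^sup>2 + A j * (csqrt (- A i))\<^sup>2 = 0"
      "B i * (csqrt (A j))\<^sup>2 + B j * (csqrt (- A i))\<^sup>2 = 0"
      using AB by (simp_all add: mult.commute)
    ultimately show ?thesis by blast
  next
    case A0: True
    show ?thesis
    proof (cases "B i = 0 \<and> B j = 0")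
      case False
      then have "csqrt (B j) \<noteq> 0 \<or> csqrt (- B i) \<noteq> 0" by auto
      moreover have "A i * (csqrt (B j))\<^sup>2 + A j * (csqrt (- B i))\<^sup>2 = 0"
        "B i * (csqrt (B j))\<^sup>2 + B j * (csqrt (- B i))\<^sup>2 = 0"
        using A0 by (simp_all add: mult.commute)
      ultimately show ?thesis by blast
    next
      case True
      then show ?thesis using A0 by (intro exI[of _ 1]) simp
    qed
  qed
  then obtain s t where st: "s \<noteq> 0 \<or> t \<noteq> 0" "A i * s\<^sup>2 + A j * t\<^sup>2 = 0" "B i * s\<^sup>2 + B j * t\<^sup>2 = 0"
    by blast
  \<comment> \<open>A linear relation between the rows of the block, read off from a nonzero
    column.\<close>
  have "\<exists>l m. (l \<noteq> 0 \<or> m \<noteq> 0) \<and> l * A i + m * B i = 0 \<and> l * A j + m * B j = 0"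
  proof (cases "A i = 0 \<and> B i = 0")
    case False
    then show ?thesis using AB by (intro exI[of _ "B i"] exI[of _ "- A i"]) (auto simp: mult.commute)
  next
    case i0: True
    show ?thesis
    proof (cases "A j = 0 \<and> B j = 0")
      case False
      then show ?thesis using i0 by (intro exI[of _ "B j"] exI[of _ "- A j"]) (auto simp: mult.commute)
    next
      case True
      then show ?thesis using i0 by (intro exI[of _ 1]) simp
    qed
  qed
  then obtain l m where lm: "l \<noteq> 0 \<or> m \<noteq> 0" "l * A i + m * B i = 0" "l * A j + m * B j = 0" by blast
  define x :: "complex ^ 4" where "x = (\<chi> k. if k = i then s else if k = j then t else 0)"
  have xi: "x $ i = s" "x $ j = t" using ij by (auto simp: x_def)
  have x0: "x $ k = 0" if "k \<noteq> i" "k \<noteq> j" for k using that by (simp add: x_def)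
  have "x \<noteq> 0" using st(1) xi by auto
  moreover have "diag_form a x = 0"
    unfolding diag_form_def by (subst sum_two_indices[OF ij]) (use st x0 xi in \<open>simp_all add: A_def\<close>)
  moreover have "diag_form b x = 0"
    unfolding diag_form_def by (subst sum_two_indices[OF ij]) (use st x0 xi in \<open>simp_all add: B_def\<close>)
  ultimately have rk: "rank (jacobian a b x) = 2" using ns by (auto simp: nonsingular_ci_def)
  define J where "J = jacobian a b x"
  have J1: "J $ 1 $ k = 2 * A k * x $ k" and J2: "J $ 2 $ k = 2 * B k * x $ k" for k
    by (simp_all add: J_def jacobian_def diag_grad_def A_def B_def)
  have dep: "l * J $ 1 $ k + m * J $ 2 $ k = 0" for k
  proof -
    have "l * J $ 1 $ k + m * J $ 2 $ k = 2 * x $ k * (l * A k + m * B k)"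
      by (simp add: J1 J2 algebra_simps)
    also have "\<dots> = 0" using lm x0 by (cases "k = i"; cases "k = j") auto
    finally show ?thesis .
  qed
  have rows: "rows J \<subseteq> {J $ 1, J $ 2}"
  proof
    fix r assume "r \<in> rows J"
    then obtain h where "r = J $ h" by (auto simp: rows_def row_def vec_nth_inverse)
    then show "r \<in> {J $ 1, J $ 2}" using exhaust_2[of h] by auto
  qed
  have "\<exists>r. {J $ 1, J $ 2} \<subseteq> vec.span {r}"
  proof (cases "l = 0")
    case True
    then have "J $ 2 = 0" using dep lm(1) by (simp add: vec_eq_iff)
    then have "{J $ 1, J $ 2} \<subseteq> vec.span {J $ 1}" by (simp add: vec.span_base vec.span_zero)
    then show ?thesis by blast
  next
    case False
    have eq: "J $ 1 = (- m / l) *s (J $ 2)"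
    proof -
      have "J $ 1 $ k = - m / l * J $ 2 $ k" for k
        using dep[of k] False by (simp add: field_simps eq_neg_iff_add_eq_0)
      then show ?thesis by (simp add: vec_eq_iff)
    qed
    have "J $ 1 \<in> vec.span {J $ 2}" unfolding eq by (rule vec.span_scale[OF vec.span_base]) simp
    then have "{J $ 1, J $ 2} \<subseteq> vec.span {J $ 2}" by (simp add: vec.span_base)
    then show ?thesis by blast
  qed
  then obtain r where "{J $ 1, J $ 2} \<subseteq> vec.span {r}" by blast
  then have "rows J \<subseteq> vec.span {r}" using rows by blast
  then have "vec.dim (rows J) \<le> card {r}" by (rule vec.dim_le_card) simp
  then show False using rk by (simp add: J_def row_rank_def_gen)
qed

section \<open>Duality between the minors of \<open>a, b\<close> and those of the lattice orthogonal
  to them\<close>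

definition square_lattice :: "int ^ 4 \<Rightarrow> int ^ 4 \<Rightarrow> (int ^ 4) set" where
  "square_lattice a b = {y. (\<Sum>k\<in>UNIV. a $ k * y $ k) = 0 \<and> (\<Sum>k\<in>UNIV. b $ k * y $ k) = 0}"

lemma plucker_swap: "plucker a b j i = - plucker a b i j"
  by (simp add: plucker_def)

text \<open>Coordinate \<open>l\<close> is eliminated from the two equations: \<open>a_l\<close>
  times the second minus \<open>b_l\<close> times the first.\<close>

lemma square_lattice_relation:
  assumes "y \<in> square_lattice a b"
  shows "plucker a b l 0 * y $ 0 + plucker a b l 1 * y $ 1 + plucker a b l 2 * y $ 2 + plucker a b l 3 * y $ 3 = 0"
proof -
  have a: "a $ 0 * y $ 0 + a $ 1 * y $ 1 + a $ 2 * y $ 2 + a $ 3 * y $ 3 = 0"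
    and b: "b $ 0 * y $ 0 + b $ 1 * y $ 1 + b $ 2 * y $ 2 + b $ 3 * y $ 3 = 0"
    using assms by (auto simp: square_lattice_def sum_4_from_0)
  have "plucker a b l 0 * y $ 0 + plucker a b l 1 * y $ 1 + plucker a b l 2 * y $ 2 + plucker a b l 3 * y $ 3
    = a $ l * (b $ 0 * y $ 0 + b $ 1 * y $ 1 + b $ 2 * y $ 2 + b $ 3 * y $ 3)
      - b $ l * (a $ 0 * y $ 0 + a $ 1 * y $ 1 + a $ 2 * y $ 2 + a $ 3 * y $ 3)"
    by (simp add: plucker_def algebra_simps)
  then show ?thesis by (simp only: a b)
qed

text \<open>Up to sign and a common factor, the minors of two vectors orthogonal to
  \<open>a, b\<close> are the complementary minors of \<open>a, b\<close>. The factor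
  \<open>plucker x y 2 3 / plucker a b 0 1\<close> is written without division.\<close>

lemma square_lattice_dual_plucker:
  assumes x: "x \<in> square_lattice a b" and y: "y \<in> square_lattice a b"
    and nz: "plucker a b 0 2 \<noteq> 0"
  shows "plucker a b 0 1 * plucker x y 0 1 = plucker a b 2 3 * plucker x y 2 3"
    and "plucker a b 0 1 * plucker x y 0 2 = - plucker a b 1 3 * plucker x y 2 3"
    and "plucker a b 0 1 * plucker x y 0 3 = plucker a b 1 2 * plucker x y 2 3"
    and "plucker a b 0 1 * plucker x y 1 2 = plucker a b 0 3 * plucker x y 2 3"
    and "plucker a b 0 1 * plucker x y 1 3 = - plucker a b 0 2 * plucker x y 2 3"
proof -
  let ?d = "plucker a b"
  have d0: "?d l l = 0" for l by (simp add: plucker_def)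
  have R0: "?d 0 1 * z $ 1 + ?d 0 2 * z $ 2 + ?d 0 3 * z $ 3 = 0"
    and R1: "- ?d 0 1 * z $ 0 + ?d 1 2 * z $ 2 + ?d 1 3 * z $ 3 = 0"
    and R2: "- ?d 0 2 * z $ 0 - ?d 1 2 * z $ 1 + ?d 2 3 * z $ 3 = 0"
    if "z \<in> square_lattice a b" for z
    using square_lattice_relation[OF that, of 0] square_lattice_relation[OF that, of 1]
      square_lattice_relation[OF that, of 2] plucker_swap[of a b 1 0] plucker_swap[of a b 2 0] plucker_swap[of a b 2 1]
    by (simp_all add: d0)
  note X = R0[OF x] R1[OF x] R2[OF x] and Y = R0[OF y] R1[OF y] R2[OF y]
  show "?d 0 1 * plucker x y 0 2 = - ?d 1 3 * plucker x y 2 3"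
    unfolding plucker_def[of x y] using X(2) Y(2) by algebra
  show "?d 0 1 * plucker x y 0 3 = ?d 1 2 * plucker x y 2 3"
    unfolding plucker_def[of x y] using X(2) Y(2) by algebra
  show "?d 0 1 * plucker x y 1 2 = ?d 0 3 * plucker x y 2 3"
    unfolding plucker_def[of x y] using X(1) Y(1) by algebra
  show e13: "?d 0 1 * plucker x y 1 3 = - ?d 0 2 * plucker x y 2 3"
    unfolding plucker_def[of x y] using X(1) Y(1) by algebra
  \<comment> \<open>The indices 0 1 are reached from 1 3 by the relation without coordinate 2, at
    the price of cancelling \<open>plucker a b 0 2\<close>.\<close>
  have "?d 0 2 * plucker x y 0 1 = - ?d 2 3 * plucker x y 1 3"
    unfolding plucker_def[of x y] using X(3) Y(3) by algebra
  then have "?d 0 2 * (?d 0 1 * plucker x y 0 1) = ?d 0 2 * (?d 2 3 * plucker x y 2 3)"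
    using e13 by algebra
  then show "?d 0 1 * plucker x y 0 1 = ?d 2 3 * plucker x y 2 3" using nz by simp
qed

text \<open>Coordinates 2 and 3 determine a lattice vector when \<open>plucker a b 0 1\<close> is
  nonzero, and in these two coordinates the claim is an identity of 2 by 2 determinants.\<close>

lemma square_lattice_rank:
  assumes x: "x \<in> square_lattice a b" and y: "y \<in> square_lattice a b" and z: "z \<in> square_lattice a b"
    and nz: "plucker a b 0 1 \<noteq> 0"
  shows "plucker x y 2 3 * z $ k = plucker z y 2 3 * x $ k + plucker x z 2 3 * y $ k"
proof -
  let ?d = "plucker a b"
  have d0: "?d l l = 0" for l by (simp add: plucker_def)
  have R0: "?d 0 1 * z $ 1 + ?d 0 2 * z $ 2 + ?d 0 3 * z $ 3 = 0"
    and R1: "- ?d 0 1 * z $ 0 + ?d 1 2 * z $ 2 + ?d 1 3 * z $ 3 = 0"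
    if "z \<in> square_lattice a b" for z
    using square_lattice_relation[OF that, of 0] square_lattice_relation[OF that, of 1] plucker_swap[of a b 1 0]
    by (simp_all add: d0)
  have "?d 0 1 * (plucker x y 2 3 * z $ 0) = ?d 0 1 * (plucker z y 2 3 * x $ 0 + plucker x z 2 3 * y $ 0)"
    unfolding plucker_def[of x] plucker_def[of z] using R1[OF x] R1[OF y] R1[OF z] by algebra
  moreover have "?d 0 1 * (plucker x y 2 3 * z $ 1) = ?d 0 1 * (plucker z y 2 3 * x $ 1 + plucker x z 2 3 * y $ 1)"
    unfolding plucker_def[of x] plucker_def[of z] using R0[OF x] R0[OF y] R0[OF z] by algebra
  moreover have "plucker x y 2 3 * z $ 2 = plucker z y 2 3 * x $ 2 + plucker x z 2 3 * y $ 2"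
    "plucker x y 2 3 * z $ 3 = plucker z y 2 3 * x $ 3 + plucker x z 2 3 * y $ 3"
    by (simp_all add: plucker_def algebra_simps)
  ultimately show ?thesis using nz index_cases[of k] by auto
qed

lemma symmetric_index_cases:
  fixes i j :: 4
  assumes "i \<noteq> j" "\<And>k l. P k l \<Longrightarrow> P l k" "P 0 1" "P 0 2" "P 0 3" "P 1 2" "P 1 3" "P 2 3"
  shows "P i j"
  using index_cases[of i] index_cases[of j] assms by (elim disjE) simp_all

lemma dual_plucker_abs:
  assumes x: "x \<in> square_lattice a b" and y: "y \<in> square_lattice a b"
    and nz: "plucker a b 0 2 \<noteq> 0" and ij: "i \<noteq> j"
  shows "\<exists>k l. k \<noteq> l \<and> \<bar>plucker a b 0 1 * plucker x y k l\<bar> = \<bar>plucker a b i j * plucker x y 2 3\<bar>"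
    and "\<exists>k l. k \<noteq> l \<and> \<bar>plucker a b 0 1 * plucker x y i j\<bar> = \<bar>plucker a b k l * plucker x y 2 3\<bar>"
proof -
  note D = square_lattice_dual_plucker[OF x y nz]
  have E: "\<bar>plucker a b 0 1 * plucker x y 0 1\<bar> = \<bar>plucker a b 2 3 * plucker x y 2 3\<bar>"
    "\<bar>plucker a b 0 1 * plucker x y 0 2\<bar> = \<bar>plucker a b 1 3 * plucker x y 2 3\<bar>"
    "\<bar>plucker a b 0 1 * plucker x y 0 3\<bar> = \<bar>plucker a b 1 2 * plucker x y 2 3\<bar>"
    "\<bar>plucker a b 0 1 * plucker x y 1 2\<bar> = \<bar>plucker a b 0 3 * plucker x y 2 3\<bar>"
    "\<bar>plucker a b 0 1 * plucker x y 1 3\<bar> = \<bar>plucker a b 0 2 * plucker x y 2 3\<bar>"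
    "\<bar>plucker a b 0 1 * plucker x y 2 3\<bar> = \<bar>plucker a b 0 1 * plucker x y 2 3\<bar>"
    unfolding D by (simp_all add: abs_mult)
  have dist: "(0 :: 4) \<noteq> 1" "(0 :: 4) \<noteq> 2" "(0 :: 4) \<noteq> 3" "(1 :: 4) \<noteq> 2" "(1 :: 4) \<noteq> 3" "(2 :: 4) \<noteq> 3"
    by simp_all
  show "\<exists>k l. k \<noteq> l \<and> \<bar>plucker a b 0 1 * plucker x y k l\<bar> = \<bar>plucker a b i j * plucker x y 2 3\<bar>"
  proof (rule symmetric_index_cases[OF ij])
    fix i j assume "\<exists>k l. k \<noteq> l \<and> \<bar>plucker a b 0 1 * plucker x y k l\<bar> = \<bar>plucker a b i j * plucker x y 2 3\<bar>"
    then show "\<exists>k l. k \<noteq> l \<and> \<bar>plucker a b 0 1 * plucker x y k l\<bar> = \<bar>plucker a b j i * plucker x y 2 3\<bar>"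
      by (simp add: plucker_swap[of a b j i])
  qed (use E dist in blast)+
  show "\<exists>k l. k \<noteq> l \<and> \<bar>plucker a b 0 1 * plucker x y i j\<bar> = \<bar>plucker a b k l * plucker x y 2 3\<bar>"
  proof (rule symmetric_index_cases[OF ij])
    fix i j assume "\<exists>k l. k \<noteq> l \<and> \<bar>plucker a b 0 1 * plucker x y i j\<bar> = \<bar>plucker a b k l * plucker x y 2 3\<bar>"
    then show "\<exists>k l. k \<noteq> l \<and> \<bar>plucker a b 0 1 * plucker x y j i\<bar> = \<bar>plucker a b k l * plucker x y 2 3\<bar>"
      by (simp add: plucker_swap[of x y j i])
  qed (use E dist in blast)+
qed

text \<open>Up to order and sign, the minors of \<open>x, y\<close> are \<kappa> times the primitive
  vector of all \<open>d_ij / g\<close>. Since \<kappa> is a nonzero integer, \<open>H(C)\<close> is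
  at most the absolute value of some minor of \<open>x, y\<close>, hence at most the product of
  their lengths.\<close>

lemma curve_height_le:
  assumes d: "\<And>i j. i \<noteq> j \<Longrightarrow> plucker a b i j \<noteq> 0"
    and x: "x \<in> square_lattice a b" and y: "y \<in> square_lattice a b" and m: "plucker x y 2 3 \<noteq> 0"
  shows "curve_height a b > 0" and "(curve_height a b)\<^sup>2 \<le> real_of_int (dot x x * dot y y)"
proof -
  define D where "D = {plucker a b i j | i j. i < j}"
  define A where "A = {\<bar>plucker a b i j\<bar> | i j. i < j}"
  define g where "g = Gcd D"
  have d01: "plucker a b 0 1 \<noteq> 0" and d02: "plucker a b 0 2 \<noteq> 0" using d[of 0 1] d[of 0 2] by simp_all
  have fin: "finite A"
  proof -
    have "A = (\<lambda>(i, j). \<bar>plucker a b i j\<bar>) ` {(i, j). i < j}" by (auto simp: A_def)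
    then show ?thesis by simp
  qed
  have lt: "(0 :: 4) < 1 \<or> (1 :: 4) < 0" by (simp add: neq_iff[symmetric])
  then have ne: "A \<noteq> {}" "\<exists>e\<in>D. e \<noteq> 0" using d by (auto simp: A_def D_def) (metis less_irrefl)+
  have g0: "g > 0"
  proof -
    have "g \<noteq> 0" using ne(2) unfolding g_def by (auto simp: Gcd_0_iff)
    moreover have "g \<ge> 0" unfolding g_def by simp
    ultimately show ?thesis by simp
  qed
  \<comment> \<open>Integrality of \<kappa>: the divisibility holds for each minor \<open>e\<close>
    of \<open>a, b\<close>, and therefore for their gcd \<open>g\<close>.\<close>
  have "plucker a b 0 1 dvd plucker x y 2 3 * e" if "e \<in> D" for e
  proof -
    obtain i j where "i < j" and e: "e = plucker a b i j" using \<open>e \<in> D\<close> by (auto simp: D_def)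
    then have "i \<noteq> j" by simp
    then obtain k l where "\<bar>plucker a b 0 1 * plucker x y k l\<bar> = \<bar>e * plucker x y 2 3\<bar>"
      using dual_plucker_abs(1)[OF x y d02] e by blast
    then have "plucker a b 0 1 dvd \<bar>e * plucker x y 2 3\<bar>"
      by (metis dvd_abs_iff dvd_triv_left)
    then show ?thesis by (simp add: mult.commute)
  qed
  then have "plucker a b 0 1 dvd Gcd ((*) (plucker x y 2 3) ` D)" by (intro Gcd_greatest) auto
  also have "Gcd ((*) (plucker x y 2 3) ` D) = \<bar>plucker x y 2 3 * g\<bar>"
    by (simp add: Gcd_mult g_def abs_mult)
  finally have "plucker a b 0 1 dvd plucker x y 2 3 * g" by simp
  then obtain \<kappa> where \<kappa>: "plucker x y 2 3 * g = plucker a b 0 1 * \<kappa>" ..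
  have \<kappa>0: "\<kappa> \<noteq> 0" using \<kappa> m g0 by auto
  have bound: "(plucker a b i j)\<^sup>2 \<le> g\<^sup>2 * (dot x x * dot y y)" if ne': "i \<noteq> j" for i j
  proof -
    obtain k l where kl: "k \<noteq> l" "\<bar>plucker a b 0 1 * plucker x y k l\<bar> = \<bar>plucker a b i j * plucker x y 2 3\<bar>"
      using dual_plucker_abs(1)[OF x y d02 ne'] by blast
    have "\<bar>plucker a b 0 1\<bar> * \<bar>plucker x y k l * g\<bar> = \<bar>plucker a b 0 1 * plucker x y k l\<bar> * \<bar>g\<bar>"
      by (simp add: abs_mult)
    also have "\<dots> = \<bar>plucker a b i j\<bar> * \<bar>plucker x y 2 3 * g\<bar>" unfolding kl(2) by (simp add: abs_mult)
    also have "\<dots> = \<bar>plucker a b 0 1\<bar> * \<bar>plucker a b i j * \<kappa>\<bar>" unfolding \<kappa> by (simp add: abs_mult)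
    finally have e: "\<bar>plucker x y k l * g\<bar> = \<bar>plucker a b i j * \<kappa>\<bar>" using d01 by simp
    have "\<bar>plucker a b i j\<bar> * 1 \<le> \<bar>plucker a b i j\<bar> * \<bar>\<kappa>\<bar>" using \<kappa>0 by (intro mult_left_mono) auto
    also have "\<dots> = \<bar>g * plucker x y k l\<bar>" using e by (simp add: abs_mult mult.commute)
    finally have "\<bar>plucker a b i j\<bar> \<le> \<bar>g * plucker x y k l\<bar>" by simp
    then have "(plucker a b i j)\<^sup>2 \<le> (g * plucker x y k l)\<^sup>2" by (simp only: abs_le_square_iff)
    also have "\<dots> = g\<^sup>2 * (plucker x y k l)\<^sup>2" by (simp add: power_mult_distrib)
    also have "\<dots> \<le> g\<^sup>2 * (dot x x * dot y y)"
      by (intro mult_left_mono plucker_square_le kl(1)) auto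
    finally show ?thesis .
  qed
  have "Max A \<in> A" using fin ne(1) by (rule Max_in)
  then obtain i j where "i < j" and maxA: "Max A = \<bar>plucker a b i j\<bar>" by (auto simp: A_def)
  then have ij: "i \<noteq> j" by simp
  have H: "curve_height a b = real_of_int \<bar>plucker a b i j\<bar> / real_of_int g"
    by (simp add: curve_height_def A_def[symmetric] D_def[symmetric] g_def[symmetric] maxA)
  show "curve_height a b > 0" unfolding H using d[OF ij] g0 by simp
  have "real_of_int ((plucker a b i j)\<^sup>2) \<le> real_of_int (g\<^sup>2 * (dot x x * dot y y))"
    using bound[OF ij] by (simp only: of_int_le_iff)
  then show "(curve_height a b)\<^sup>2 \<le> real_of_int (dot x x * dot y y)"
    unfolding H power_divide using g0 by (simp add: divide_le_eq mult.commute)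
qed

section \<open>From rational points to primitive vectors, and the final estimate\<close>

lemma points_as_primitive_vectors:
  "\<exists>S. card S = count_points a b B \<and>
    (\<forall>x\<in>S. primitive x \<and> (\<forall>k. \<bar>real_of_int (x $ k)\<bar> \<le> B) \<and> (\<chi> k. (x $ k)\<^sup>2) \<in> square_lattice a b)"
proof -
  define T where "T = {P \<in> curve_points a b. real_of_int (point_height P) \<le> B}"
  define f where "f P = (SOME x. primitive x \<and> rat_vec x \<in> P)" for P
  have TP: "P \<in> proj3Q" if "P \<in> T" for P using that by (auto simp: T_def curve_points_def)
  have f: "primitive (f P)" "rat_vec (f P) \<in> P" if "P \<in> T" for P
    using someI_ex[OF ex_primitive[OF TP[OF that]]] by (auto simp: f_def)
  have sub: "P \<subseteq> P'" if P: "P \<in> proj3Q" "P' \<in> proj3Q" and z: "z \<in> P" "z \<in> P'" for P P' z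
  proof
    fix y assume "y \<in> P"
    then obtain c where c: "c \<noteq> 0" "y = c *s z" using proj_class_proportional[OF P(1) z(1)] by blast
    obtain z0 d where z0: "z0 \<noteq> 0" "P' = proj_rel `` {z0}" and d: "d \<noteq> 0" "z = d *s z0"
      using P(2) z(2) by (auto simp: proj3Q_def quotient_def proj_rel_def)
    have "y = (c * d) *s z0" "c * d \<noteq> 0" using c d by auto
    moreover from this have "y \<noteq> 0" using z0(1) by simp
    ultimately show "y \<in> P'" using z0 by (auto simp: proj_rel_def)
  qed
  have inj: "inj_on f T"
  proof (rule inj_onI)
    fix P P' assume PP: "P \<in> T" "P' \<in> T" "f P = f P'"
    then have "rat_vec (f P) \<in> P" "rat_vec (f P) \<in> P'" using f(2) by metis+
    then show "P = P'" using sub TP PP(1,2) by blast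
  qed
  have "primitive x \<and> (\<forall>k. \<bar>real_of_int (x $ k)\<bar> \<le> B) \<and> (\<chi> k. (x $ k)\<^sup>2) \<in> square_lattice a b" if xS: "x \<in> f ` T" for x
  proof -
    obtain P where P: "P \<in> T" "x = f P" using xS by blast
    have x: "primitive x" "rat_vec x \<in> P" using f[OF P(1)] P(2) by auto
    have "\<bar>real_of_int (x $ k)\<bar> \<le> B" for k
    proof -
      have "\<bar>x $ k\<bar> \<le> point_height P"
        unfolding point_height_eq[OF TP[OF P(1)] x] by (rule Max_ge) auto
      then show ?thesis using P(1) by (simp add: T_def) linarith
    qed
    moreover have "diag_form a (rat_vec x) = 0" "diag_form b (rat_vec x) = 0"
      using P(1) x(2) by (auto simp: T_def curve_points_def)
    then have "rat_of_int (\<Sum>k\<in>UNIV. a $ k * (x $ k)\<^sup>2) = rat_of_int 0" "rat_of_int (\<Sum>k\<in>UNIV. b $ k * (x $ k)\<^sup>2) = rat_of_int 0"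
      by (simp_all add: diag_form_def rat_vec_def)
    then have "(\<chi> k. (x $ k)\<^sup>2) \<in> square_lattice a b"
      unfolding of_int_eq_iff by (simp add: square_lattice_def)
    ultimately show ?thesis using x(1) by blast
  qed
  moreover have "card (f ` T) = count_points a b B"
    using card_image[OF inj] by (simp add: count_points_def T_def)
  ultimately show ?thesis by blast
qed

text \<open>The maximum separates the degenerate case, where no two vectors of squares are
  independent and so no bound for a reduced basis is at hand, from the case treated by the
  determinant method.\<close>

lemma count_points_le_height:
  fixes \<epsilon> :: real
  assumes "\<epsilon> > 0"
  shows "\<exists>K>0. \<forall>(a :: int ^ 4) (b :: int ^ 4) (B :: real). nonsingular_ci a b \<longrightarrow> B \<ge> 1 \<longrightarrow>
     real (count_points a b B) \<le> max 16 (K * (B powr (1/2 + \<epsilon>) / curve_height a b powr (1/8)))"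
proof -
  obtain K where K: "K > 0" and main:
    "\<And>(v1 :: int ^ 4) (v2 :: int ^ 4) (S :: (int ^ 4) set) u w B U W.
     B \<ge> 1 \<Longrightarrow> U > 0 \<Longrightarrow> W > 0 \<Longrightarrow> W \<le> 3 * B\<^sup>2 \<Longrightarrow> U * W \<ge> 1 \<Longrightarrow>
     (\<forall>i j. i \<noteq> j \<longrightarrow> plucker v1 v2 i j \<noteq> 0 \<and> \<bar>real_of_int (plucker v1 v2 i j)\<bar> \<le> 4 * B ^ 4) \<Longrightarrow>
     (\<forall>x\<in>S. primitive x \<and> (\<forall>k. (x $ k)\<^sup>2 = v1 $ k * u x + v2 $ k * w x) \<and> (\<forall>k. \<bar>real_of_int (x $ k)\<bar> \<le> B)
        \<and> \<bar>real_of_int (u x)\<bar> \<le> U \<and> \<bar>real_of_int (w x)\<bar> \<le> W) \<Longrightarrow>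
     real (card S) \<le> K * (B powr \<epsilon> * (U * W) powr (1/8))"
    using four_linear_squares_count[OF assms] by blast
  have "real (count_points a b B) \<le> max 16 (8 * K * (B powr (1/2 + \<epsilon>) / curve_height a b powr (1/8)))"
    if ns: "nonsingular_ci a b" and B: "B \<ge> 1" for a b :: "int ^ 4" and B :: real
  proof -
    define H where "H = curve_height a b"
    define \<Lambda> where "\<Lambda> = square_lattice a b"
    define sqv where "sqv x = (\<chi> k. (x $ k)\<^sup>2)" for x :: "int ^ 4"
    have d: "plucker a b i j \<noteq> 0" if "i \<noteq> j" for i j by (rule nonsingular_plucker_nonzero[OF ns that])
    have d01: "plucker a b 0 1 \<noteq> 0" and d02: "plucker a b 0 2 \<noteq> 0" using d[of 0 1] d[of 0 2] by simp_all
    obtain S where card: "card S = count_points a b B" and S: "\<And>x. x \<in> S \<Longrightarrow> primitive x"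
      "\<And>x k. x \<in> S \<Longrightarrow> \<bar>real_of_int (x $ k)\<bar> \<le> B" "\<And>x. x \<in> S \<Longrightarrow> sqv x \<in> \<Lambda>"
      using points_as_primitive_vectors[of a b B] unfolding sqv_def \<Lambda>_def by blast
    have sqv: "sqv x $ k = (x $ k)\<^sup>2" for x k by (simp add: sqv_def)
    show ?thesis
    proof (cases "\<exists>x\<in>S. \<exists>y\<in>S. plucker (sqv x) (sqv y) 2 3 \<noteq> 0")
      case False
      have "card S \<le> 16"
      proof (cases "S = {}")
        case ne: False
        then obtain y where y: "y \<in> S" by blast
        have "\<bar>x $ k\<bar> = \<bar>y $ k\<bar>" if x: "x \<in> S" for x k
        proof (rule primitive_parallel_squares[OF S(1)[OF x] S(1)[OF y]])
          fix k l
          have m: "plucker (sqv x) (sqv y) 2 3 = 0" using False x y by blast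
          have "plucker (sqv x) (sqv y) k l = 0"
          proof (cases "k = l")
            case True
            then show ?thesis by (simp add: plucker_def)
          next
            case kl: False
            from dual_plucker_abs(2)[OF S(3)[OF x, unfolded \<Lambda>_def] S(3)[OF y, unfolded \<Lambda>_def] d02 kl]
            show ?thesis using m d01 by auto
          qed
          then show "(x $ k)\<^sup>2 * (y $ l)\<^sup>2 = (x $ l)\<^sup>2 * (y $ k)\<^sup>2" by (simp add: plucker_def sqv)
        qed
        then have "S \<subseteq> {x. \<forall>k. \<bar>x $ k\<bar> = \<bar>y $ k\<bar>}" by blast
        from card_mono[OF card_same_abs(1) this] show ?thesis using card_same_abs(2)[of y] by linarith
      qed simp
      then show ?thesis unfolding card[symmetric] by simp
    next
      case True
      then obtain y1 y2 where y: "y1 \<in> S" "y2 \<in> S" "plucker (sqv y1) (sqv y2) 2 3 \<noteq> 0" by blast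
      \<comment> \<open>The vector \<open>sqv x\<close> has four entries of size at most
        \<open>B ^ 2\<close>, so its squared length is at most \<open>4 * B ^ 4\<close>.\<close>
      define T where "T = \<lfloor>4 * B ^ 4\<rfloor>"
      have B4: "B ^ 4 \<ge> 1" using B by simp
      have dotS: "real_of_int (dot (sqv x) (sqv x)) \<le> 4 * B ^ 4" if x: "x \<in> S" for x
      proof -
        have "real_of_int (sqv x $ k * sqv x $ k) \<le> B ^ 4" for k
        proof -
          have "\<bar>real_of_int (x $ k)\<bar> ^ 4 \<le> B ^ 4" using S(2)[OF x] by (intro power_mono) auto
          then show ?thesis by (simp add: sqv flip: power_add)
        qed
        then have "(\<Sum>k\<in>(UNIV :: 4 set). real_of_int (sqv x $ k * sqv x $ k)) \<le> (\<Sum>k\<in>(UNIV :: 4 set). B ^ 4)"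
          by (intro sum_mono)
        then show ?thesis by (simp add: dot_def)
      qed
      then have dotT: "dot (sqv x) (sqv x) \<le> T" if "x \<in> S" for x
        using that unfolding T_def by (simp add: le_floor_iff)
      have "\<exists>v1\<in>\<Lambda>. \<exists>v2\<in>\<Lambda>. plucker v1 v2 2 3 \<noteq> 0 \<and> 0 < dot v1 v1 \<and> dot v1 v1 \<le> dot v2 v2 \<and> dot v2 v2 \<le> T
        \<and> 2 * \<bar>dot v1 v2\<bar> \<le> dot v1 v1 \<and> (\<forall>z\<in>\<Lambda>. \<exists>u w. \<forall>k. z $ k = v1 $ k * u + v2 $ k * w)"
      proof (rule reduced_basis[OF _ _ _ S(3)[OF y(1)] S(3)[OF y(2)] y(3) dotT[OF y(1)] dotT[OF y(2)]])
        show "x - z \<in> \<Lambda>" if "x \<in> \<Lambda>" "z \<in> \<Lambda>" for x z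
          using that by (simp add: \<Lambda>_def square_lattice_def right_diff_distrib sum_subtractf)
        show "(\<chi> k. c * x $ k) \<in> \<Lambda>" if "x \<in> \<Lambda>" for c x
          using that by (simp add: \<Lambda>_def square_lattice_def mult.left_commute flip: sum_distrib_left)
        show "plucker x y 2 3 * z $ k = plucker z y 2 3 * x $ k + plucker x z 2 3 * y $ k"
          if "x \<in> \<Lambda>" "y \<in> \<Lambda>" "z \<in> \<Lambda>" for x y z k
          using that d01 unfolding \<Lambda>_def by (rule square_lattice_rank)
      qed
      then obtain v1 v2 where v: "v1 \<in> \<Lambda>" "v2 \<in> \<Lambda>" "plucker v1 v2 2 3 \<noteq> 0" and q: "0 < dot v1 v1" "dot v1 v1 \<le> dot v2 v2"
        "dot v2 v2 \<le> T" and c: "2 * \<bar>dot v1 v2\<bar> \<le> dot v1 v1"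
        and basis: "\<And>z. z \<in> \<Lambda> \<Longrightarrow> \<exists>u w. \<forall>k. z $ k = v1 $ k * u + v2 $ k * w" by blast
      have "\<forall>x\<in>S. \<exists>p. \<forall>k. (x $ k)\<^sup>2 = v1 $ k * fst p + v2 $ k * snd p"
      proof
        fix x assume "x \<in> S"
        from basis[OF S(3)[OF this]] obtain s t where "\<forall>k. sqv x $ k = v1 $ k * s + v2 $ k * t" by blast
        then show "\<exists>p. \<forall>k. (x $ k)\<^sup>2 = v1 $ k * fst p + v2 $ k * snd p"
          by (intro exI[of _ "(s, t)"]) (simp add: sqv)
      qed
      from bchoice[OF this] obtain p where p: "\<forall>x\<in>S. \<forall>k. (x $ k)\<^sup>2 = v1 $ k * fst (p x) + v2 $ k * snd (p x)" by blast
      define u where "u x = fst (p x)" for x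
      define w where "w x = snd (p x)" for x
      have uw: "(x $ k)\<^sup>2 = v1 $ k * u x + v2 $ k * w x" if "x \<in> S" for x k
        using p that by (simp add: u_def w_def)
      define Q1 where "Q1 = real_of_int (dot v1 v1)"
      define Q2 where "Q2 = real_of_int (dot v2 v2)"
      have Q: "1 \<le> Q1" "Q1 \<le> Q2" "Q2 \<le> 4 * B ^ 4"
        using q by (auto simp: Q1_def Q2_def T_def le_floor_iff)
      \<comment> \<open>\<open>u ^ 2 * Q1 + w ^ 2 * Q2\<close> is at most twice the squared length
        \<open>4 * B ^ 4\<close>. Both bounds are at least 1 because \<open>Q1\<close> and
        \<open>Q2\<close> do not exceed \<open>4 * B ^ 4\<close>.\<close>
      define U where "U = sqrt (8 * B ^ 4 / Q1)"
      define W where "W = sqrt (8 * B ^ 4 / Q2)"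
      have coord: "(real_of_int (u x))\<^sup>2 * Q1 + (real_of_int (w x))\<^sup>2 * Q2 \<le> 8 * B ^ 4" if x: "x \<in> S" for x
      proof -
        have "(u x)\<^sup>2 * dot v1 v1 + (w x)\<^sup>2 * dot v2 v2 \<le> 2 * dot (sqv x) (sqv x)"
          by (rule reduced_basis_coordinates[OF q(2) c]) (simp add: sqv uw[OF x])
        then have "real_of_int ((u x)\<^sup>2 * dot v1 v1 + (w x)\<^sup>2 * dot v2 v2) \<le> real_of_int (2 * dot (sqv x) (sqv x))"
          by (simp only: of_int_le_iff)
        then show ?thesis using dotS[OF x] by (simp add: Q1_def Q2_def)
      qed
      have bu: "\<bar>real_of_int (u x)\<bar> \<le> U" if x: "x \<in> S" for x
      proof -
        have "(real_of_int (u x))\<^sup>2 * Q1 \<le> 8 * B ^ 4"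
          using coord[OF x] mult_nonneg_nonneg[OF zero_le_power2[of "real_of_int (w x)"], of Q2] Q by linarith
        then have "\<bar>real_of_int (u x)\<bar>\<^sup>2 \<le> 8 * B ^ 4 / Q1" using Q by (simp add: field_simps)
        then show ?thesis unfolding U_def by (rule real_le_rsqrt)
      qed
      have bw: "\<bar>real_of_int (w x)\<bar> \<le> W" if x: "x \<in> S" for x
      proof -
        have "(real_of_int (w x))\<^sup>2 * Q2 \<le> 8 * B ^ 4"
          using coord[OF x] mult_nonneg_nonneg[OF zero_le_power2[of "real_of_int (u x)"], of Q1] Q by linarith
        then have "\<bar>real_of_int (w x)\<bar>\<^sup>2 \<le> 8 * B ^ 4 / Q2" using Q by (simp add: field_simps)
        then show ?thesis unfolding W_def by (rule real_le_rsqrt)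
      qed
      have U1: "U \<ge> 1" unfolding U_def using Q B4 by (intro real_le_rsqrt) (simp add: field_simps)
      have W1: "W \<ge> 1" unfolding W_def using Q B4 by (intro real_le_rsqrt) (simp add: field_simps)
      \<comment> \<open>The bound \<open>Y = 3 * B ^ 2\<close> for products of two coordinates has
        to dominate \<open>W\<close> too; the 3 serves since \<open>sqrt 8 < 3\<close>.\<close>
      have W3: "W \<le> 3 * B\<^sup>2"
      proof -
        have "8 * B ^ 4 / Q2 \<le> 8 * B ^ 4 / 1" using Q B4 by (intro divide_left_mono) auto
        also have "\<dots> \<le> (3 * B\<^sup>2)\<^sup>2" using B4 by (simp add: power_mult_distrib)
        finally show ?thesis unfolding W_def using B by (intro real_le_lsqrt) auto
      qed
      have UW1: "U * W \<ge> 1" using mult_mono[OF U1 W1] U1 by simp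
      have H: "H > 0" "H\<^sup>2 \<le> Q1 * Q2"
        using curve_height_le[OF d, of v1 v2] v by (auto simp: H_def \<Lambda>_def Q1_def Q2_def)
      have UWH: "U * W \<le> 8 * B ^ 4 / H"
      proof -
        have "U * W = sqrt (8 * B ^ 4 / Q1 * (8 * B ^ 4 / Q2))" by (simp only: U_def W_def real_sqrt_mult)
        also have "\<dots> \<le> 8 * B ^ 4 / H"
        proof (rule real_le_lsqrt)
          have "8 * B ^ 4 / Q1 * (8 * B ^ 4 / Q2) = (8 * B ^ 4)\<^sup>2 / (Q1 * Q2)" by (simp add: power2_eq_square)
          also have "\<dots> \<le> (8 * B ^ 4)\<^sup>2 / H\<^sup>2" using H Q by (intro divide_left_mono) auto
          also have "\<dots> = (8 * B ^ 4 / H)\<^sup>2" by (simp add: power_divide)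
          finally show "8 * B ^ 4 / Q1 * (8 * B ^ 4 / Q2) \<le> (8 * B ^ 4 / H)\<^sup>2" .
        qed (use H B4 in auto)
        finally show ?thesis .
      qed
      have pl: "\<forall>i j. i \<noteq> j \<longrightarrow> plucker v1 v2 i j \<noteq> 0 \<and> \<bar>real_of_int (plucker v1 v2 i j)\<bar> \<le> 4 * B ^ 4"
      proof (intro allI impI conjI)
        fix i j :: 4 assume ij: "i \<noteq> j"
        obtain k l where kl: "k \<noteq> l" "\<bar>plucker a b 0 1 * plucker v1 v2 i j\<bar> = \<bar>plucker a b k l * plucker v1 v2 2 3\<bar>"
          using dual_plucker_abs(2)[OF v(1,2)[unfolded \<Lambda>_def] d02 ij] by blast
        show "plucker v1 v2 i j \<noteq> 0" using kl(2) v(3) d[OF kl(1)] by auto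
        have "real_of_int ((plucker v1 v2 i j)\<^sup>2) \<le> Q1 * Q2"
          unfolding Q1_def Q2_def of_int_mult[symmetric] of_int_le_iff by (rule plucker_square_le[OF ij])
        also have "\<dots> \<le> (4 * B ^ 4) * (4 * B ^ 4)" using Q by (intro mult_mono) auto
        finally have "\<bar>real_of_int (plucker v1 v2 i j)\<bar>\<^sup>2 \<le> (4 * B ^ 4)\<^sup>2" by (simp add: power2_eq_square)
        then show "\<bar>real_of_int (plucker v1 v2 i j)\<bar> \<le> 4 * B ^ 4" by (rule power2_le_imp_le) (use B4 in simp)
      qed
      have "real (card S) \<le> K * (B powr \<epsilon> * (U * W) powr (1/8))"
        by (rule main[OF B _ _ W3 UW1 pl]) (use U1 W1 S uw bu bw in auto)
      also have "\<dots> \<le> K * (B powr \<epsilon> * (8 * (B powr (1/2) / H powr (1/8))))"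
      proof -
        \<comment> \<open>The eighth root of \<open>8 * B ^ 4 / H\<close> is the origin of
          \<open>B powr (1/2)\<close> and \<open>H powr (1/8)\<close>.\<close>
        have "(U * W) powr (1/8) \<le> (8 * B ^ 4 / H) powr (1/8)"
          using UWH UW1 by (intro powr_mono2) auto
        also have "\<dots> = 8 powr (1/8) * (B ^ 4) powr (1/8) / H powr (1/8)"
          using H B4 by (simp add: powr_divide powr_mult)
        also have "(B ^ 4) powr (1/8) = B powr (1/2)"
          using B powr_realpow[of B 4] powr_powr[of B 4 "1/8"] by simp
        also have "8 powr (1/8) * B powr (1/2) / H powr (1/8) \<le> 8 * B powr (1/2) / H powr (1/8)"
          using powr_mono[of "1/8" 1 "8 :: real"] by (intro divide_right_mono mult_right_mono) auto
        finally have "(U * W) powr (1/8) \<le> 8 * (B powr (1/2) / H powr (1/8))" by simp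
        then show ?thesis using K by (intro mult_left_mono) auto
      qed
      also have "\<dots> = 8 * K * (B powr (1/2 + \<epsilon>) / H powr (1/8))"
        by (simp add: powr_add)
      finally show ?thesis unfolding card H_def by simp
    qed
  qed
  then show ?thesis using K by (intro exI[of _ "8 * K"]) auto
qed

theorem theorem3p1:
  fixes \<epsilon> :: real
  assumes "\<epsilon> > 0"
  shows "\<exists>K > 0. \<forall>(a :: int ^ 4) (b :: int ^ 4) (B :: real).
           nonsingular_ci a b \<longrightarrow> B \<ge> 1 \<longrightarrow>
           real (count_points a b B)
             \<le> K * (B powr (1/2 + \<epsilon>) / curve_height a b powr (1/8) + ln B + 1)"
proof -
  obtain K where K: "K > 0" and main: "\<And>(a :: int ^ 4) (b :: int ^ 4) (B :: real). nonsingular_ci a b \<Longrightarrow> B \<ge> 1 \<Longrightarrow>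
     real (count_points a b B) \<le> max 16 (K * (B powr (1/2 + \<epsilon>) / curve_height a b powr (1/8)))"
    using count_points_le_height[OF assms] by blast
  show ?thesis
  proof (intro exI[of _ "K + 16"] conjI allI impI)
    show "K + 16 > 0" using K by simp
    fix a b :: "int ^ 4" and B :: real
    assume ab: "nonsingular_ci a b" and B: "B \<ge> 1"
    let ?t = "B powr (1/2 + \<epsilon>) / curve_height a b powr (1/8)"
    have t: "?t \<ge> 0" and l: "ln B \<ge> 0" using B by simp_all
    \<comment> \<open>The 16 vectors of the degenerate case go into the summand 1 of the
      bound.\<close>
    have "max 16 (K * ?t) \<le> 16 + K * ?t" using K t by simp
    also have "\<dots> \<le> (K + 16) * (?t + ln B + 1)"
    proof -
      have "16 + K * t \<le> (K + 16) * (t + l + 1)" if "t \<ge> 0" "l \<ge> 0" for t l :: real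
        using that K by (simp add: algebra_simps)
      then show ?thesis using t l by blast
    qed
    finally show "real (count_points a b B) \<le> (K + 16) * (?t + ln B + 1)"
      using main[OF ab B] by linarith
  qed
qed

end
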